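(* Let $r\ge 0$ be an integer and let $\alpha=(\alpha_0,\dots,\alpha_r)\in[0,\infty]^{r+1}$ be fixed. Let $Y=Y(n)$ be the random simplicial complex in the multi-parameter upper model determined by $\alpha$. Put $\beta_i=i+1-\alpha_i$ for $0\le i\le r$ and $\beta=\max\{\beta_0,\dots,\beta_r\}$. Assume $\beta>0$ and $\beta\notin\mathbb{Z}$, and let $\ell=\lfloor\beta\rfloor$. Define $$d=\sum_{i:\,\beta_i=\beta}\frac{1}{(i+1)\,\ell!\,(i-\ell)!},$$ $$\gamma_k=\max\{\beta_k,\dots,\beta_r\},\qquad \nu_k=2\gamma_k-k\qquad (0\le k\le r),$$ $$\ell'=\max\{k:\ \nu_k\ge 0\}.$$ Then the following holds a.a.s.: (a) $Y$ has full $(\ell-1)$-skeleton. (b) $Y$ may be collapsed into its $\ell'$-skeleton, where $\ell\le \ell'\le\lfloor 2\beta\rfloor\le 2\ell+1$. Furthermore, letting $b_k(Y)$ denote the $k$th Betti number of $Y$, for every sequence $\omega=\omega(n)\to\infty$ the following holds a.a.s.: (c) For $k<\ell$: $\tilde H_k(Y;\mathbb{Z})=0$. (d) For $k=\ell$: $b_\ell(Y)\sim d\,n^{\beta}$. (e) For $\ell<k\le\ell'$: $b_k(Y)\le\omega\, n^{\nu_k}$, where the exponents satisfy $\nu_{\ell+1}<\beta$ (if $\ell+1\le r$) and $\nu_{k+1}\le\nu_k-1$ for all $k$ with $0\le k<r$. (f) For $k>\ell'$: $\tilde H_k(Y;\mathbb{Z})=0$.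
   Context: Multi-parameter upper model: for each positive integer $n$, a random hypergraph $X=X(n)$ is a random set of non-empty subsets of the vertex set $\{0,\dots,n\}$; each simplex $\sigma$ (non-empty subset) of dimension $i=|\sigma|-1$ with $0\le i\le r$ is included in $X$ independently with probability $n^{-\alpha_i}$ (with $n^{-\infty}=0$), and no simplex of dimension $>r$ is included. The random simplicial complex $Y=Y(n)$ consists of all simplices in $X$ and all their non-empty faces. If $\alpha_i=\infty$ then $\beta_i=-\infty$, and $n^{-\infty}=0$. A property $T$ of a random object $Z=Z(n)$ holds asymptotically almost surely (a.a.s.) if the probability that $T$ holds converges to $1$ as $n\to\infty$. For a random quantity $a=a(n)$ and a deterministic quantity $b=b(n)$, "$a\sim b$ a.a.s." means that there is a (deterministic) sequence $\epsilon_n\to0$ such that $|\frac{a}{b}-1|<\epsilon_n$ a.a.s. "$Y$ has full $m$-skeleton" means $Y$ contains all simplices of dimension $\le m$ on the vertex set $\{0,\dots,n\}$. "$Y$ may be collapsed into its $m$-skeleton" means that $Y$ collapses (by a finite sequence of elementary simplicial collapses) onto a subcomplex contained in the $m$-skeleton of $Y$. $\tilde H_k$ denotes reduced homology. *)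

theory Defs
  imports "HOL-Probability.Probability" "HOL-Algebra.Free_Abelian_Groups"
begin

text \<open>
  A simplicial complex is represented by the set of its non-empty faces. All complexes that occur are
  finite; for an infinite set \<^term>\<open>card\<close> is 0 and the dimension below is meaningless.
\<close>

definition dimension :: "nat set \<Rightarrow> int" where
  "dimension \<sigma> = int (card \<sigma>) - 1"

definition generated_complex :: "nat set set \<Rightarrow> nat set set" where
  "generated_complex X = {\<tau>. \<tau> \<noteq> {} \<and> (\<exists>\<sigma>\<in>X. \<tau> \<subseteq> \<sigma>)}"

definition skeleton :: "int \<Rightarrow> nat set set \<Rightarrow> nat set set" where
  "skeleton m K = {\<sigma>\<in>K. dimension \<sigma> \<le> m}"

definition has_full_skeleton :: "nat \<Rightarrow> int \<Rightarrow> nat set set \<Rightarrow> bool" where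
  "has_full_skeleton n m K \<longleftrightarrow>
     (\<forall>\<sigma>. \<sigma> \<noteq> {} \<and> \<sigma> \<subseteq> {0..n} \<and> dimension \<sigma> \<le> m \<longrightarrow> \<sigma> \<in> K)"

definition elementary_collapse :: "nat set set \<Rightarrow> nat set set \<Rightarrow> bool" where
  "elementary_collapse K L \<longleftrightarrow>
     (\<exists>\<sigma> \<tau>. \<sigma> \<in> K \<and> \<tau> \<in> K \<and> \<sigma> \<subset> \<tau> \<and> dimension \<tau> = dimension \<sigma> + 1 \<and>
        (\<forall>\<rho>\<in>K. \<sigma> \<subset> \<rho> \<longrightarrow> \<rho> = \<tau>) \<and> L = K - {\<sigma>, \<tau>})"

text \<open>
  No separate requirement that \<open>L\<close> be a subcomplex is needed: an elementary collapse of a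
  complex removes a maximal face and a free face of it, so the result is again a complex.
\<close>

definition collapses_into_skeleton :: "int \<Rightarrow> nat set set \<Rightarrow> bool" where
  "collapses_into_skeleton m K \<longleftrightarrow>
     (\<exists>L. elementary_collapse\<^sup>*\<^sup>* K L \<and> L \<subseteq> skeleton m K)"

definition face_chain_group :: "int \<Rightarrow> nat set set \<Rightarrow> (nat set \<Rightarrow>\<^sub>0 int) monoid" where
  "face_chain_group k K = free_Abelian_group {\<sigma>\<in>K. dimension \<sigma> = k}"

text \<open>
  Simplices are oriented by the order of their vertices: the facet omitting \<open>v\<close> has sign
  $(-1)^j$, where \<open>j\<close> is the position of \<open>v\<close>. Only facets belonging to \<open>K\<close> are kept, so that
  vertices have zero boundary if the empty face is not in \<open>K\<close>, and the boundary is the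
  augmentation on vertices if it is.
\<close>

definition face_boundary :: "nat set set \<Rightarrow> (nat set \<Rightarrow>\<^sub>0 int) \<Rightarrow> (nat set \<Rightarrow>\<^sub>0 int)" where
  "face_boundary K = frag_extend
     (\<lambda>\<sigma>. \<Sum>v\<in>{v\<in>\<sigma>. \<sigma> - {v} \<in> K}. frag_cmul ((-1) ^ card {u\<in>\<sigma>. u < v}) (frag_of (\<sigma> - {v})))"

definition face_cycles :: "int \<Rightarrow> nat set set \<Rightarrow> (nat set \<Rightarrow>\<^sub>0 int) set" where
  "face_cycles k K = {c \<in> carrier (face_chain_group k K). face_boundary K c = 0}"

definition face_boundaries :: "int \<Rightarrow> nat set set \<Rightarrow> (nat set \<Rightarrow>\<^sub>0 int) set" where
  "face_boundaries k K = face_boundary K ` carrier (face_chain_group (k + 1) K)"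

definition face_homology :: "int \<Rightarrow> nat set set \<Rightarrow> (nat set \<Rightarrow>\<^sub>0 int) set monoid" where
  "face_homology k K =
     subgroup_generated (face_chain_group k K) (face_cycles k K) Mod face_boundaries k K"

definition reduced_face_homology :: "int \<Rightarrow> nat set set \<Rightarrow> (nat set \<Rightarrow>\<^sub>0 int) set monoid" where
  "reduced_face_homology k K = face_homology k (insert {} K)"

definition int_independent :: "('a, 'b) monoid_scheme \<Rightarrow> 'a set \<Rightarrow> bool" where
  "int_independent G S \<longleftrightarrow> finite S \<and> S \<subseteq> carrier G \<and>
     (\<forall>c :: 'a \<Rightarrow> int. finprod G (\<lambda>x. x [^]\<^bsub>G\<^esub> c x) S = \<one>\<^bsub>G\<^esub> \<longrightarrow> (\<forall>x\<in>S. c x = 0))"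

text \<open>The rank of a finitely generated abelian group; for groups of infinite rank the maximum
  is undefined.\<close>

definition abelian_rank :: "('a, 'b) monoid_scheme \<Rightarrow> nat" where
  "abelian_rank G = Max {card S | S. int_independent G S}"

definition betti :: "int \<Rightarrow> nat set set \<Rightarrow> nat" where
  "betti k K = abelian_rank (face_homology k K)"

text \<open>
  The parameters \<open>\<alpha> 0, \<dots>, \<alpha> r\<close> are extended reals in $[0,\infty]$; the values of \<open>\<alpha>\<close> beyond \<open>r\<close>
  play no role.
\<close>

definition inclusion_prob :: "nat \<Rightarrow> ereal \<Rightarrow> real" where
  "inclusion_prob n a = (if a = \<infinity> then 0 else real n powr (- real_of_ereal a))"

definition random_hypergraph :: "nat \<Rightarrow> (nat \<Rightarrow> ereal) \<Rightarrow> nat \<Rightarrow> nat set set pmf" where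
  "random_hypergraph r \<alpha> n =
     map_pmf (\<lambda>f. {\<sigma>. f \<sigma>})
       (Pi_pmf {\<sigma>. \<sigma> \<noteq> {} \<and> \<sigma> \<subseteq> {0..n} \<and> dimension \<sigma> \<le> int r} False
          (\<lambda>\<sigma>. bernoulli_pmf (inclusion_prob n (\<alpha> (nat (dimension \<sigma>))))))"

definition upper_model :: "nat \<Rightarrow> (nat \<Rightarrow> ereal) \<Rightarrow> nat \<Rightarrow> nat set set pmf" where
  "upper_model r \<alpha> n = map_pmf generated_complex (random_hypergraph r \<alpha> n)"

definition aas :: "(nat \<Rightarrow> 'a pmf) \<Rightarrow> (nat \<Rightarrow> 'a \<Rightarrow> bool) \<Rightarrow> bool" where
  "aas Z T \<longleftrightarrow> (\<lambda>n. measure_pmf.prob (Z n) {z. T n z}) \<longlonglongrightarrow> 1"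

definition aas_sim :: "(nat \<Rightarrow> 'a pmf) \<Rightarrow> ('a \<Rightarrow> real) \<Rightarrow> (nat \<Rightarrow> real) \<Rightarrow> bool" where
  "aas_sim Z a b \<longleftrightarrow>
     (\<exists>\<epsilon> :: nat \<Rightarrow> real. \<epsilon> \<longlonglongrightarrow> 0 \<and> aas Z (\<lambda>n z. \<bar>a z / b n - 1\<bar> < \<epsilon> n))"

definition beta_at :: "(nat \<Rightarrow> ereal) \<Rightarrow> nat \<Rightarrow> ereal" where
  "beta_at \<alpha> i = ereal (real i + 1) - \<alpha> i"

definition beta_max :: "nat \<Rightarrow> (nat \<Rightarrow> ereal) \<Rightarrow> ereal" where
  "beta_max r \<alpha> = Max (beta_at \<alpha> ` {0..r})"

definition gamma_at :: "nat \<Rightarrow> (nat \<Rightarrow> ereal) \<Rightarrow> nat \<Rightarrow> ereal" where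
  "gamma_at r \<alpha> k = Max (beta_at \<alpha> ` {k..r})"

definition nu_at :: "nat \<Rightarrow> (nat \<Rightarrow> ereal) \<Rightarrow> nat \<Rightarrow> ereal" where
  "nu_at r \<alpha> k = 2 * gamma_at r \<alpha> k - ereal (real k)"

definition ell' :: "nat \<Rightarrow> (nat \<Rightarrow> ereal) \<Rightarrow> nat" where
  "ell' r \<alpha> = Max {k. k \<le> r \<and> 0 \<le> nu_at r \<alpha> k}"

text \<open>If \<open>\<beta>\<^sub>i = \<beta>\<close> then \<open>i \<ge> \<ell>\<close> for \<open>\<ell> = \<lfloor>\<beta>\<rfloor>\<close> with \<open>\<beta>\<close> not an integer, so the subtraction
  below does not truncate where it is used.\<close>

definition d_coeff :: "nat \<Rightarrow> (nat \<Rightarrow> ereal) \<Rightarrow> nat \<Rightarrow> real" where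
  "d_coeff r \<alpha> l =
     (\<Sum>i\<in>{i. i \<le> r \<and> beta_at \<alpha> i = beta_max r \<alpha>}. 1 / ((real i + 1) * fact l * fact (i - l)))"

end

theory Submission
  imports Defs "HOL-Real_Asymp.Real_Asymp"
begin

text \<open>
  Put $\beta = \max \beta_i$ and $l = \lfloor\beta\rfloor$, and let $X$ be the random hypergraph.

  Homology below $l$: say that a simplex of $X$ is fresh if the boundary of one of its $l$-faces is
  not an integral combination of boundaries of $l$-faces of the other simplices. The fresh simplices
  provide vectors with coordinates in $\{-1,0,1\}$, none in the span of the others, so that
  all their subset sums differ and a pigeonhole argument bounds their number by $O(n^l \log n)$.
  About $n^\beta$ simplices of a dimension $i$ with $\beta_i = \beta$ are present; by symmetry, a
  given one is fresh with probability at most $n^{l-\beta+o(1)}$. For a fixed $l$-simplex $\rho$, a constant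
  number of disjoint sets of further vertices gives independent attempts at filling the boundary of
  $\rho$, so with high probability the boundaries of all $\rho$ are filled. This kills the reduced homology
  below $l$ over the integers, and already forces the full $(l-1)$-skeleton.

  Homology above $l$: a cycle of dimension $k$ restricts to a cycle on every simplex that shares no $k$
  vertices with another one, and bounds there. Hence the $k$-th Betti number is at most a constant times the number
  of pairs sharing $k$ vertices, whose expectation is $O(n^{\nu_k})$. If there are no such
  pairs, then in every simplex of dimension at least $k$ the faces with at least $k$ vertices that miss the least
  vertex are matched with the faces obtained by adding it; removing these pairs, largest first, is a collapse
  into the $(k-1)$-skeleton.

  Homology in dimension $l$: each $i$-simplex contributes ${i \choose l}$ to the Betti number, up to an error
  that is controlled by the overlaps and by the number of $(l-1)$-faces; a second moment
  estimate finishes the proof.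
\<close>

section \<open>Rank over the integers\<close>

text \<open>Vanishing over the integers excludes counting by rank: a simplex may be fresh although
  its boundary is rationally dependent on the others, so that it only shrinks torsion. The
  subset-sum pigeonhole copes with this at the price of a logarithm, which is affordable because
  \<beta> > l strictly. The failure probability for one \<rho> is then only a small negative power
  of n, while there are about n^(l+1) choices of \<rho>; hence the repeated attempts, whose number
  depends on l and \<beta> - l. Exchanging simplices by symmetry requires a common probability, so a
  single dimension i with \<beta>_i = \<beta> does all the filling. The exponent \<nu>_k counts
  overlaps: about n^k choices of k common vertices and, twice, O(n^(\<gamma>_k - k)) expected
  simplices through them. In degree l the relevant overlaps share l + 1 vertices; they are O(n^(2
  \<beta> - l - 1)) in expectation, and the (l-1)-faces are O(n^l). Both are o(n^\<beta>) since l <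
  \<beta> < l + 1, which is where non-integrality enters.\<close>

lemma int_left_kernel:
  fixes a :: "'s \<Rightarrow> 't \<Rightarrow> int"
  assumes "finite T" "finite S" "card T < card S"
  shows "\<exists>c. (\<exists>s\<in>S. c s \<noteq> 0) \<and> (\<forall>t\<in>T. (\<Sum>s\<in>S. c s * a s t) = 0)"
  using assms
proof (induction T arbitrary: S a rule: finite_induct)
  case empty
  then have "S \<noteq> {}" by auto
  then show ?case by (intro exI[of _ "\<lambda>_. 1"]) auto
next
  case (insert t T)
  show ?case
  proof (cases "\<forall>s\<in>S. a s t = 0")
    case True
    obtain c where "\<exists>s\<in>S. c s \<noteq> 0" "\<forall>t\<in>T. (\<Sum>s\<in>S. c s * a s t) = 0"
      using insert.IH[of S a] insert.prems insert.hyps by auto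
    with True show ?thesis by (intro exI[of _ c]) auto
  next
    case False
    then obtain s0 where s0: "s0 \<in> S" "a s0 t \<noteq> 0" by auto
    define S' where "S' = S - {s0}"
    have S': "finite S'" "card T < card S'" "S = insert s0 S'" "s0 \<notin> S'"
      using insert.prems insert.hyps s0 by (auto simp: S'_def)
    \<comment> \<open>Elimination without division: each remaining row is cross-multiplied with the
      pivot row \<open>s0\<close>, so that column \<open>t\<close> cancels and all entries stay
      integers.\<close>
    obtain c where c: "\<exists>s\<in>S'. c s \<noteq> 0"
      "\<forall>u\<in>T. (\<Sum>s\<in>S'. c s * (a s0 t * a s u - a s t * a s0 u)) = 0"
      using insert.IH[of S' "\<lambda>s u. a s0 t * a s u - a s t * a s0 u"] S' by auto
    \<comment> \<open>The coefficient of the pivot row is forced by column \<open>t\<close>; the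
      others are scaled by the pivot entry, which is nonzero and so keeps the relation
      nontrivial.\<close>
    define c' where "c' = (\<lambda>s. if s = s0 then - (\<Sum>s\<in>S'. c s * a s t) else c s * a s0 t)"
    have sum': "(\<Sum>s\<in>S. c' s * a s u) = (\<Sum>s\<in>S'. c s * (a s0 t * a s u - a s t * a s0 u))" for u
    proof -
      have "(\<Sum>s\<in>S. c' s * a s u) = c' s0 * a s0 u + (\<Sum>s\<in>S'. c' s * a s u)"
        using S' by simp
      also have "(\<Sum>s\<in>S'. c' s * a s u) = (\<Sum>s\<in>S'. c s * a s0 t * a s u)"
        using S' by (intro sum.cong) (auto simp: c'_def)
      also have "c' s0 = - (\<Sum>s\<in>S'. c s * a s t)" by (simp add: c'_def)
      finally show ?thesis
        by (simp add: sum_distrib_left sum_distrib_right sum_subtractf right_diff_distrib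
            mult.commute mult.left_commute)
    qed
    show ?thesis
    proof (intro exI[of _ c'] conjI ballI)
      show "\<exists>s\<in>S. c' s \<noteq> 0"
        using c(1) s0 S' by (auto simp: c'_def)
      show "(\<Sum>s\<in>S. c' s * a s u) = 0" if "u \<in> insert t T" for u
        using that c(2) unfolding sum' by (auto simp: mult.commute)
    qed
  qed
qed

interpretation frag: module "frag_cmul :: int \<Rightarrow> ('a \<Rightarrow>\<^sub>0 int) \<Rightarrow> _"
  by unfold_locales (auto simp: frag_cmul_distrib frag_cmul_distrib2)

text \<open>Independence of classes modulo \<open>B\<close>, expressed on representatives so that no
  quotient group has to be formed. Torsion does not count: an element with a nonzero multiple in
  \<open>B\<close> cannot belong to such a family.\<close>

definition indep_mod :: "('a \<Rightarrow>\<^sub>0 int) set \<Rightarrow> ('i \<Rightarrow> 'a \<Rightarrow>\<^sub>0 int) \<Rightarrow> 'i set \<Rightarrow> bool" where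
  "indep_mod B z I \<longleftrightarrow>
     finite I \<and> (\<forall>c. (\<Sum>i\<in>I. frag_cmul (c i) (z i)) \<in> B \<longrightarrow> (\<forall>i\<in>I. c i = 0))"

lemma indep_modD:
  "indep_mod B z I \<Longrightarrow> (\<Sum>i\<in>I. frag_cmul (c i) (z i)) \<in> B \<Longrightarrow> i \<in> I \<Longrightarrow> c i = 0"
  by (simp add: indep_mod_def)

text \<open>Modulo \<open>B\<close> each \<open>z i\<close> is an integer combination of
  \<open>T\<close>. With more indices than elements of \<open>T\<close>, the coefficient matrix has
  a nonzero left kernel vector, and this gives a nontrivial relation with value in
  \<open>B\<close>.\<close>

lemma card_indep_mod_le:
  assumes I: "indep_mod B z I" and B: "frag.subspace B" and T: "finite T"
    and z: "\<And>i. i \<in> I \<Longrightarrow> z i \<in> frag.span (B \<union> T)"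
  shows "card I \<le> card T"
proof (rule ccontr)
  assume "\<not> card I \<le> card T"
  have "\<exists>a. z i - (\<Sum>t\<in>T. frag_cmul (a t) t) \<in> B" if i: "i \<in> I" for i
  proof -
    obtain x y where xy: "z i = x + y" "x \<in> frag.span B" "y \<in> frag.span T"
      using z[OF i] unfolding frag.span_Un by auto
    have "x \<in> B" using xy(2) B by (metis frag.span_eq_iff)
    moreover obtain a where "y = (\<Sum>t\<in>T. frag_cmul (a t) t)"
      using xy(3) unfolding frag.span_finite[OF T] by auto
    ultimately show ?thesis using xy(1) by (intro exI[of _ a]) simp
  qed
  then obtain a where a: "\<And>i. i \<in> I \<Longrightarrow> z i - (\<Sum>t\<in>T. frag_cmul (a i t) t) \<in> B"
    by metis
  have fI: "finite I" using I by (simp add: indep_mod_def)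
  obtain c where c: "\<exists>i\<in>I. c i \<noteq> 0" "\<forall>t\<in>T. (\<Sum>i\<in>I. c i * a i t) = 0"
    using int_left_kernel[OF T fI, of a] \<open>\<not> card I \<le> card T\<close> by auto
  have "(\<Sum>i\<in>I. frag_cmul (c i) (z i - (\<Sum>t\<in>T. frag_cmul (a i t) t))) \<in> B"
    using a B by (intro frag.subspace_sum frag.subspace_scale) auto
  moreover have "(\<Sum>i\<in>I. frag_cmul (c i) (z i - (\<Sum>t\<in>T. frag_cmul (a i t) t))) =
      (\<Sum>i\<in>I. frag_cmul (c i) (z i)) - (\<Sum>i\<in>I. \<Sum>t\<in>T. frag_cmul (c i * a i t) t)"
    by (simp add: frag.scale_right_diff_distrib sum_subtractf frag_cmul_sum)
  moreover have "(\<Sum>i\<in>I. \<Sum>t\<in>T. frag_cmul (c i * a i t) t) = 0"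
    using c(2) by (subst sum.swap) (simp flip: frag.scale_sum_left)
  ultimately show False using I c(1) by (auto simp: indep_mod_def)
qed

text \<open>The bound \<open>card T\<close> makes a family of largest size available. Enlarging it
  by \<open>x\<close> creates a relation whose coefficient at \<open>x\<close> is nonzero; without
  division, only that multiple of \<open>x\<close> is known to lie in the span.\<close>

lemma obtain_maximal_indep_mod:
  assumes B: "frag.subspace B" and T: "finite T" and Z: "Z \<subseteq> frag.span (B \<union> T)"
  obtains I where "I \<subseteq> Z" "indep_mod B (\<lambda>x. x) I"
    "\<And>x. x \<in> Z \<Longrightarrow> \<exists>m. m \<noteq> 0 \<and> frag_cmul m x \<in> frag.span (B \<union> I)"
proof -
  let ?P = "\<lambda>I. I \<subseteq> Z \<and> indep_mod B (\<lambda>x. x) I"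
  have P0: "?P {}" by (simp add: indep_mod_def)
  have bound: "card I \<le> card T" if "?P I" for I
    using card_indep_mod_le[OF _ B T, of "\<lambda>x. x" I] that Z by blast
  have "\<exists>I. ?P I \<and> (\<forall>J. ?P J \<longrightarrow> card J \<le> card I)"
    using P0 bound less_Suc_eq_le
    by (intro ex_has_greatest_nat[of ?P "{}" card "Suc (card T)"]) blast+
  then obtain I where I: "I \<subseteq> Z" "indep_mod B (\<lambda>x. x) I"
    and max: "\<And>J. ?P J \<Longrightarrow> card J \<le> card I" by blast
  have fI: "finite I" using I(2) by (simp add: indep_mod_def)
  have "\<exists>m. m \<noteq> 0 \<and> frag_cmul m x \<in> frag.span (B \<union> I)" if x: "x \<in> Z" for x
  proof (cases "x \<in> I")
    case True
    then show ?thesis by (intro exI[of _ 1]) (simp add: frag.span_base)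
  next
    case False
    have "\<not> indep_mod B (\<lambda>x. x) (insert x I)"
      using max[of "insert x I"] False fI I(1) x by auto
    then obtain c where c: "(\<Sum>i\<in>insert x I. frag_cmul (c i) i) \<in> B" "\<exists>i\<in>insert x I. c i \<noteq> 0"
      using fI by (auto simp only: indep_mod_def finite_insert simp_thms not_all not_imp bex_simps)
    have c': "frag_cmul (c x) x + (\<Sum>i\<in>I. frag_cmul (c i) i) \<in> B"
      using c(1) False fI by simp
    have "c x \<noteq> 0"
    proof
      assume 0: "c x = 0"
      then have "(\<Sum>i\<in>I. frag_cmul (c i) i) \<in> B" using c' by simp
      then have "\<forall>i\<in>I. c i = 0" using I(2) unfolding indep_mod_def by blast
      then show False using c(2) 0 by blast
    qed
    moreover have "frag_cmul (c x) x + (\<Sum>i\<in>I. frag_cmul (c i) i) - (\<Sum>i\<in>I. frag_cmul (c i) i)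
        \<in> frag.span (B \<union> I)"
      using c' by (intro frag.span_diff frag.span_sum frag.span_scale) (simp_all add: frag.span_base)
    then have "frag_cmul (c x) x \<in> frag.span (B \<union> I)" by simp
    ultimately show ?thesis by blast
  qed
  then show thesis using that[of I] I by blast
qed

text \<open>Support conditions become memberships in spans, to which the generic module lemmas
  apply.\<close>

lemma keys_subset_iff_span: "Poly_Mapping.keys c \<subseteq> F \<longleftrightarrow> c \<in> frag.span (frag_of ` F)"
proof
  assume F: "Poly_Mapping.keys c \<subseteq> F"
  have "c = (\<Sum>i\<in>Poly_Mapping.keys c. frag_cmul (poly_mapping.lookup c i) (frag_of i))"
    using frag_expansion[of c] by (simp add: frag_extend_def)
  also have "\<dots> \<in> frag.span (frag_of ` F)"
    using F by (intro frag.span_sum frag.span_scale frag.span_base) auto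
  finally show "c \<in> frag.span (frag_of ` F)" .
next
  assume "c \<in> frag.span (frag_of ` F)"
  then show "Poly_Mapping.keys c \<subseteq> F"
  proof (induction rule: frag.span_induct_alt)
    case (step m x y)
    then show ?case
      using keys_add[of "frag_cmul m x" y] keys_cmul[of m x] by fastforce
  qed auto
qed

text \<open>The scalars \<open>m x\<close> are there because basis elements will lie in the span of
  interest only up to a nonzero multiple.\<close>

lemma indep_mod_frag_of:
  assumes "finite F" "\<And>x. x \<in> F \<Longrightarrow> m x \<noteq> 0"
  shows "indep_mod {0} (\<lambda>x. frag_cmul (m x) (frag_of x)) F"
  unfolding indep_mod_def
proof (intro conjI allI impI ballI)
  fix c x assume 0: "(\<Sum>x\<in>F. frag_cmul (c x) (frag_cmul (m x) (frag_of x))) \<in> {0}" and x: "x \<in> F"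
  have "0 = poly_mapping.lookup (\<Sum>x\<in>F. frag_cmul (c x) (frag_cmul (m x) (frag_of x))) x"
    using 0 by simp
  also have "\<dots> = (\<Sum>y\<in>F. if y = x then c y * m y else 0)"
    by (auto simp: lookup_sum intro!: sum.cong)
  also have "\<dots> = c x * m x" using assms x by (simp add: sum.delta')
  finally show "c x = 0" using assms(2)[OF x] by simp
qed (use assms in auto)

text \<open>Rank--nullity over the integers: \<open>\<phi>\<close> has rank at most \<open>card E\<close>, so modulo torsion the group
  of all chains is spanned by \<open>I\<close>, by \<open>G\<close> and by at most \<open>card E\<close> further elements.\<close>

lemma obtain_indep_mod_in_kernel:
  fixes \<phi> :: "('a \<Rightarrow>\<^sub>0 int) \<Rightarrow> ('b \<Rightarrow>\<^sub>0 int)"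
  assumes \<phi>: "module_hom frag_cmul frag_cmul \<phi>"
    and F: "finite F" and E: "finite E" and G: "finite G"
    and img: "\<And>x. x \<in> F \<Longrightarrow> Poly_Mapping.keys (\<phi> (frag_of x)) \<subseteq> E"
  obtains I where "I \<subseteq> {c. Poly_Mapping.keys c \<subseteq> F \<and> \<phi> c = 0}"
    "indep_mod (frag.span G) (\<lambda>x. x) I" "card F \<le> card I + card G + card E"
proof -
  interpret module_hom "frag_cmul :: int \<Rightarrow> ('a \<Rightarrow>\<^sub>0 int) \<Rightarrow> _" "frag_cmul :: int \<Rightarrow> ('b \<Rightarrow>\<^sub>0 int) \<Rightarrow> _" \<phi>
    by fact
  let ?C = "frag.span (frag_of ` F)"
  define K where "K = {c. Poly_Mapping.keys c \<subseteq> F \<and> \<phi> c = 0}"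
  have K: "K = ?C \<inter> {c. \<phi> c = 0}" by (auto simp: K_def keys_subset_iff_span)
  have subK: "frag.subspace K"
    unfolding K by (intro frag.subspace_inter subspace_kernel) auto
  have fF: "finite (frag_of ` F)" using F by simp
  obtain I where I: "I \<subseteq> K" "indep_mod (frag.span G) (\<lambda>x. x) I"
    "\<And>x. x \<in> K \<Longrightarrow> \<exists>m. m \<noteq> 0 \<and> frag_cmul m x \<in> frag.span (frag.span G \<union> I)"
    by (rule obtain_maximal_indep_mod[OF frag.subspace_span fF, of K G])
       (use K frag.span_mono[of "frag_of ` F" "frag.span G \<union> frag_of ` F"] in auto)
  obtain R where R: "R \<subseteq> frag_of ` F" "indep_mod K (\<lambda>x. x) R"
    "\<And>x. x \<in> frag_of ` F \<Longrightarrow> \<exists>m. m \<noteq> 0 \<and> frag_cmul m x \<in> frag.span (K \<union> R)"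
    by (rule obtain_maximal_indep_mod[OF subK fF, of "frag_of ` F"]) (auto intro: frag.span_base)
  have fI: "finite I" and fR: "finite R" using I(2) R(2) by (auto simp: indep_mod_def)
  have "indep_mod {0} \<phi> R"
    unfolding indep_mod_def
  proof (intro conjI allI impI fR)
    fix c assume "(\<Sum>i\<in>R. frag_cmul (c i) (\<phi> i)) \<in> {0}"
    then have "\<phi> (\<Sum>i\<in>R. frag_cmul (c i) i) = 0" by (simp add: sum scale)
    moreover have "(\<Sum>i\<in>R. frag_cmul (c i) i) \<in> ?C"
      using R(1) by (intro frag.span_sum frag.span_scale frag.span_base) auto
    ultimately have "(\<Sum>i\<in>R. frag_cmul (c i) i) \<in> K" by (simp add: K)
    then show "\<forall>i\<in>R. c i = 0" using R(2) by (simp add: indep_mod_def)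
  qed
  then have "card R \<le> card (frag_of ` E)"
    by (rule card_indep_mod_le)
       (use E R(1) img frag.span_mono[of "frag_of ` E" "{0} \<union> frag_of ` E"]
         in \<open>auto simp: keys_subset_iff_span\<close>)
  then have cR: "card R \<le> card E" using card_image_le[OF E, of frag_of] by linarith
  have "\<exists>m. m \<noteq> 0 \<and> frag_cmul m (frag_of x) \<in> frag.span (G \<union> I \<union> R)" if x: "x \<in> F" for x
  proof -
    obtain m where m: "m \<noteq> 0" "frag_cmul m (frag_of x) \<in> frag.span (K \<union> R)"
      using R(3)[of "frag_of x"] x by auto
    then have "\<exists>k y. frag_cmul m (frag_of x) = k + y \<and> k \<in> K \<and> y \<in> frag.span R"
      using subK frag.span_eq_iff[of K] unfolding frag.span_Un by blast
    then obtain k y where ky: "frag_cmul m (frag_of x) = k + y" "k \<in> K" "y \<in> frag.span R"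
      by blast
    obtain m' where m': "m' \<noteq> 0" "frag_cmul m' k \<in> frag.span (frag.span G \<union> I)"
      using I(3) ky(2) by blast
    have "frag.span (frag.span G \<union> I) \<subseteq> frag.span (G \<union> I \<union> R)"
      by (intro frag.span_minimal Un_least)
         (auto intro: frag.span_base subsetD[OF frag.span_mono[of G "G \<union> I \<union> R"]])
    moreover have "frag.span R \<subseteq> frag.span (G \<union> I \<union> R)" by (rule frag.span_mono) auto
    ultimately have "frag_cmul m' k + frag_cmul m' y \<in> frag.span (G \<union> I \<union> R)"
      using m'(2) ky(3) by (intro frag.span_add frag.span_scale[of y]) auto
    moreover have "frag_cmul m' k + frag_cmul m' y = frag_cmul (m' * m) (frag_of x)"
      using ky(1) by (metis frag_cmul_cmul frag_cmul_distrib2)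
    ultimately show ?thesis using m m' by (intro exI[of _ "m' * m"]) auto
  qed
  then obtain m where m: "\<And>x. x \<in> F \<Longrightarrow> m x \<noteq> 0"
    "\<And>x. x \<in> F \<Longrightarrow> frag_cmul (m x) (frag_of x) \<in> frag.span (G \<union> I \<union> R)" by metis
  have "card F \<le> card (G \<union> I \<union> R)"
    by (rule card_indep_mod_le[OF indep_mod_frag_of[OF F m(1)]])
       (use m(2) G fI fR frag.span_mono[of "G \<union> I \<union> R" "{0} \<union> (G \<union> I \<union> R)"] in auto)
  also have "\<dots> \<le> card G + card I + card R"
    using card_Un_le[of "G \<union> I" R] card_Un_le[of G I] by linarith
  finally show thesis using that[of I] I cR by (simp add: K_def)
qed

section \<open>Quotients of free abelian groups\<close>

text \<open>Abstract form of cycles \<open>Z\<close> modulo boundaries \<open>B\<close>. It mediates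
  between the multiplicative quotient group, whose rank or triviality is asked for, and additive
  statements about spans.\<close>

locale free_quotient =
  fixes S :: "'a set" and Z B :: "('a \<Rightarrow>\<^sub>0 int) set"
  assumes subspace_Z: "frag.subspace Z" and subspace_B: "frag.subspace B"
    and B_Z: "B \<subseteq> Z" and Z_S: "\<And>c. c \<in> Z \<Longrightarrow> Poly_Mapping.keys c \<subseteq> S"
begin

abbreviation "ZG \<equiv> subgroup_generated (free_Abelian_group S) Z"
abbreviation "H \<equiv> ZG Mod B"

lemma subgroup_of_subspace:
  assumes "frag.subspace A" "A \<subseteq> Z"
  shows "subgroup A (free_Abelian_group S)"
proof -
  have AS: "Poly_Mapping.keys c \<subseteq> S" if "c \<in> A" for c using Z_S[of c] assms(2) that by blast
  show ?thesis
  proof (rule group.subgroupI[OF group_free_Abelian_group])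
    show "A \<subseteq> carrier (free_Abelian_group S)" using AS by auto
    show "A \<noteq> {}" using frag.subspace_0[OF assms(1)] by blast
    show "inv\<^bsub>free_Abelian_group S\<^esub> c \<in> A" if "c \<in> A" for c
      using frag.subspace_neg[OF assms(1) that] inv_free_Abelian_group[OF AS[OF that]] by simp
    show "c \<otimes>\<^bsub>free_Abelian_group S\<^esub> c' \<in> A" if "c \<in> A" "c' \<in> A" for c c'
      using frag.subspace_add[OF assms(1) that] by simp
  qed
qed

lemma carrier_ZG: "carrier ZG = Z"
  using subgroup_of_subspace[OF subspace_Z] subgroup.carrier_subgroup_generated_subgroup by blast

sublocale ZG: comm_group ZG
  by (intro group.abelian_subgroup_generated group_free_Abelian_group abelian_free_Abelian_group)

sublocale B: normal B ZG
proof -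
  have "subgroup B ZG"
    by (intro group.subgroup_of_subgroup_generated group_free_Abelian_group
        subgroup_of_subspace subspace_B B_Z)
  then show "normal B ZG" by (rule ZG.subgroup_imp_normal)
qed

sublocale H: comm_group H
  using ZG.abelian_FactGroup[OF B.subgroup_axioms] .

definition cls where "cls z = B #>\<^bsub>ZG\<^esub> z"

lemma cls_hom: "cls \<in> hom ZG H"
  unfolding cls_def by (rule B.r_coset_hom_Mod)

lemma carrier_H: "carrier H = cls ` Z"
  by (simp add: carrier_FactGroup cls_def[abs_def] carrier_ZG)

lemma cls_eq_one: "z \<in> Z \<Longrightarrow> cls z = \<one>\<^bsub>H\<^esub> \<longleftrightarrow> z \<in> B"
  using ZG.coset_join1[of B z] ZG.coset_join2[of z B] B.subgroup_axioms B.subset carrier_ZG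
  by (auto simp: cls_def)

lemma int_pow_ZG: "z \<in> Z \<Longrightarrow> z [^]\<^bsub>ZG\<^esub> (m :: int) = frag_cmul m z"
  using group.int_pow_subgroup_generated[OF group_free_Abelian_group, of z S Z m]
    Z_S carrier_ZG by simp

lemma scale_Z: "z \<in> Z \<Longrightarrow> frag_cmul m z \<in> Z"
  using subspace_Z by (rule frag.subspace_scale)

lemma cls_pow: "z \<in> Z \<Longrightarrow> cls z [^]\<^bsub>H\<^esub> (m :: int) = cls (frag_cmul m z)"
  using hom_int_pow[OF cls_hom, of z m] carrier_ZG int_pow_ZG ZG.is_group H.is_group by simp

lemma finprod_cls:
  assumes "finite I" "\<And>i. i \<in> I \<Longrightarrow> z i \<in> Z"
  shows "finprod H (\<lambda>i. cls (z i) [^]\<^bsub>H\<^esub> (c i :: int)) I = cls (\<Sum>i\<in>I. frag_cmul (c i) (z i))"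
  using assms
proof (induction I rule: finite_induct)
  case empty
  then show ?case using cls_eq_one[of 0] subspace_Z subspace_B
    by (simp add: frag.subspace_0 del: one_FactGroup)
next
  case (insert i I)
  have in_H: "cls (z j) [^]\<^bsub>H\<^esub> (c j :: int) \<in> carrier H" if "j \<in> insert i I" for j
    using insert.prems[OF that] carrier_H by (intro H.int_pow_closed) auto
  have sumZ: "(\<Sum>i\<in>I. frag_cmul (c i) (z i)) \<in> Z" "frag_cmul (c i) (z i) \<in> Z"
    using insert.prems subspace_Z by (auto intro!: frag.subspace_sum frag.subspace_scale)
  have "finprod H (\<lambda>i. cls (z i) [^]\<^bsub>H\<^esub> (c i :: int)) (insert i I) =
     cls (frag_cmul (c i) (z i)) \<otimes>\<^bsub>H\<^esub> cls (\<Sum>i\<in>I. frag_cmul (c i) (z i))"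
    using insert in_H by (subst H.finprod_insert) (auto simp: cls_pow)
  also have "\<dots> = cls (frag_cmul (c i) (z i) + (\<Sum>i\<in>I. frag_cmul (c i) (z i)))"
    using hom_mult[OF cls_hom, of "frag_cmul (c i) (z i)" "\<Sum>i\<in>I. frag_cmul (c i) (z i)"]
      sumZ carrier_ZG by simp
  finally show ?case using insert by simp
qed

lemma int_independent_lift:
  assumes "int_independent H T"
  obtains z where "\<And>x. x \<in> T \<Longrightarrow> z x \<in> Z" "indep_mod B z T"
proof -
  have T: "finite T" "T \<subseteq> cls ` Z"
    using assms by (simp_all add: int_independent_def carrier_H)
  define z where "z = inv_into Z cls"
  have z: "z x \<in> Z \<and> cls (z x) = x" if "x \<in> T" for x
    using inv_into_into[of x cls Z] f_inv_into_f[of x cls Z] subsetD[OF T(2) that]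
    by (simp add: z_def)
  have "finprod H (\<lambda>x. x [^]\<^bsub>H\<^esub> (c x :: int)) T = cls (\<Sum>i\<in>T. frag_cmul (c i) (z i))" for c
  proof -
    have in_H: "x [^]\<^bsub>H\<^esub> (c x :: int) \<in> carrier H" if "x \<in> T" for x
      using z[OF that] carrier_H by (intro H.int_pow_closed) (metis imageI)
    have "finprod H (\<lambda>x. x [^]\<^bsub>H\<^esub> (c x :: int)) T = finprod H (\<lambda>x. cls (z x) [^]\<^bsub>H\<^esub> (c x :: int)) T"
      by (rule H.finprod_cong') (use z in_H in \<open>simp_all add: Pi_def\<close>)
    then show ?thesis using finprod_cls[OF T(1), of z c] z by simp
  qed
  moreover have "(\<Sum>i\<in>T. frag_cmul (c i) (z i)) \<in> Z" for c
    using z subspace_Z by (auto intro!: frag.subspace_sum frag.subspace_scale)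
  ultimately have *: "finprod H (\<lambda>x. x [^]\<^bsub>H\<^esub> (c x :: int)) T = \<one>\<^bsub>H\<^esub>"
    if "(\<Sum>i\<in>T. frag_cmul (c i) (z i)) \<in> B" for c
    using that cls_eq_one[of "\<Sum>i\<in>T. frag_cmul (c i) (z i)"] by simp
  have "indep_mod B z T"
    unfolding indep_mod_def
  proof (intro conjI allI impI T(1))
    fix c assume "(\<Sum>i\<in>T. frag_cmul (c i) (z i)) \<in> B"
    from *[OF this] show "\<forall>i\<in>T. c i = 0"
      using assms by (simp add: int_independent_def)
  qed
  show thesis
    by (rule that[of z]) (use z \<open>indep_mod B z T\<close> in auto)
qed

lemma int_independent_cls:
  assumes I: "I \<subseteq> Z" and ind: "indep_mod B (\<lambda>x. x) I"
  shows "int_independent H (cls ` I)" "card (cls ` I) = card I"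
proof -
  have fI: "finite I" using ind by (simp add: indep_mod_def)
  have clsH: "cls i \<in> carrier H" if "i \<in> I" for i using I that carrier_H by auto
  have sumI: "(\<Sum>i\<in>I. frag_cmul (c i) i) \<in> Z" for c
    using I subspace_Z by (auto intro!: frag.subspace_sum frag.subspace_scale)
  \<comment> \<open>Independence in the quotient is stated for a set of cosets, so distinct
    representatives must be shown to have distinct classes: otherwise \<open>x - y\<close> would be
    a forbidden relation in \<open>B\<close>.\<close>
  have inj: "inj_on cls I"
  proof (rule inj_onI, rule ccontr)
    fix x y assume xy: "x \<in> I" "y \<in> I" "cls x = cls y" "x \<noteq> y"
    define c :: "_ \<Rightarrow> int" where "c = (\<lambda>i. if i = x then 1 else if i = y then -1 else 0)"
    have Z: "x \<in> Z" "y \<in> Z" "frag_cmul (- 1) y \<in> Z" "x + frag_cmul (- 1) y \<in> Z"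
      using I xy scale_Z[of y "- 1"] frag.subspace_diff[OF subspace_Z, of x y] by auto
    have cl: "cls y \<in> carrier H" using Z(2) carrier_H by auto
    have "cls (x + frag_cmul (- 1) y) = cls x \<otimes>\<^bsub>H\<^esub> cls (frag_cmul (- 1) y)"
      using hom_mult[OF cls_hom, of x "frag_cmul (- 1) y"] Z carrier_ZG by simp
    also have "\<dots> = cls y \<otimes>\<^bsub>H\<^esub> inv\<^bsub>H\<^esub> cls y"
      using cls_pow[OF Z(2), of "- 1"] xy(3) H.int_pow_neg[OF cl, of 1] cl by simp
    also have "\<dots> = \<one>\<^bsub>H\<^esub>" using cl by (rule H.r_inv)
    finally have "x + frag_cmul (- 1) y \<in> B" using cls_eq_one[OF Z(4)] by simp
    moreover have "(\<Sum>i\<in>I. frag_cmul (c i) i) = (\<Sum>i\<in>{x, y}. frag_cmul (c i) i)"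
      using xy fI by (intro sum.mono_neutral_right) (auto simp: c_def)
    ultimately have "(\<Sum>i\<in>I. frag_cmul (c i) i) \<in> B"
      using xy(4) by (simp add: c_def)
    then have "c x = 0" using ind xy(1) by (simp add: indep_mod_def)
    then show False by (simp add: c_def)
  qed
  show "card (cls ` I) = card I" using inj by (rule card_image)
  show "int_independent H (cls ` I)"
    unfolding int_independent_def
  proof (intro conjI allI impI)
    show "cls ` I \<subseteq> carrier H" using I carrier_H by auto
    fix c :: "_ \<Rightarrow> int"
    assume 1: "finprod H (\<lambda>x. x [^]\<^bsub>H\<^esub> c x) (cls ` I) = \<one>\<^bsub>H\<^esub>"
    have "finprod H (\<lambda>x. x [^]\<^bsub>H\<^esub> c x) (cls ` I) = finprod H (\<lambda>x. cls x [^]\<^bsub>H\<^esub> c (cls x)) I"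
      using inj clsH by (subst H.finprod_reindex) (force intro!: H.int_pow_closed)+
    also have "\<dots> = cls (\<Sum>i\<in>I. frag_cmul (c (cls i)) i)"
      by (rule finprod_cls[OF fI]) (use I in auto)
    finally have "cls (\<Sum>i\<in>I. frag_cmul (c (cls i)) i) = \<one>\<^bsub>H\<^esub>" using 1 by argo
    then have "(\<Sum>i\<in>I. frag_cmul (c (cls i)) i) \<in> B"
      using cls_eq_one[OF sumI[of "\<lambda>i. c (cls i)"]] by blast
    then have "\<forall>i\<in>I. c (cls i) = 0" using indep_modD[OF ind, of "\<lambda>i. c (cls i)"] by blast
    then show "\<forall>x\<in>cls ` I. c x = 0" by auto
  qed (use fI in auto)
qed

lemma card_int_independent_le:
  assumes "finite T" "Z \<subseteq> frag.span (B \<union> T)" "int_independent H J"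
  shows "card J \<le> card T"
proof -
  obtain z where "\<And>x. x \<in> J \<Longrightarrow> z x \<in> Z" "indep_mod B z J"
    using int_independent_lift[OF assms(3)] by blast
  then show ?thesis using card_indep_mod_le[OF _ subspace_B assms(1)] assms(2) by blast
qed

lemma abelian_rank_le:
  assumes "finite T" "Z \<subseteq> frag.span (B \<union> T)"
  shows "abelian_rank H \<le> card T"
proof -
  \<comment> \<open>\<open>Max\<close> has its meaning only on a non-empty finite set: the empty
    family gives an element, and \<open>card T\<close> bounds all of them.\<close>
  have "int_independent H {}" by (simp add: int_independent_def)
  then have "{card J |J. int_independent H J} \<noteq> {}" by blast
  moreover have "{card J |J. int_independent H J} \<subseteq> {..card T}"
    using card_int_independent_le[OF assms] by auto
  ultimately show ?thesis
    unfolding abelian_rank_def by (subst Max_le_iff) (auto dest: finite_subset)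
qed

text \<open>Finiteness of \<open>S\<close> bounds the size of every independent set, so that the
  maximum defining the rank exists and dominates \<open>card I\<close>.\<close>

lemma abelian_rank_ge:
  assumes "finite S" "I \<subseteq> Z" "indep_mod B (\<lambda>x. x) I"
  shows "card I \<le> abelian_rank H"
proof -
  have "Z \<subseteq> frag.span (B \<union> frag_of ` S)"
    using Z_S keys_subset_iff_span frag.span_mono[of "frag_of ` S" "B \<union> frag_of ` S"] by blast
  then have "{card J |J. int_independent H J} \<subseteq> {..card (frag_of ` S)}"
    using card_int_independent_le[of "frag_of ` S"] assms(1) by auto
  then show ?thesis
    unfolding abelian_rank_def using int_independent_cls[OF assms(2,3)]
    by (intro Max_ge CollectI exI[of _ "cls ` I"]) (auto dest: finite_subset)
qed

lemma trivial_group_quotient: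
  assumes "Z \<subseteq> B" shows "trivial_group H"
  unfolding trivial_group_def
proof (intro conjI H.is_group)
  have "cls z = \<one>\<^bsub>H\<^esub>" if "z \<in> Z" for z using cls_eq_one[OF that] assms that by blast
  moreover have "0 \<in> Z" using subspace_Z by (rule frag.subspace_0)
  ultimately show "carrier H = {\<one>\<^bsub>H\<^esub>}" unfolding carrier_H by auto
qed

end

section \<open>Simplicial chains and cones\<close>

definition facet_sign :: "nat set \<Rightarrow> nat \<Rightarrow> int" where
  "facet_sign \<sigma> v = (-1) ^ card {u\<in>\<sigma>. u < v}"

text \<open>Unlike \<open>face_boundary\<close>, this keeps every facet, including the empty facet
  of a vertex. It is the augmented boundary and does not depend on a complex.\<close>

definition bd :: "(nat set \<Rightarrow>\<^sub>0 int) \<Rightarrow> (nat set \<Rightarrow>\<^sub>0 int)" where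
  "bd = frag_extend (\<lambda>\<sigma>. \<Sum>v\<in>\<sigma>. frag_cmul (facet_sign \<sigma> v) (frag_of (\<sigma> - {v})))"

text \<open>No sign is attached, which is correct for the homotopy formula only if \<open>w\<close>
  precedes all vertices of the chain.\<close>

definition coned :: "nat \<Rightarrow> (nat set \<Rightarrow>\<^sub>0 int) \<Rightarrow> (nat set \<Rightarrow>\<^sub>0 int)" where
  "coned w = frag_extend (\<lambda>\<tau>. if w \<in> \<tau> then 0 else frag_of (insert w \<tau>))"

lemma module_hom_frag_extend: "module_hom frag_cmul frag_cmul (frag_extend f)"
  by unfold_locales (auto simp: frag_extend_add frag_extend_cmul)

interpretation bd: module_hom "frag_cmul :: int \<Rightarrow> (nat set \<Rightarrow>\<^sub>0 int) \<Rightarrow> _" frag_cmul bd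
  unfolding bd_def by (rule module_hom_frag_extend)

interpretation coned: module_hom "frag_cmul :: int \<Rightarrow> (nat set \<Rightarrow>\<^sub>0 int) \<Rightarrow> _" frag_cmul "coned w" for w
  unfolding coned_def by (rule module_hom_frag_extend)

lemma bd_frag_of: "bd (frag_of \<sigma>) = (\<Sum>v\<in>\<sigma>. frag_cmul (facet_sign \<sigma> v) (frag_of (\<sigma> - {v})))"
  by (simp add: bd_def)

lemma coned_frag_of: "coned w (frag_of \<tau>) = (if w \<in> \<tau> then 0 else frag_of (insert w \<tau>))"
  by (simp add: coned_def)

lemma keys_bd_frag_of: "Poly_Mapping.keys (bd (frag_of \<sigma>)) \<subseteq> (\<lambda>v. \<sigma> - {v}) ` \<sigma>"
proof -
  have "Poly_Mapping.keys (bd (frag_of \<sigma>)) \<subseteq>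
      (\<Union>v\<in>\<sigma>. Poly_Mapping.keys (frag_cmul (facet_sign \<sigma> v) (frag_of (\<sigma> - {v}))))"
    unfolding bd_frag_of by (rule keys_sum)
  also have "\<dots> \<subseteq> (\<lambda>v. \<sigma> - {v}) ` \<sigma>"
    using keys_cmul by fastforce
  finally show ?thesis .
qed

lemma keys_bd:
  assumes "Poly_Mapping.keys c \<subseteq> F"
  shows "Poly_Mapping.keys (bd c) \<subseteq> {\<sigma> - {v} | \<sigma> v. \<sigma> \<in> F \<and> v \<in> \<sigma>}"
proof -
  have "Poly_Mapping.keys (bd c) \<subseteq> (\<Union>\<sigma>\<in>Poly_Mapping.keys c. Poly_Mapping.keys (bd (frag_of \<sigma>)))"
    using keys_frag_extend unfolding bd_frag_of unfolding bd_def by fast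
  also have "\<dots> \<subseteq> (\<Union>\<sigma>\<in>Poly_Mapping.keys c. (\<lambda>v. \<sigma> - {v}) ` \<sigma>)"
    using keys_bd_frag_of by fast
  finally show ?thesis using assms by blast
qed

lemma keys_coned:
  assumes "Poly_Mapping.keys c \<subseteq> F"
  shows "Poly_Mapping.keys (coned w c) \<subseteq> {insert w \<tau> | \<tau>. \<tau> \<in> F \<and> w \<notin> \<tau>}"
proof -
  have "Poly_Mapping.keys (coned w c) \<subseteq>
      (\<Union>\<tau>\<in>Poly_Mapping.keys c. Poly_Mapping.keys (if w \<in> \<tau> then 0 else frag_of (insert w \<tau>)))"
    unfolding coned_def by (rule keys_frag_extend)
  also have "\<dots> \<subseteq> {insert w \<tau> | \<tau>. \<tau> \<in> F \<and> w \<notin> \<tau>}"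
  proof
    fix x assume "x \<in> (\<Union>\<tau>\<in>Poly_Mapping.keys c. Poly_Mapping.keys (if w \<in> \<tau> then 0 else frag_of (insert w \<tau>)))"
    then obtain \<tau> where "\<tau> \<in> Poly_Mapping.keys c"
      "x \<in> Poly_Mapping.keys (if w \<in> \<tau> then 0 else frag_of (insert w \<tau>))" by blast
    then show "x \<in> {insert w \<tau> | \<tau>. \<tau> \<in> F \<and> w \<notin> \<tau>}"
      using assms by (cases "w \<in> \<tau>") auto
  qed
  finally show ?thesis .
qed

text \<open>Coning with a vertex that precedes all others is a contracting homotopy; the other
  vertices then carry the same signs up to a global factor \<open>-1\<close>.\<close>

lemma cone_homotopy_frag_of:
  assumes fin: "finite \<tau>" and w: "\<And>u. u \<in> \<tau> \<Longrightarrow> w \<le> u"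
  shows "bd (coned w (frag_of \<tau>)) + coned w (bd (frag_of \<tau>)) = frag_of \<tau>"
proof (cases "w \<in> \<tau>")
  case True
  have "{u\<in>\<tau>. u < w} = {}" using w by (auto simp: not_less)
  then have sw: "facet_sign \<tau> w = 1" by (simp only: facet_sign_def) simp
  have "coned w (bd (frag_of \<tau>)) = (\<Sum>v\<in>\<tau>. frag_cmul (facet_sign \<tau> v) (coned w (frag_of (\<tau> - {v}))))"
    by (simp add: bd_frag_of coned.sum coned.scale)
  also have "\<dots> = (\<Sum>v\<in>\<tau>. if v = w then frag_of \<tau> else 0)"
    using True sw by (intro sum.cong) (auto simp: coned_frag_of insert_absorb)
  also have "\<dots> = frag_of \<tau>" using True fin by simp
  finally show ?thesis using True by (simp add: coned_frag_of)
next
  case False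
  then have less: "w < u" if "u \<in> \<tau>" for u using w[OF that] that by (metis le_neq_implies_less)
  have "{u \<in> insert w \<tau>. u < w} = {}" using w by (auto simp: not_less)
  then have sw: "facet_sign (insert w \<tau>) w = 1" by (simp only: facet_sign_def) simp
  have sv: "facet_sign (insert w \<tau>) v = - facet_sign \<tau> v" if "v \<in> \<tau>" for v
  proof -
    have "{u \<in> insert w \<tau>. u < v} = insert w {u \<in> \<tau>. u < v}" using less[OF that] by auto
    then show ?thesis using fin False by (simp add: facet_sign_def)
  qed
  have cb: "coned w (bd (frag_of \<tau>)) =
      (\<Sum>v\<in>\<tau>. frag_cmul (facet_sign \<tau> v) (frag_of (insert w (\<tau> - {v}))))"
    using False by (simp add: bd_frag_of coned.sum coned.scale coned_frag_of)
  have diff: "insert w \<tau> - {v} = insert w (\<tau> - {v})" if "v \<in> \<tau>" for v using that False by auto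
  have "bd (coned w (frag_of \<tau>)) = frag_of \<tau> +
      (\<Sum>v\<in>\<tau>. frag_cmul (facet_sign (insert w \<tau>) v) (frag_of (insert w \<tau> - {v})))"
    using False fin sw by (simp add: coned_frag_of bd_frag_of)
  also have "(\<Sum>v\<in>\<tau>. frag_cmul (facet_sign (insert w \<tau>) v) (frag_of (insert w \<tau> - {v}))) =
      (\<Sum>v\<in>\<tau>. - frag_cmul (facet_sign \<tau> v) (frag_of (insert w (\<tau> - {v}))))"
    by (rule sum.cong) (simp_all only: sv diff minus_frag_cmul)
  also have "\<dots> = - coned w (bd (frag_of \<tau>))"
    by (simp only: cb sum_negf)
  finally show ?thesis by simp
qed

lemma cone_homotopy:
  assumes "\<And>\<tau>. \<tau> \<in> Poly_Mapping.keys c \<Longrightarrow> finite \<tau> \<and> (\<forall>u\<in>\<tau>. w \<le> u)"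
  shows "bd (coned w c) + coned w (bd c) = c"
proof -
  have "frag.subspace {c. bd (coned w c) + coned w (bd c) = c}"
    by (rule frag.subspaceI)
       (auto simp: bd.add coned.add bd.scale coned.scale algebra_simps simp flip: frag_cmul_distrib2)
  moreover have "frag_of ` Poly_Mapping.keys c \<subseteq> {c. bd (coned w c) + coned w (bd c) = c}"
  proof clarify
    fix \<tau> assume "\<tau> \<in> Poly_Mapping.keys c"
    then show "bd (coned w (frag_of \<tau>)) + coned w (bd (frag_of \<tau>)) = frag_of \<tau>"
      using assms[of \<tau>] by (intro cone_homotopy_frag_of) simp_all
  qed
  ultimately have "frag.span (frag_of ` Poly_Mapping.keys c) \<subseteq>
      {c. bd (coned w c) + coned w (bd c) = c}"
    by (intro frag.span_minimal)
  then show ?thesis using keys_subset_iff_span[of c "Poly_Mapping.keys c"] by auto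
qed

text \<open>The homotopy formula replaces the usual cancellation in a double sum: with least vertex
  \<open>w\<close> and opposite facet \<tau>', it gives the boundary of \<tau> as \<tau>' minus the
  cone over the boundary of \<tau>'. Applying it once more to the boundary of \<tau>' reduces the
  claim to \<tau>'.\<close>

lemma bd_bd_frag_of: "finite \<tau> \<Longrightarrow> bd (bd (frag_of \<tau>)) = 0"
proof (induction "card \<tau>" arbitrary: \<tau>)
  case 0
  then show ?case by (simp add: bd_frag_of)
next
  case (Suc s)
  then have "\<tau> \<noteq> {}" by auto
  define w where "w = Min \<tau>"
  define \<tau>' where "\<tau>' = \<tau> - {w}"
  have w: "w \<in> \<tau>" "\<And>u. u \<in> \<tau> \<Longrightarrow> w \<le> u" using Suc \<open>\<tau> \<noteq> {}\<close> by (auto simp: w_def)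
  have IH: "bd (bd (frag_of \<tau>')) = 0"
    using Suc w by (intro Suc.hyps(1)) (auto simp: \<tau>'_def)
  have "coned w (frag_of \<tau>') = frag_of \<tau>"
    using w by (simp add: coned_frag_of \<tau>'_def insert_absorb)
  then have "bd (frag_of \<tau>) = frag_of \<tau>' - coned w (bd (frag_of \<tau>'))"
    using cone_homotopy_frag_of[of \<tau>' w] Suc.prems w(2)
    by (metis (no_types, lifting) DiffD1 \<tau>'_def add_diff_cancel_right' finite_Diff)
  moreover have "bd (coned w (bd (frag_of \<tau>'))) + coned w (bd (bd (frag_of \<tau>'))) = bd (frag_of \<tau>')"
    using keys_bd_frag_of[of \<tau>'] Suc.prems w(2) by (intro cone_homotopy) (auto simp: \<tau>'_def)
  ultimately show ?case using IH by (simp add: bd.diff)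
qed

lemma bd_bd:
  assumes "\<And>\<tau>. \<tau> \<in> Poly_Mapping.keys c \<Longrightarrow> finite \<tau>"
  shows "bd (bd c) = 0"
proof -
  have "frag.subspace {c. bd (bd c) = 0}"
    by (rule frag.subspaceI) (auto simp: bd.add bd.scale)
  moreover have "frag_of ` Poly_Mapping.keys c \<subseteq> {c. bd (bd c) = 0}"
    using assms bd_bd_frag_of by auto
  ultimately have "frag.span (frag_of ` Poly_Mapping.keys c) \<subseteq> {c. bd (bd c) = 0}"
    by (intro frag.span_minimal)
  then show ?thesis using keys_subset_iff_span[of c "Poly_Mapping.keys c"] by auto
qed

definition boundary_span :: "nat set set \<Rightarrow> (nat set \<Rightarrow>\<^sub>0 int) set" where
  "boundary_span F = frag.span (bd ` frag_of ` F)"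

lemma boundary_span_eq: "boundary_span F = bd ` {c. Poly_Mapping.keys c \<subseteq> F}"
  using keys_subset_iff_span[of _ F] by (auto simp: boundary_span_def bd.span_image)

lemma boundary_span_mono: "F \<subseteq> F' \<Longrightarrow> boundary_span F \<subseteq> boundary_span F'"
  unfolding boundary_span_def by (intro frag.span_mono image_mono)

lemma subspace_boundary_span: "frag.subspace (boundary_span F)"
  by (simp add: boundary_span_def)

lemma bd_in_boundary_span: "Poly_Mapping.keys c \<subseteq> F \<Longrightarrow> bd c \<in> boundary_span F"
  by (auto simp: boundary_span_eq)

text \<open>Modulo the boundary of its cone, a face avoiding the least vertex \<open>w\<close> is a
  combination of faces through \<open>w\<close>. Hence faces through the least vertex suffice as
  generators modulo boundaries.\<close>

lemma frag_of_in_span_cone: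
  assumes "finite \<tau>" "\<And>u. u \<in> \<tau> \<Longrightarrow> w \<le> u" "w \<notin> \<tau>"
  shows "frag_of \<tau> \<in> frag.span ({bd (frag_of (insert w \<tau>))} \<union> frag_of ` (\<lambda>u. insert w (\<tau> - {u})) ` \<tau>)"
proof -
  have "Poly_Mapping.keys (coned w (bd (frag_of \<tau>))) \<subseteq> (\<lambda>u. insert w (\<tau> - {u})) ` \<tau>"
    using keys_coned[OF keys_bd_frag_of, of w \<tau>] by blast
  then have "coned w (bd (frag_of \<tau>)) \<in>
      frag.span ({bd (frag_of (insert w \<tau>))} \<union> frag_of ` (\<lambda>u. insert w (\<tau> - {u})) ` \<tau>)"
    unfolding keys_subset_iff_span by (meson frag.span_mono subsetD sup_ge2)
  moreover have "frag_of \<tau> = bd (frag_of (insert w \<tau>)) + coned w (bd (frag_of \<tau>))"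
    using cone_homotopy_frag_of[OF assms(1), of w] assms(2,3) by (simp add: coned_frag_of)
  ultimately show ?thesis
    by (metis (no_types, lifting) UnCI frag.span_add frag.span_base singletonI)
qed

text \<open>Applying \<open>bd\<close> to the homotopy formula kills the first term, so \<rho> has
  the same boundary as the cone over its boundary, and that cone is supported on faces through
  \<open>w\<close>.\<close>

lemma bd_in_boundary_span_through:
  assumes fin: "finite \<sigma>" and \<rho>: "\<rho> \<subseteq> \<sigma>" and w: "w \<in> \<sigma>" "\<And>u. u \<in> \<sigma> \<Longrightarrow> w \<le> u"
  shows "bd (frag_of \<rho>) \<in> boundary_span {\<rho>'. \<rho>' \<subseteq> \<sigma> \<and> w \<in> \<rho>' \<and> card \<rho>' = card \<rho>}"
proof (cases "w \<in> \<rho>")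
  case True
  then show ?thesis using \<rho> by (intro bd_in_boundary_span) auto
next
  case False
  have fin\<rho>: "finite \<rho>" using fin \<rho> finite_subset by blast
  have "bd (frag_of \<rho>) = bd (bd (coned w (frag_of \<rho>)) + coned w (bd (frag_of \<rho>)))"
    using cone_homotopy_frag_of[OF fin\<rho>, of w] w(2) \<rho> by (simp add: subset_iff)
  also have "\<dots> = bd (coned w (bd (frag_of \<rho>)))"
    using False fin\<rho> by (simp add: bd.add coned_frag_of bd_bd_frag_of)
  also have "\<dots> \<in> boundary_span {\<rho>'. \<rho>' \<subseteq> \<sigma> \<and> w \<in> \<rho>' \<and> card \<rho>' = card \<rho>}"
  proof (rule bd_in_boundary_span)
    have "card (insert w (\<rho> - {u})) = card \<rho>" if "u \<in> \<rho>" for u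
      using that False fin\<rho> card_Suc_Diff1[of \<rho> u] by simp
    then show "Poly_Mapping.keys (coned w (bd (frag_of \<rho>))) \<subseteq>
        {\<rho>'. \<rho>' \<subseteq> \<sigma> \<and> w \<in> \<rho>' \<and> card \<rho>' = card \<rho>}"
      using keys_coned[OF keys_bd_frag_of, of w \<rho>] \<rho> w(1) by fastforce
  qed
  finally show ?thesis .
qed

section \<open>Homology of simplicial complexes\<close>

definition simplicial_complex :: "nat set set \<Rightarrow> bool" where
  "simplicial_complex K \<longleftrightarrow> finite K \<and> (\<forall>\<sigma>\<in>K. finite \<sigma> \<and> \<sigma> \<noteq> {} \<and> (\<forall>\<tau>. \<tau> \<subseteq> \<sigma> \<and> \<tau> \<noteq> {} \<longrightarrow> \<tau> \<in> K))"

lemma simplicial_complexD: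
  assumes "simplicial_complex K"
  shows "finite K" "\<sigma> \<in> K \<Longrightarrow> finite \<sigma> \<and> \<sigma> \<noteq> {}" "\<sigma> \<in> K \<Longrightarrow> \<tau> \<subseteq> \<sigma> \<Longrightarrow> \<tau> \<noteq> {} \<Longrightarrow> \<tau> \<in> K"
  using assms unfolding simplicial_complex_def by blast+

lemma keys_bd_subset:
  assumes "Poly_Mapping.keys c \<subseteq> F" "\<And>\<sigma> v. \<sigma> \<in> F \<Longrightarrow> v \<in> \<sigma> \<Longrightarrow> \<sigma> - {v} \<in> E"
  shows "Poly_Mapping.keys (bd c) \<subseteq> E"
proof
  fix \<tau> assume "\<tau> \<in> Poly_Mapping.keys (bd c)"
  then obtain \<sigma> v where "\<tau> = \<sigma> - {v}" "\<sigma> \<in> F" "v \<in> \<sigma>" using keys_bd[OF assms(1)] by blast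
  then show "\<tau> \<in> E" using assms(2) by simp
qed

lemma dimension_eq_iff: "dimension \<sigma> = int k \<longleftrightarrow> card \<sigma> = Suc k"
  by (auto simp: dimension_def)

interpretation face_boundary: module_hom "frag_cmul :: int \<Rightarrow> (nat set \<Rightarrow>\<^sub>0 int) \<Rightarrow> _" frag_cmul "face_boundary K" for K
  unfolding face_boundary_def by (rule module_hom_frag_extend)

lemma face_boundary_eq_bd:
  assumes "\<And>\<sigma> v. \<sigma> \<in> Poly_Mapping.keys c \<Longrightarrow> v \<in> \<sigma> \<Longrightarrow> \<sigma> - {v} \<in> K"
  shows "face_boundary K c = bd c"
  unfolding face_boundary_def bd_def facet_sign_def
proof (rule frag_extend_eq)
  fix \<sigma> assume "\<sigma> \<in> Poly_Mapping.keys c"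
  then have "{v \<in> \<sigma>. \<sigma> - {v} \<in> K} = \<sigma>" using assms by auto
  then show "(\<Sum>v\<in>{v \<in> \<sigma>. \<sigma> - {v} \<in> K}. frag_cmul ((- 1) ^ card {u \<in> \<sigma>. u < v}) (frag_of (\<sigma> - {v}))) =
    (\<Sum>v\<in>\<sigma>. frag_cmul ((- 1) ^ card {u \<in> \<sigma>. u < v}) (frag_of (\<sigma> - {v})))" by simp
qed

lemma face_boundary_vertices:
  assumes "simplicial_complex K" "\<And>\<sigma>. \<sigma> \<in> Poly_Mapping.keys c \<Longrightarrow> card \<sigma> = 1"
  shows "face_boundary K c = 0"
  unfolding face_boundary_def
proof (rule frag_extend_eq_0)
  fix \<sigma> assume "\<sigma> \<in> Poly_Mapping.keys c"
  then obtain u where "\<sigma> = {u}" using assms(2) card_1_singletonE by metis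
  then have "{v\<in>\<sigma>. \<sigma> - {v} \<in> K} = {}" using assms(1) by (auto simp: simplicial_complex_def)
  then show "(\<Sum>v\<in>{v \<in> \<sigma>. \<sigma> - {v} \<in> K}. frag_cmul ((- 1) ^ card {u \<in> \<sigma>. u < v}) (frag_of (\<sigma> - {v}))) = 0"
    by (simp only: sum.empty)
qed

lemma free_quotient_homology:
  assumes "face_boundaries k K \<subseteq> face_cycles k K"
  shows "free_quotient {\<sigma>\<in>K. dimension \<sigma> = k} (face_cycles k K) (face_boundaries k K)"
proof
  have C: "frag.subspace {c. Poly_Mapping.keys c \<subseteq> F}" for F :: "nat set set"
    unfolding keys_subset_iff_span by simp
  show "frag.subspace (face_cycles k K)"
    using frag.subspace_inter[OF C face_boundary.subspace_kernel, of "{\<sigma>\<in>K. dimension \<sigma> = k}" K]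
    by (simp add: face_cycles_def face_chain_group_def Int_def)
  show "frag.subspace (face_boundaries k K)"
    using face_boundary.subspace_image[OF C[of "{\<sigma>\<in>K. dimension \<sigma> = k + 1}"], of K]
    by (simp add: face_boundaries_def face_chain_group_def free_Abelian_group_def)
qed (use assms in \<open>auto simp: face_cycles_def face_chain_group_def\<close>)

lemma face_homology_eq: "face_homology k K =
    subgroup_generated (free_Abelian_group {\<sigma>\<in>K. dimension \<sigma> = k}) (face_cycles k K) Mod face_boundaries k K"
  by (simp add: face_homology_def face_chain_group_def)

lemma face_boundary_insert_empty:
  assumes "simplicial_complex K" "Poly_Mapping.keys c \<subseteq> insert {} K"
  shows "face_boundary (insert {} K) c = bd c"
proof (rule face_boundary_eq_bd)
  fix \<sigma> v assume \<sigma>: "\<sigma> \<in> Poly_Mapping.keys c" "v \<in> \<sigma>"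
  then have "\<sigma> \<in> K" using assms(2) by blast
  then show "\<sigma> - {v} \<in> insert {} K"
    using simplicial_complexD(3)[OF assms(1), of \<sigma> "\<sigma> - {v}"] by blast
qed

text \<open>Once the empty face is added, \<open>face_boundary\<close> agrees with \<open>bd\<close>
  on all chains of the complex, so a single exactness criterion covers every integer degree, degree
  0 and negative degrees included.\<close>

lemma trivial_reduced_face_homology:
  assumes K: "simplicial_complex K"
    and ex: "\<And>c. Poly_Mapping.keys c \<subseteq> {\<sigma>\<in>insert {} K. dimension \<sigma> = k} \<Longrightarrow> bd c = 0 \<Longrightarrow>
      c \<in> boundary_span {\<sigma>\<in>insert {} K. dimension \<sigma> = k + 1}"
  shows "trivial_group (reduced_face_homology k K)"
proof -
  let ?K = "insert {} K"
  have B: "face_boundaries k ?K = boundary_span {\<sigma>\<in>?K. dimension \<sigma> = k + 1}"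
    unfolding face_boundaries_def boundary_span_eq face_chain_group_def
    by (rule image_cong)
       (use face_boundary_insert_empty[OF K] in \<open>auto simp: free_Abelian_group_def subset_iff\<close>)
  have Z: "face_cycles k ?K = {c. Poly_Mapping.keys c \<subseteq> {\<sigma>\<in>?K. dimension \<sigma> = k} \<and> bd c = 0}"
    unfolding face_cycles_def face_chain_group_def
    using face_boundary_insert_empty[OF K] by (auto simp: subset_iff)
  have "bd c \<in> face_cycles k ?K" if c: "Poly_Mapping.keys c \<subseteq> {\<sigma>\<in>?K. dimension \<sigma> = k + 1}" for c
  proof -
    have fin: "finite \<sigma>" if "\<sigma> \<in> ?K" for \<sigma>
      using simplicial_complexD(2)[OF K, of \<sigma>] that by auto
    have bb: "bd (bd c) = 0"
    proof (rule bd_bd)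
      fix \<tau> assume "\<tau> \<in> Poly_Mapping.keys c"
      then have "\<tau> \<in> ?K" using c by blast
      then show "finite \<tau>" by (rule fin)
    qed
    have facet: "\<sigma> - {v} \<in> {\<sigma>\<in>?K. dimension \<sigma> = k}"
      if "\<sigma> \<in> ?K" "dimension \<sigma> = k + 1" "v \<in> \<sigma>" for \<sigma> v
    proof -
      have "card \<sigma> = Suc (card (\<sigma> - {v}))" using card_Suc_Diff1[OF fin[OF that(1)] that(3)] by simp
      moreover have "\<sigma> - {v} \<in> ?K"
        using simplicial_complexD(3)[OF K, of \<sigma> "\<sigma> - {v}"] that by blast
      ultimately show ?thesis using that(2) by (simp add: dimension_def)
    qed
    have "Poly_Mapping.keys (bd c) \<subseteq> {\<sigma>\<in>?K. dimension \<sigma> = k}"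
    proof (rule keys_bd_subset[OF c])
      fix \<sigma> v assume "\<sigma> \<in> {\<sigma>\<in>?K. dimension \<sigma> = k + 1}" "v \<in> \<sigma>"
      then show "\<sigma> - {v} \<in> {\<sigma>\<in>?K. dimension \<sigma> = k}" by (intro facet) simp_all
    qed
    then show ?thesis using bb unfolding Z by simp
  qed
  then have BZ: "face_boundaries k ?K \<subseteq> face_cycles k ?K"
    unfolding B boundary_span_eq by auto
  interpret free_quotient "{\<sigma>\<in>?K. dimension \<sigma> = k}" "face_cycles k ?K" "face_boundaries k ?K"
    using BZ by (rule free_quotient_homology)
  have "face_cycles k ?K \<subseteq> face_boundaries k ?K"
    unfolding Z B using ex by auto
  then show ?thesis
    using trivial_group_quotient unfolding reduced_face_homology_def face_homology_eq by blast
qed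

text \<open>Indexed by the number of vertices: dimension \<open>k\<close> corresponds to
  \<open>s = k + 1\<close>.\<close>

abbreviation faces :: "nat set set \<Rightarrow> nat \<Rightarrow> nat set set" where
  "faces K s \<equiv> {\<sigma>\<in>K. card \<sigma> = s}"

context
  fixes K :: "nat set set" and k :: nat
  assumes K: "simplicial_complex K"
begin

lemma face_boundary_ge_1:
  assumes "Poly_Mapping.keys c \<subseteq> faces K (Suc (Suc m))"
  shows "face_boundary K c = bd c"
proof (rule face_boundary_eq_bd)
  fix \<sigma> v assume \<sigma>: "\<sigma> \<in> Poly_Mapping.keys c" "v \<in> \<sigma>"
  then have "\<sigma> \<in> K" "card \<sigma> = Suc (Suc m)" using assms by auto
  moreover have "finite \<sigma>" using simplicial_complexD(2)[OF K \<open>\<sigma> \<in> K\<close>] by simp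
  ultimately have "card (\<sigma> - {v}) = Suc m" using \<sigma> by simp
  then have "\<sigma> - {v} \<noteq> {}" by (metis card.empty nat.simps(3))
  with Diff_subset show "\<sigma> - {v} \<in> K" by (rule simplicial_complexD(3)[OF K \<open>\<sigma> \<in> K\<close>])
qed

lemma face_boundaries_eq: "face_boundaries (int k) K = boundary_span (faces K (k + 2))"
proof -
  have *: "{\<sigma>\<in>K. dimension \<sigma> = int k + 1} = faces K (k + 2)"
    by (auto simp: dimension_def)
  show ?thesis
    unfolding face_boundaries_def boundary_span_eq face_chain_group_def *
    by (rule image_cong) (use face_boundary_ge_1[of _ k] in \<open>auto simp: free_Abelian_group_def\<close>)
qed

lemma face_cycles_subset: "face_cycles (int k) K \<subseteq> {c. Poly_Mapping.keys c \<subseteq> faces K (k + 1)}"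
  by (auto simp: face_cycles_def face_chain_group_def dimension_eq_iff subset_iff)

text \<open>Only an inclusion, because in degree 0 every unreduced chain is a cycle, whereas
  \<open>bd\<close> is the augmentation there. In positive degrees it is an equality.\<close>

lemma face_cycles_supset:
  "{c. Poly_Mapping.keys c \<subseteq> faces K (k + 1) \<and> bd c = 0} \<subseteq> face_cycles (int k) K"
proof clarify
  fix c assume c: "Poly_Mapping.keys c \<subseteq> faces K (k + 1)" "bd c = 0"
  have "face_boundary K c = 0"
  proof (cases k)
    case 0
    then show ?thesis using c by (intro face_boundary_vertices K) auto
  next
    case (Suc m)
    then show ?thesis using face_boundary_ge_1[of c m] c by simp
  qed
  then show "c \<in> face_cycles (int k) K"
    using c by (auto simp: face_cycles_def face_chain_group_def dimension_eq_iff subset_iff)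
qed

lemma face_cycles_eq:
  assumes "0 < k"
  shows "face_cycles (int k) K = {c. Poly_Mapping.keys c \<subseteq> faces K (k + 1) \<and> bd c = 0}"
proof (intro equalityI face_cycles_supset subsetI)
  fix c assume c: "c \<in> face_cycles (int k) K"
  obtain m where m: "k = Suc m" using assms gr0_conv_Suc by auto
  have keys: "Poly_Mapping.keys c \<subseteq> faces K (k + 1)" using c face_cycles_subset by blast
  then show "c \<in> {c. Poly_Mapping.keys c \<subseteq> faces K (k + 1) \<and> bd c = 0}"
    using c face_boundary_ge_1[of c m] m by (auto simp: face_cycles_def)
qed

lemma free_quotient_betti:
  "free_quotient {\<sigma>\<in>K. dimension \<sigma> = int k} (face_cycles (int k) K) (face_boundaries (int k) K)"
proof (rule free_quotient_homology)
  have "bd c \<in> face_cycles (int k) K" if c: "Poly_Mapping.keys c \<subseteq> faces K (k + 2)" for c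
  proof (rule subsetD[OF face_cycles_supset], intro CollectI conjI)
    show "bd (bd c) = 0" using c simplicial_complexD(2)[OF K] by (intro bd_bd) blast
    have "\<sigma> - {v} \<in> faces K (k + 1)" if \<sigma>: "\<sigma> \<in> faces K (k + 2)" "v \<in> \<sigma>" for \<sigma> v
    proof -
      have "\<sigma> \<in> K" using \<sigma> by simp
      then have 1: "card (\<sigma> - {v}) = k + 1" using simplicial_complexD(2)[OF K \<open>\<sigma> \<in> K\<close>] \<sigma> by simp
      then have "\<sigma> - {v} \<noteq> {}" by (metis card.empty Suc_eq_plus1 nat.simps(3))
      with Diff_subset have "\<sigma> - {v} \<in> K" by (rule simplicial_complexD(3)[OF K \<open>\<sigma> \<in> K\<close>])
      then show ?thesis using 1 by simp
    qed
    then show "Poly_Mapping.keys (bd c) \<subseteq> faces K (k + 1)" by (rule keys_bd_subset[OF c])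
  qed
  then show "face_boundaries (int k) K \<subseteq> face_cycles (int k) K"
    unfolding face_boundaries_eq boundary_span_eq by auto
qed

lemma betti_le:
  assumes "finite T" "face_cycles (int k) K \<subseteq> frag.span (boundary_span (faces K (k + 2)) \<union> T)"
  shows "betti (int k) K \<le> card T"
proof -
  interpret free_quotient "{\<sigma>\<in>K. dimension \<sigma> = int k}" "face_cycles (int k) K" "face_boundaries (int k) K"
    by (rule free_quotient_betti)
  show ?thesis
    using abelian_rank_le[OF assms(1)] assms(2)
    unfolding betti_def face_homology_eq face_boundaries_eq by blast
qed

text \<open>Rank-nullity: the boundary map into chains on \<open>E\<close> costs at most
  \<open>card E\<close>, and dividing by boundaries, which lie in the span of \<open>G\<close>,
  costs at most \<open>card G\<close>.\<close>

lemma betti_ge: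
  assumes E: "finite E" "\<And>\<tau> v. \<tau> \<in> faces K (k + 1) \<Longrightarrow> v \<in> \<tau> \<Longrightarrow> \<tau> - {v} \<in> E"
    and G: "finite G" "bd ` frag_of ` faces K (k + 2) \<subseteq> frag.span G"
  shows "card (faces K (k + 1)) \<le> betti (int k) K + card G + card E"
proof -
  interpret free_quotient "{\<sigma>\<in>K. dimension \<sigma> = int k}" "face_cycles (int k) K" "face_boundaries (int k) K"
    by (rule free_quotient_betti)
  have finK: "finite K" using simplicial_complexD(1)[OF K] .
  have finF: "finite (faces K (k + 1))" using finK by simp
  have img: "Poly_Mapping.keys (bd (frag_of \<tau>)) \<subseteq> E" if "\<tau> \<in> faces K (k + 1)" for \<tau>
  proof (rule subset_trans[OF keys_bd_frag_of], rule image_subsetI)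
    show "\<tau> - {v} \<in> E" if "v \<in> \<tau>" for v using \<open>\<tau> \<in> faces K (k + 1)\<close> that by (rule E(2))
  qed
  obtain I where I: "I \<subseteq> {c. Poly_Mapping.keys c \<subseteq> faces K (k + 1) \<and> bd c = 0}"
    "indep_mod (frag.span G) (\<lambda>x. x) I" "card (faces K (k + 1)) \<le> card I + card G + card E"
    by (rule obtain_indep_mod_in_kernel[OF bd.module_hom_axioms finF E(1) G(1) img])
  have "face_boundaries (int k) K \<subseteq> frag.span G"
    unfolding face_boundaries_eq boundary_span_def using G(2) by (simp add: frag.span_minimal)
  then have "indep_mod (face_boundaries (int k) K) (\<lambda>x. x) I"
    using I(2) unfolding indep_mod_def by (metis (no_types, lifting) subsetD)
  then have "card I \<le> betti (int k) K"
    unfolding betti_def face_homology_eq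
    using finK I(1) face_cycles_supset by (intro abelian_rank_ge) auto
  then show ?thesis using I(3) by linarith
qed

end

lemma simplicial_generated_complex:
  assumes "finite X" "\<And>\<sigma>. \<sigma> \<in> X \<Longrightarrow> finite \<sigma>"
  shows "simplicial_complex (generated_complex X)"
proof -
  have "generated_complex X \<subseteq> (\<Union>\<sigma>\<in>X. Pow \<sigma>)" by (auto simp: generated_complex_def)
  moreover have "finite (\<Union>\<sigma>\<in>X. Pow \<sigma>)" using assms by auto
  ultimately have "finite (generated_complex X)" using finite_subset by blast
  moreover have "finite \<tau>" if \<tau>: "\<tau> \<in> generated_complex X" for \<tau>
  proof -
    obtain \<sigma> where "\<sigma> \<in> X" "\<tau> \<subseteq> \<sigma>" using \<tau> unfolding generated_complex_def by blast
    then show ?thesis using assms(2)[of \<sigma>] finite_subset[of \<tau> \<sigma>] by simp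
  qed
  moreover have "\<rho> \<in> generated_complex X"
    if "\<tau> \<in> generated_complex X" "\<rho> \<subseteq> \<tau>" "\<rho> \<noteq> {}" for \<rho> \<tau>
    using that unfolding generated_complex_def by blast
  moreover have "\<tau> \<noteq> {}" if "\<tau> \<in> generated_complex X" for \<tau>
    using that by (simp add: generated_complex_def)
  ultimately show ?thesis by (simp add: simplicial_complex_def)
qed

section \<open>Betti numbers of generated complexes\<close>

text \<open>By coning from the least vertex, these faces generate the \<open>s\<close>-chains of the
  simplex modulo boundaries. One of the \<open>Suc s\<close> vertices is fixed, so \<open>s\<close>
  remain to be chosen.\<close>

definition min_faces :: "nat \<Rightarrow> nat set \<Rightarrow> nat set set" where
  "min_faces s \<sigma> = {\<tau>. \<tau> \<subseteq> \<sigma> \<and> Min \<sigma> \<in> \<tau> \<and> card \<tau> = Suc s}"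

lemma min_faces:
  assumes "finite \<sigma>" "\<sigma> \<noteq> {}"
  shows "finite (min_faces s \<sigma>)" "card (min_faces s \<sigma>) = (card \<sigma> - 1) choose s"
proof -
  let ?A = "{\<rho>. \<rho> \<subseteq> \<sigma> - {Min \<sigma>} \<and> card \<rho> = s}"
  have fin: "finite \<tau>" if "\<tau> \<subseteq> \<sigma>" for \<tau> using that assms finite_subset by blast
  have "bij_betw (insert (Min \<sigma>)) ?A (min_faces s \<sigma>)"
  proof (rule bij_betw_byWitness[where f' = "\<lambda>\<tau>. \<tau> - {Min \<sigma>}"])
    show "insert (Min \<sigma>) ` ?A \<subseteq> min_faces s \<sigma>"
    proof clarify
      fix \<rho> assume \<rho>: "\<rho> \<subseteq> \<sigma> - {Min \<sigma>}"
      then have "finite \<rho>" "Min \<sigma> \<notin> \<rho>" using fin[of \<rho>] by auto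
      then show "insert (Min \<sigma>) \<rho> \<in> min_faces (card \<rho>) \<sigma>"
        using \<rho> Min_in[OF assms] by (auto simp: min_faces_def)
    qed
    show "(\<lambda>\<tau>. \<tau> - {Min \<sigma>}) ` min_faces s \<sigma> \<subseteq> ?A"
      using fin by (auto simp: min_faces_def)
  qed (auto simp: min_faces_def)
  moreover have "card ?A = (card \<sigma> - 1) choose s"
    using n_subsets[of "\<sigma> - {Min \<sigma>}" s] assms by simp
  moreover have "finite ?A" using assms by simp
  ultimately show "finite (min_faces s \<sigma>)" "card (min_faces s \<sigma>) = (card \<sigma> - 1) choose s"
    using bij_betw_same_card bij_betw_finite by fastforce+
qed

context
  fixes X :: "nat set set"
  assumes finX: "finite X" and X: "\<And>\<sigma>. \<sigma> \<in> X \<Longrightarrow> finite \<sigma> \<and> \<sigma> \<noteq> {}"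
begin

lemma complex: "simplicial_complex (generated_complex X)"
  using finX X by (intro simplicial_generated_complex) auto

lemma finite_min_faces: "finite (\<Union>\<sigma>\<in>X. min_faces s \<sigma>)"
  using finX X min_faces(1) by auto

lemma card_min_faces: "card (\<Union>\<sigma>\<in>X. min_faces s \<sigma>) \<le> (\<Sum>\<sigma>\<in>X. (card \<sigma> - 1) choose s)"
  using card_UN_le[OF finX, of "min_faces s"] X by (simp add: min_faces(2))

text \<open>Every \<open>k\<close>-face lies in some member of \<open>X\<close> and is, modulo
  boundaries, a combination of its faces through the least vertex; those are counted by the binomial
  coefficients.\<close>

lemma betti_generated_le: "betti (int k) (generated_complex X) \<le> (\<Sum>\<sigma>\<in>X. (card \<sigma> - 1) choose k)"
proof -
  let ?T = "frag_of ` (\<Union>\<sigma>\<in>X. min_faces k \<sigma>)" and ?B = "boundary_span (faces (generated_complex X) (k + 2))"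
  have "frag_of \<tau> \<in> frag.span (?B \<union> ?T)" if \<tau>: "\<tau> \<in> faces (generated_complex X) (k + 1)" for \<tau>
  proof -
    obtain \<sigma> where \<sigma>: "\<sigma> \<in> X" "\<tau> \<subseteq> \<sigma>" using \<tau> by (auto simp: generated_complex_def)
    define w where "w = Min \<sigma>"
    have w: "w \<in> \<sigma>" "\<And>u. u \<in> \<sigma> \<Longrightarrow> w \<le> u" and fin: "finite \<sigma>" "finite \<tau>"
      using X \<sigma> finite_subset by (auto simp: w_def)
    show ?thesis
    proof (cases "w \<in> \<tau>")
      case True
      then have "\<tau> \<in> min_faces k \<sigma>" using \<tau> \<sigma> by (auto simp: min_faces_def w_def)
      then show ?thesis using \<sigma> by (intro frag.span_base) auto
    next
      case False
      have "insert w \<tau> \<in> faces (generated_complex X) (k + 2)"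
        using False fin \<tau> w \<sigma> by (auto simp: generated_complex_def)
      then have "bd (frag_of (insert w \<tau>)) \<in> ?B"
        by (intro bd_in_boundary_span) auto
      moreover have "insert w (\<tau> - {u}) \<in> min_faces k \<sigma>" if "u \<in> \<tau>" for u
        using that False fin \<tau> w \<sigma> by (auto simp: min_faces_def w_def)
      ultimately have "{bd (frag_of (insert w \<tau>))} \<union> frag_of ` (\<lambda>u. insert w (\<tau> - {u})) ` \<tau> \<subseteq> ?B \<union> ?T"
        using \<sigma>(1) by auto
      then show ?thesis
        using frag_of_in_span_cone[OF fin(2), of w] w(2) \<sigma>(2) False frag.span_mono by blast
    qed
  qed
  then have "frag.span (frag_of ` faces (generated_complex X) (k + 1)) \<subseteq> frag.span (?B \<union> ?T)"
    by (intro frag.span_minimal) auto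
  then have "face_cycles (int k) (generated_complex X) \<subseteq> frag.span (?B \<union> ?T)"
    using face_cycles_subset[OF complex, of k] unfolding keys_subset_iff_span by blast
  then have "betti (int k) (generated_complex X) \<le> card ?T"
    using finite_min_faces by (intro betti_le complex) auto
  also have "\<dots> \<le> (\<Sum>\<sigma>\<in>X. (card \<sigma> - 1) choose k)"
    using card_image_le[OF finite_min_faces] card_min_faces le_trans by blast
  finally show ?thesis .
qed

text \<open>The first error term bounds the rank of the boundaries, which are spanned by boundaries
  of faces through least vertices. The second bounds the rank of the boundary map on
  \<open>k\<close>-faces, whose images are supported on \<open>k\<close>-subsets of
  \<open>V\<close>; for \<open>k = 0\<close> this is the augmentation.\<close>

lemma betti_generated_ge:
  assumes V: "finite V" "\<Union>X \<subseteq> V"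
  shows "card (faces (generated_complex X) (k + 1)) \<le>
    betti (int k) (generated_complex X) + (\<Sum>\<sigma>\<in>X. (card \<sigma> - 1) choose (k + 1)) + (card V choose k)"
proof -
  let ?G = "bd ` frag_of ` (\<Union>\<sigma>\<in>X. min_faces (k + 1) \<sigma>)"
  have "bd (frag_of \<rho>) \<in> frag.span ?G" if \<rho>: "\<rho> \<in> faces (generated_complex X) (k + 2)" for \<rho>
  proof -
    obtain \<sigma> where \<sigma>: "\<sigma> \<in> X" "\<rho> \<subseteq> \<sigma>" using \<rho> by (auto simp: generated_complex_def)
    have w: "Min \<sigma> \<in> \<sigma>" "\<And>u. u \<in> \<sigma> \<Longrightarrow> Min \<sigma> \<le> u" "finite \<sigma>" using X \<sigma> by auto
    have "bd (frag_of \<rho>) \<in> boundary_span (min_faces (k + 1) \<sigma>)"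
      using bd_in_boundary_span_through[OF w(3) \<sigma>(2) w(1,2)] \<rho> by (simp add: min_faces_def)
    also have "\<dots> \<subseteq> frag.span ?G"
      unfolding boundary_span_def using \<sigma>(1) by (intro frag.span_mono) auto
    finally show ?thesis .
  qed
  moreover have "\<tau> - {v} \<in> {\<rho>. \<rho> \<subseteq> V \<and> card \<rho> = k}" if "\<tau> \<in> faces (generated_complex X) (k + 1)" "v \<in> \<tau>" for \<tau> v
    using that V by (auto simp: generated_complex_def)
  ultimately have "card (faces (generated_complex X) (k + 1)) \<le>
      betti (int k) (generated_complex X) + card ?G + card {\<rho>. \<rho> \<subseteq> V \<and> card \<rho> = k}"
    using finite_min_faces V(1) by (intro betti_ge complex) auto
  moreover have "card ?G \<le> (\<Sum>\<sigma>\<in>X. (card \<sigma> - 1) choose (k + 1))"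
    unfolding image_image using card_image_le[OF finite_min_faces] card_min_faces le_trans by blast
  ultimately show ?thesis using n_subsets[OF V(1)] by simp
qed

end

section \<open>Overlapping simplices\<close>

text \<open>Two thresholds, since a simplex matters in degree \<open>k\<close> only with at least
  \<open>k + 1\<close> vertices, while two of them already interfere through a common
  \<open>(k - 1)\<close>-face, that is \<open>k\<close> common vertices.\<close>

definition overlaps :: "nat \<Rightarrow> nat \<Rightarrow> nat set set \<Rightarrow> (nat set \<times> nat set) set" where
  "overlaps m s X = {(\<sigma>, \<sigma>'). \<sigma> \<in> X \<and> \<sigma>' \<in> X \<and> \<sigma> \<noteq> \<sigma>' \<and> m \<le> card \<sigma> \<and> m \<le> card \<sigma>' \<and> s \<le> card (\<sigma> \<inter> \<sigma>')}"

lemma overlaps_mono: "m' \<le> m \<Longrightarrow> s' \<le> s \<Longrightarrow> overlaps m s X \<subseteq> overlaps m' s' X"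
  unfolding overlaps_def by clarsimp

lemma finite_overlaps: "finite X \<Longrightarrow> finite (overlaps m s X)"
  by (rule finite_subset[of _ "X \<times> X"]) (auto simp: overlaps_def)

lemma generated_complexE:
  assumes "\<tau> \<in> generated_complex X"
  obtains \<sigma> where "\<sigma> \<in> X" "\<tau> \<subseteq> \<sigma>" "\<tau> \<noteq> {}"
  using assms unfolding generated_complex_def by blast

lemma generated_complexI: "\<sigma> \<in> X \<Longrightarrow> \<tau> \<subseteq> \<sigma> \<Longrightarrow> \<tau> \<noteq> {} \<Longrightarrow> \<tau> \<in> generated_complex X"
  unfolding generated_complex_def by blast

lemma lookup_bd:
  assumes "finite S"
  shows "Poly_Mapping.lookup (bd (\<Sum>\<tau>\<in>S. frag_cmul (a \<tau>) (frag_of \<tau>))) \<kappa> =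
    (\<Sum>\<tau>\<in>S. a \<tau> * Poly_Mapping.lookup (bd (frag_of \<tau>)) \<kappa>)"
  by (simp add: bd.sum bd.scale lookup_sum)

lemma lookup_bd_frag_of_eq_0:
  assumes "\<And>v. v \<in> \<tau> \<Longrightarrow> \<kappa> \<noteq> \<tau> - {v}"
  shows "Poly_Mapping.lookup (bd (frag_of \<tau>)) \<kappa> = 0"
proof (rule ccontr)
  assume "Poly_Mapping.lookup (bd (frag_of \<tau>)) \<kappa> \<noteq> 0"
  then have "\<kappa> \<in> Poly_Mapping.keys (bd (frag_of \<tau>))" by (simp add: in_keys_iff)
  then have "\<kappa> \<in> (\<lambda>v. \<tau> - {v}) ` \<tau>" using keys_bd_frag_of[of \<tau>] by (rule rev_subsetD)
  then obtain v where "v \<in> \<tau>" "\<kappa> = \<tau> - {v}" by (rule imageE)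
  then show False using assms by simp
qed

context
  fixes X :: "nat set set" and R :: nat
  assumes finX: "finite X" and X: "\<And>\<sigma>. \<sigma> \<in> X \<Longrightarrow> finite \<sigma> \<and> \<sigma> \<noteq> {}"
    and R: "\<And>\<sigma>. \<sigma> \<in> X \<Longrightarrow> card \<sigma> \<le> R"
begin

text \<open>Each overlap accounts for at most \<open>2 ^ R\<close> faces of its first simplex; this
  is the source of the constant in the Betti number bounds.\<close>

lemma card_pairs_le:
  assumes "P \<subseteq> overlaps m s X"
  shows "finite (SIGMA p:P. Pow (fst p))" "card (SIGMA p:P. Pow (fst p)) \<le> 2 ^ R * card (overlaps m s X)"
proof -
  have fin: "finite P" using assms finite_overlaps[OF finX] finite_subset by blast
  have fst: "fst p \<in> X" if "p \<in> P" for p using that assms by (auto simp: overlaps_def)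
  then show "finite (SIGMA p:P. Pow (fst p))" using fin X by (intro finite_SigmaI) auto
  have "card (SIGMA p:P. Pow (fst p)) = (\<Sum>p\<in>P. card (Pow (fst p)))"
    using fin fst X by (intro card_SigmaI) auto
  also have "\<dots> \<le> (\<Sum>p\<in>P. 2 ^ R)"
    using fst X R by (intro sum_mono) (auto simp: card_Pow)
  also have "\<dots> \<le> 2 ^ R * card (overlaps m s X)"
    using card_mono[OF finite_overlaps[OF finX] assms] by simp
  finally show "card (SIGMA p:P. Pow (fst p)) \<le> 2 ^ R * card (overlaps m s X)" .
qed

text \<open>The left side counts incidences of a simplex with a face. Fix one simplex
  \<open>rep\<close> for each face: incidences with that simplex are counted by the faces, and any
  other incidence determines the overlap of its simplex with \<open>rep\<close>, together with a
  face of the former.\<close>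

lemma sum_choose_le_card_faces:
  assumes "0 < s"
  shows "(\<Sum>\<sigma>\<in>X. card \<sigma> choose s) \<le> card (faces (generated_complex X) s) + 2 ^ R * card (overlaps s s X)"
proof -
  let ?F = "faces (generated_complex X) s"
  define A where "A = (SIGMA \<sigma>:X. {\<tau>. \<tau> \<subseteq> \<sigma> \<and> card \<tau> = s})"
  have cA: "card A = (\<Sum>\<sigma>\<in>X. card \<sigma> choose s)"
    unfolding A_def using finX X by (subst card_SigmaI) (auto simp: n_subsets)
  have AF: "\<tau> \<in> ?F" if "(\<sigma>, \<tau>) \<in> A" for \<sigma> \<tau>
    using that assms by (auto simp: A_def intro!: generated_complexI)
  define rep where "rep \<tau> = (SOME \<sigma>. \<sigma> \<in> X \<and> \<tau> \<subseteq> \<sigma>)" for \<tau>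
  have rep: "rep \<tau> \<in> X \<and> \<tau> \<subseteq> rep \<tau>" if "\<tau> \<in> ?F" for \<tau>
  proof -
    have "\<tau> \<in> generated_complex X" using that by simp
    then obtain \<sigma> where "\<sigma> \<in> X" "\<tau> \<subseteq> \<sigma>" by (rule generated_complexE)
    then have "\<exists>\<sigma>. \<sigma> \<in> X \<and> \<tau> \<subseteq> \<sigma>" by blast
    then show ?thesis unfolding rep_def by (rule someI_ex)
  qed
  define A1 where "A1 = {p \<in> A. fst p = rep (snd p)}"
  define A2 where "A2 = {p \<in> A. fst p \<noteq> rep (snd p)}"
  have finF: "finite ?F"
    using simplicial_complexD(1)[OF simplicial_generated_complex[OF finX]] X by simp
  have "inj_on snd A1" by (auto simp: A1_def inj_on_def)
  moreover have "snd ` A1 \<subseteq> ?F" using AF by (auto simp: A1_def)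
  ultimately have c1: "card A1 \<le> card ?F" using finF card_inj_on_le by blast
  let ?f = "\<lambda>p. ((fst p, rep (snd p)), snd p)"
  have "inj_on ?f A2" by (auto simp: inj_on_def)
  moreover have "?f ` A2 \<subseteq> (SIGMA p:overlaps s s X. Pow (fst p))"
  proof
    fix q assume "q \<in> ?f ` A2"
    then obtain p where p: "q = ?f p" "p \<in> A2" by (rule imageE)
    obtain \<sigma> \<tau> where "p = (\<sigma>, \<tau>)" by (cases p)
    then have q: "q = ((\<sigma>, rep \<tau>), \<tau>)" "(\<sigma>, \<tau>) \<in> A" "\<sigma> \<noteq> rep \<tau>"
      using p unfolding A2_def by simp_all
    have \<tau>: "\<sigma> \<in> X" "\<tau> \<subseteq> \<sigma>" "card \<tau> = s" using q(2) by (auto simp: A_def)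
    have r: "rep \<tau> \<in> X" "\<tau> \<subseteq> rep \<tau>" using rep[OF AF[OF q(2)]] by auto
    have "s \<le> card \<sigma>" "s \<le> card (rep \<tau>)" "s \<le> card (\<sigma> \<inter> rep \<tau>)"
      using \<tau> r X[OF \<tau>(1)] X[OF r(1)] card_mono[of \<sigma> \<tau>] card_mono[of "rep \<tau>" \<tau>]
        card_mono[of "\<sigma> \<inter> rep \<tau>" \<tau>] by auto
    then show "q \<in> (SIGMA p:overlaps s s X. Pow (fst p))"
      using q(1,3) \<tau> r by (simp add: overlaps_def)
  qed
  ultimately have c2: "card A2 \<le> 2 ^ R * card (overlaps s s X)"
    using card_pairs_le[OF subset_refl, of s s] card_inj_on_le le_trans by meson
  have "A = A1 \<union> A2" by (auto simp: A1_def A2_def)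
  then have "card A \<le> card A1 + card A2" using card_Un_le by metis
  then show ?thesis using c1 c2 cA by linarith
qed

text \<open>A cycle restricts to a cycle on each simplex that shares no \<open>k\<close> vertices with another one,
  and there it bounds.\<close>

lemma cycle_in_span_overlaps:
  assumes k: "0 < k" and c: "Poly_Mapping.keys c \<subseteq> faces (generated_complex X) (k + 1)" "bd c = 0"
  shows "c \<in> frag.span (boundary_span (faces (generated_complex X) (k + 2)) \<union>
      frag_of ` (\<Union>p\<in>overlaps (k + 1) k X. Pow (fst p)))"
    (is "c \<in> frag.span (?B \<union> ?T)")
proof -
  let ?K = "Poly_Mapping.keys c" and ?a = "Poly_Mapping.lookup c"
  define Tb where "Tb = (\<Union>p\<in>overlaps (k + 1) k X. Pow (fst p))"
  define Good where "Good = {\<sigma>\<in>X. k + 1 \<le> card \<sigma> \<and> (\<forall>\<sigma>'\<in>X. \<sigma>' \<noteq> \<sigma> \<longrightarrow> k + 1 \<le> card \<sigma>' \<longrightarrow> card (\<sigma> \<inter> \<sigma>') < k)}"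
  have finG: "finite Good" using finX by (simp add: Good_def)
  have cov: "\<exists>\<sigma>\<in>X. \<tau> \<subseteq> \<sigma> \<and> k + 1 \<le> card \<sigma>" and card\<tau>: "card \<tau> = k + 1" if "\<tau> \<in> ?K" for \<tau>
  proof -
    have "\<tau> \<in> generated_complex X" and *: "card \<tau> = k + 1" using c(1) that by auto
    then obtain \<sigma> where "\<sigma> \<in> X" "\<tau> \<subseteq> \<sigma>" by (elim generated_complexE)
    then show "\<exists>\<sigma>\<in>X. \<tau> \<subseteq> \<sigma> \<and> k + 1 \<le> card \<sigma>" using X card_mono[of \<sigma> \<tau>] * by auto
    show "card \<tau> = k + 1" by fact
  qed
  have good_unique: "\<sigma> = \<sigma>'"
    if "\<sigma> \<in> Good" "\<sigma>' \<in> X" "k + 1 \<le> card \<sigma>'" "\<kappa> \<subseteq> \<sigma>" "\<kappa> \<subseteq> \<sigma>'" "k \<le> card \<kappa>" for \<sigma> \<sigma>' \<kappa>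
  proof (rule ccontr)
    assume "\<sigma> \<noteq> \<sigma>'"
    then have "card (\<sigma> \<inter> \<sigma>') < k" using that by (auto simp: Good_def)
    moreover have "card \<kappa> \<le> card (\<sigma> \<inter> \<sigma>')"
      using that X[of \<sigma>'] by (intro card_mono) auto
    ultimately show False using that by simp
  qed
  define Ks where "Ks \<sigma> = {\<tau>\<in>?K. \<tau> \<subseteq> \<sigma>}" for \<sigma>
  define cs where "cs \<sigma> = (\<Sum>\<tau>\<in>Ks \<sigma>. frag_cmul (?a \<tau>) (frag_of \<tau>))" for \<sigma>
  have finKs: "finite (Ks \<sigma>)" for \<sigma> by (simp add: Ks_def)
  have K_split: "?K = (?K \<inter> Tb) \<union> (\<Union>\<sigma>\<in>Good. Ks \<sigma>)"
  proof (intro equalityI subsetI)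
    fix \<tau> assume \<tau>: "\<tau> \<in> ?K"
    obtain \<sigma> where \<sigma>: "\<sigma> \<in> X" "\<tau> \<subseteq> \<sigma>" "k + 1 \<le> card \<sigma>" using cov[OF \<tau>] by blast
    show "\<tau> \<in> (?K \<inter> Tb) \<union> (\<Union>\<sigma>\<in>Good. Ks \<sigma>)"
    proof (cases "\<sigma> \<in> Good")
      case True
      then show ?thesis using \<tau> \<sigma> by (auto simp: Ks_def)
    next
      case False
      then obtain \<sigma>' where "(\<sigma>, \<sigma>') \<in> overlaps (k + 1) k X"
        using \<sigma> by (auto simp: Good_def overlaps_def not_less)
      then show ?thesis using \<tau> \<sigma> by (force simp: Tb_def)
    qed
  qed (auto simp: Ks_def)
  \<comment> \<open>A face of an overlapping simplex cannot lie in a good one: its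
    \<open>k + 1\<close> vertices would identify the two simplices, and the overlap would contradict
    goodness.\<close>
  have disj1: "(?K \<inter> Tb) \<inter> (\<Union>\<sigma>\<in>Good. Ks \<sigma>) = {}"
  proof (rule ccontr)
    assume "(?K \<inter> Tb) \<inter> (\<Union>\<sigma>\<in>Good. Ks \<sigma>) \<noteq> {}"
    then obtain \<tau> \<sigma> \<sigma>1 \<sigma>2 where \<tau>: "\<tau> \<in> ?K" "\<tau> \<subseteq> \<sigma>" "\<sigma> \<in> Good" "\<tau> \<subseteq> \<sigma>1" "(\<sigma>1, \<sigma>2) \<in> overlaps (k + 1) k X"
      by (force simp: Tb_def Ks_def)
    then have o: "\<sigma>1 \<in> X" "k + 1 \<le> card \<sigma>1" "\<sigma>2 \<in> X" "k + 1 \<le> card \<sigma>2" "k \<le> card (\<sigma>1 \<inter> \<sigma>2)" "\<sigma>1 \<noteq> \<sigma>2"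
      by (auto simp: overlaps_def)
    have 1: "\<sigma> = \<sigma>1" using good_unique[OF \<tau>(3) o(1,2) \<tau>(2,4)] card\<tau>[OF \<tau>(1)] by simp
    then have "\<sigma> = \<sigma>2" using good_unique[OF \<tau>(3) o(3,4), of "\<sigma>1 \<inter> \<sigma>2"] o(5) by simp
    then show False using 1 o(6) by simp
  qed
  have disj2: "\<forall>\<sigma>\<in>Good. \<forall>\<sigma>'\<in>Good. \<sigma> \<noteq> \<sigma>' \<longrightarrow> Ks \<sigma> \<inter> Ks \<sigma>' = {}"
  proof (intro ballI impI, rule ccontr)
    fix \<sigma> \<sigma>' assume \<sigma>: "\<sigma> \<in> Good" "\<sigma>' \<in> Good" "\<sigma> \<noteq> \<sigma>'" "Ks \<sigma> \<inter> Ks \<sigma>' \<noteq> {}"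
    then obtain \<tau> where "\<tau> \<in> ?K" "\<tau> \<subseteq> \<sigma>" "\<tau> \<subseteq> \<sigma>'" by (auto simp: Ks_def)
    moreover have "\<sigma>' \<in> X" "k + 1 \<le> card \<sigma>'" using \<sigma>(2) by (auto simp: Good_def)
    ultimately show False using good_unique[OF \<sigma>(1), of \<sigma>' \<tau>] card\<tau> \<sigma>(3) by simp
  qed
  have "c = (\<Sum>\<tau>\<in>?K. frag_cmul (?a \<tau>) (frag_of \<tau>))"
    using frag_expansion[of c] by (simp add: frag_extend_def)
  also have "\<dots> = (\<Sum>\<tau>\<in>?K \<inter> Tb. frag_cmul (?a \<tau>) (frag_of \<tau>)) + (\<Sum>\<sigma>\<in>Good. cs \<sigma>)"
    unfolding cs_def using finG finKs
    by (subst K_split, subst sum.union_disjoint[OF _ _ disj1], simp, simp,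
        subst sum.UNION_disjoint[OF _ _ disj2]) simp_all
  finally have c_eq: "c = \<dots>" .
  have "cs \<sigma> \<in> ?B" if \<sigma>: "\<sigma> \<in> Good" for \<sigma>
  proof -
    have \<sigma>X: "\<sigma> \<in> X" using \<sigma> by (simp add: Good_def)
    have min: "Min \<sigma> \<in> \<sigma>" "\<And>u. u \<in> \<sigma> \<Longrightarrow> Min \<sigma> \<le> u" "finite \<sigma>" using X[OF \<sigma>X] by auto
    have bd0: "bd (cs \<sigma>) = 0"
    proof (rule poly_mapping_eqI)
      fix \<kappa>
      have "Poly_Mapping.lookup (bd (cs \<sigma>)) \<kappa> = (\<Sum>\<tau>\<in>Ks \<sigma>. ?a \<tau> * Poly_Mapping.lookup (bd (frag_of \<tau>)) \<kappa>)"
        unfolding cs_def by (rule lookup_bd[OF finKs])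
      also have "\<dots> = 0"
      \<comment> \<open>A \<open>k\<close>-subset of the good simplex \<sigma> lies in no other
        simplex with at least \<open>k + 1\<close> vertices. All faces of \<open>c\<close> that have
        \<kappa> as a facet are thus inside \<sigma>, and the restricted chain has the same
        coefficient at \<kappa> as the boundary of \<open>c\<close>.\<close>
      proof (cases "\<kappa> \<subseteq> \<sigma> \<and> card \<kappa> = k")
        case True
        have "(\<Sum>\<tau>\<in>Ks \<sigma>. ?a \<tau> * Poly_Mapping.lookup (bd (frag_of \<tau>)) \<kappa>) =
            (\<Sum>\<tau>\<in>?K. ?a \<tau> * Poly_Mapping.lookup (bd (frag_of \<tau>)) \<kappa>)"
        proof (rule sum.mono_neutral_left)
          show "\<forall>\<tau>\<in>?K - Ks \<sigma>. ?a \<tau> * Poly_Mapping.lookup (bd (frag_of \<tau>)) \<kappa> = 0"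
          proof
            fix \<tau> assume \<tau>: "\<tau> \<in> ?K - Ks \<sigma>"
            have tK: "\<tau> \<in> ?K" and nsub: "\<not> \<tau> \<subseteq> \<sigma>" using \<tau> by (auto simp: Ks_def)
            obtain \<sigma>' where \<sigma>': "\<sigma>' \<in> X" "\<tau> \<subseteq> \<sigma>'" "k + 1 \<le> card \<sigma>'" using cov[OF tK] by blast
            have "Poly_Mapping.lookup (bd (frag_of \<tau>)) \<kappa> = 0"
            proof (rule lookup_bd_frag_of_eq_0, rule notI)
              fix v assume "\<kappa> = \<tau> - {v}"
              then have "\<kappa> \<subseteq> \<sigma>'" using \<sigma>'(2) by auto
              then have "\<sigma> = \<sigma>'" using good_unique[OF \<sigma> \<sigma>'(1,3), of \<kappa>] True by simp
              then show False using nsub \<sigma>'(2) by simp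
            qed
            then show "?a \<tau> * Poly_Mapping.lookup (bd (frag_of \<tau>)) \<kappa> = 0" by simp
          qed
        qed (auto simp: Ks_def)
        also have "\<dots> = Poly_Mapping.lookup (bd c) \<kappa>"
          by (subst lookup_bd[symmetric]) (simp_all add: frag_expansion[symmetric, unfolded frag_extend_def])
        finally show ?thesis using c(2) by simp
      next
        case False
        have "Poly_Mapping.lookup (bd (frag_of \<tau>)) \<kappa> = 0" if \<tau>: "\<tau> \<in> Ks \<sigma>" for \<tau>
        proof (rule lookup_bd_frag_of_eq_0, rule notI)
          fix v assume v: "v \<in> \<tau>" "\<kappa> = \<tau> - {v}"
          have "\<tau> \<subseteq> \<sigma>" "card \<tau> = k + 1" using \<tau> card\<tau> by (auto simp: Ks_def)
          then have "card \<kappa> = k" "\<kappa> \<subseteq> \<sigma>"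
            using v finite_subset[OF \<open>\<tau> \<subseteq> \<sigma>\<close> min(3)] by auto
          then show False using False by simp
        qed
        then show ?thesis by simp
      qed
      finally show "Poly_Mapping.lookup (bd (cs \<sigma>)) \<kappa> = Poly_Mapping.lookup 0 \<kappa>" by simp
    qed
    have "cs \<sigma> \<in> frag.span (frag_of ` Ks \<sigma>)"
      unfolding cs_def by (intro frag.span_sum frag.span_scale frag.span_base) simp
    then have keys_cs: "Poly_Mapping.keys (cs \<sigma>) \<subseteq> Ks \<sigma>" unfolding keys_subset_iff_span .
    have "bd (coned (Min \<sigma>) (cs \<sigma>)) + coned (Min \<sigma>) (bd (cs \<sigma>)) = cs \<sigma>"
    proof (rule cone_homotopy)
      fix \<tau> assume "\<tau> \<in> Poly_Mapping.keys (cs \<sigma>)"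
      then have "\<tau> \<subseteq> \<sigma>" using keys_cs by (auto simp: Ks_def)
      then show "finite \<tau> \<and> (\<forall>u\<in>\<tau>. Min \<sigma> \<le> u)" using min finite_subset by blast
    qed
    then have "cs \<sigma> = bd (coned (Min \<sigma>) (cs \<sigma>))" using bd0 by simp
    also have "\<dots> \<in> ?B"
    proof (rule bd_in_boundary_span, rule subset_trans[OF keys_coned[OF keys_cs]], clarify, intro conjI)
      fix \<tau> assume \<tau>: "\<tau> \<in> Ks \<sigma>" "Min \<sigma> \<notin> \<tau>"
      have \<tau>\<sigma>: "\<tau> \<subseteq> \<sigma>" "card \<tau> = k + 1" using \<tau>(1) card\<tau> by (auto simp: Ks_def)
      show "insert (Min \<sigma>) \<tau> \<in> generated_complex X"
        using \<sigma>X \<tau>\<sigma> min(1) by (intro generated_complexI) auto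
      show "card (insert (Min \<sigma>) \<tau>) = k + 2"
        using \<tau>(2) \<tau>\<sigma> finite_subset[OF \<tau>\<sigma>(1) min(3)] by simp
    qed
    finally show ?thesis .
  qed
  then have "(\<Sum>\<sigma>\<in>Good. cs \<sigma>) \<in> frag.span (?B \<union> ?T)"
    by (intro frag.span_sum frag.span_base) blast
  moreover have "(\<Sum>\<tau>\<in>?K \<inter> Tb. frag_cmul (?a \<tau>) (frag_of \<tau>)) \<in> frag.span (?B \<union> ?T)"
    by (intro frag.span_sum frag.span_scale frag.span_base) (simp add: Tb_def)
  ultimately show ?thesis by (subst c_eq) (rule frag.span_add)
qed

lemma betti_le_overlaps:
  assumes k: "0 < k"
  shows "betti (int k) (generated_complex X) \<le> 2 ^ R * card (overlaps (k + 1) k X)"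
proof -
  let ?O = "overlaps (k + 1) k X"
  let ?T = "\<Union>p\<in>?O. Pow (fst p)"
  have Y: "simplicial_complex (generated_complex X)"
    using finX X by (intro simplicial_generated_complex) auto
  have T: "?T = snd ` (SIGMA p:?O. Pow (fst p))" by force
  note fin = card_pairs_le(1)[OF subset_refl, of "k + 1" k]
  have "betti (int k) (generated_complex X) \<le> card (frag_of ` ?T)"
  proof (rule betti_le[OF Y])
    show "finite (frag_of ` ?T)" unfolding T using fin by simp
    show "face_cycles (int k) (generated_complex X) \<subseteq>
        frag.span (boundary_span (faces (generated_complex X) (k + 2)) \<union> frag_of ` ?T)"
    proof
      fix c assume "c \<in> face_cycles (int k) (generated_complex X)"
      then have "Poly_Mapping.keys c \<subseteq> faces (generated_complex X) (k + 1)" "bd c = 0"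
        unfolding face_cycles_eq[OF Y k] by simp_all
      then show "c \<in> frag.span (boundary_span (faces (generated_complex X) (k + 2)) \<union> frag_of ` ?T)"
        by (rule cycle_in_span_overlaps[OF k])
    qed
  qed
  also have "\<dots> \<le> card (SIGMA p:?O. Pow (fst p))"
    unfolding T image_image using fin by (rule card_image_le)
  also have "\<dots> \<le> 2 ^ R * card ?O" by (rule card_pairs_le(2)[OF subset_refl])
  finally show ?thesis .
qed

lemma trivial_homology_no_overlaps:
  assumes k: "0 < k" "overlaps (k + 1) k X = {}"
  shows "trivial_group (reduced_face_homology (int k) (generated_complex X))"
proof (rule trivial_reduced_face_homology)
  show "simplicial_complex (generated_complex X)"
    using finX X by (intro simplicial_generated_complex) auto
  fix c assume c: "Poly_Mapping.keys c \<subseteq> {\<sigma> \<in> insert {} (generated_complex X). dimension \<sigma> = int k}" "bd c = 0"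
  have 1: "{\<sigma> \<in> insert {} (generated_complex X). dimension \<sigma> = int k} = faces (generated_complex X) (k + 1)"
    and 2: "{\<sigma> \<in> insert {} (generated_complex X). dimension \<sigma> = int k + 1} = faces (generated_complex X) (k + 2)"
    by (auto simp: dimension_def)
  have "c \<in> frag.span (boundary_span (faces (generated_complex X) (k + 2)))"
    using cycle_in_span_overlaps[OF k(1) c(1)[unfolded 1] c(2)] k(2) by simp
  then show "c \<in> boundary_span {\<sigma> \<in> insert {} (generated_complex X). dimension \<sigma> = int k + 1}"
    unfolding 2 using subspace_boundary_span by (simp add: frag.span_eq_iff[THEN iffD2])
qed

text \<open>A face with at least \<open>k\<close> vertices lies in at most one simplex with at least
  \<open>k + 1\<close> vertices, called \<open>top\<close>. The matchings inside the separate
  simplices are therefore compatible, and freeness of a face can be checked inside its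
  \<open>top\<close>.\<close>

lemma collapses_no_overlaps:
  assumes k: "0 < k" "overlaps (k + 1) k X = {}"
  shows "collapses_into_skeleton (int k - 1) (generated_complex X)"
proof -
  let ?Y = "generated_complex X"
  have uniq: "\<sigma> = \<sigma>'" if "\<sigma> \<in> X" "\<sigma>' \<in> X" "k + 1 \<le> card \<sigma>" "k + 1 \<le> card \<sigma>'"
    "\<rho> \<subseteq> \<sigma>" "\<rho> \<subseteq> \<sigma>'" "k \<le> card \<rho>" for \<sigma> \<sigma>' \<rho>
  proof (rule ccontr)
    assume "\<sigma> \<noteq> \<sigma>'"
    moreover have "card \<rho> \<le> card (\<sigma> \<inter> \<sigma>')" using that X[of \<sigma>] by (intro card_mono) auto
    ultimately have "(\<sigma>, \<sigma>') \<in> overlaps (k + 1) k X" using that by (auto simp: overlaps_def)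
    then show False using k by simp
  qed
  define big where "big \<sigma> \<rho> \<longleftrightarrow> \<sigma> \<in> X \<and> k + 1 \<le> card \<sigma> \<and> \<rho> \<subseteq> \<sigma> \<and> k \<le> card \<rho>" for \<sigma> \<rho>
  have big_unique: "\<sigma> = \<sigma>'" if "big \<sigma> \<rho>" "big \<sigma>' \<rho>" for \<sigma> \<sigma>' \<rho>
    using that uniq[of \<sigma> \<sigma>' \<rho>] unfolding big_def by blast
  have big_sub: "big \<sigma> \<rho>" if "big \<sigma> \<kappa>" "\<rho> \<subseteq> \<kappa>" "k \<le> card \<rho>" for \<sigma> \<rho> \<kappa>
    using that unfolding big_def by blast
  \<comment> \<open>\<open>P\<close> consists of the lower members of the matched pairs;
    \<open>m\<close> maps each to its partner.\<close>
  define P where "P = {\<rho>. \<exists>\<sigma>. big \<sigma> \<rho> \<and> Min \<sigma> \<notin> \<rho>}"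
  define top where "top \<rho> = (THE \<sigma>. big \<sigma> \<rho>)" for \<rho>
  have top_eq: "top \<rho> = \<sigma>" if "big \<sigma> \<rho>" for \<sigma> \<rho>
    unfolding top_def using that big_unique by (intro the_equality) blast+
  define m where "m \<rho> = insert (Min (top \<rho>)) \<rho>" for \<rho>
  have Pbig: "big (top \<rho>) \<rho>" "Min (top \<rho>) \<notin> \<rho>" if \<rho>: "\<rho> \<in> P" for \<rho>
  proof -
    obtain \<sigma> where "big \<sigma> \<rho>" "Min \<sigma> \<notin> \<rho>" using \<rho> unfolding P_def by blast
    then show "big (top \<rho>) \<rho>" "Min (top \<rho>) \<notin> \<rho>" using top_eq by simp_all
  qed
  have bigD: "finite \<sigma>" "Min \<sigma> \<in> \<sigma>" "finite \<rho>" "\<rho> \<noteq> {}" "\<sigma> \<in> X" if "big \<sigma> \<rho>" for \<sigma> \<rho>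
  proof -
    have "\<sigma> \<in> X" "\<rho> \<subseteq> \<sigma>" "k \<le> card \<rho>" using that by (auto simp: big_def)
    then show "finite \<sigma>" "Min \<sigma> \<in> \<sigma>" "finite \<rho>" "\<rho> \<noteq> {}" "\<sigma> \<in> X"
      using X[of \<sigma>] finite_subset[of \<rho> \<sigma>] k(1) by auto
  qed
  have mbig: "big (top \<rho>) (m \<rho>)" "card (m \<rho>) = Suc (card \<rho>)" "\<rho> \<subset> m \<rho>" if "\<rho> \<in> P" for \<rho>
  proof -
    note b = Pbig[OF that] bigD[OF Pbig(1)[OF that]]
    show 1: "card (m \<rho>) = Suc (card \<rho>)" using b by (simp add: m_def)
    show "big (top \<rho>) (m \<rho>)" using b 1 unfolding big_def by (simp add: m_def)
    show "\<rho> \<subset> m \<rho>" using b by (auto simp: m_def)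
  qed
  have m_notin: "m \<rho> \<noteq> \<rho>'" if "\<rho> \<in> P" "\<rho>' \<in> P" for \<rho> \<rho>'
  proof
    assume eq: "m \<rho> = \<rho>'"
    have "top \<rho>' = top \<rho>" using mbig(1)[OF that(1)] top_eq eq by simp
    then show False using Pbig(2)[OF that(2)] eq by (auto simp: m_def)
  qed
  have m_inj: "\<rho> = \<rho>'" if "\<rho> \<in> P" "\<rho>' \<in> P" "m \<rho> = m \<rho>'" for \<rho> \<rho>'
  proof -
    have "top \<rho> = top \<rho>'" using mbig(1)[OF that(1)] mbig(1)[OF that(2)] that(3) big_unique by simp
    then show ?thesis using Pbig(2)[OF that(1)] Pbig(2)[OF that(2)] that(3) unfolding m_def by (metis insert_ident)
  qed
  have bigY: "\<rho> \<in> ?Y" if b: "big \<sigma> \<rho>" for \<sigma> \<rho>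
    using generated_complexI[OF bigD(5)[OF b] _ bigD(4)[OF b]] b by (simp add: big_def)
  have PY: "\<rho> \<in> ?Y" "m \<rho> \<in> ?Y" if "\<rho> \<in> P" for \<rho>
    using bigY[OF Pbig(1)[OF that]] bigY[OF mbig(1)[OF that]] by simp_all
  have "finite ?Y"
    using simplicial_complexD(1)[OF simplicial_generated_complex[OF finX]] X by simp
  moreover have "P \<subseteq> ?Y" using PY(1) by (rule subsetI)
  ultimately have finP: "finite P" by (rule rev_finite_subset)
  \<comment> \<open>Upward closed sets of pairs can be removed. The induction takes off a smallest
    lower face last, so every pair above it is already gone.\<close>
  have collapse: "elementary_collapse\<^sup>*\<^sup>* ?Y (?Y - Q - m ` Q)"
    if "Q \<subseteq> P" "\<And>\<rho> \<rho>'. \<rho> \<in> Q \<Longrightarrow> \<rho>' \<in> P \<Longrightarrow> \<rho> \<subset> \<rho>' \<Longrightarrow> \<rho>' \<in> Q" for Q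
    using that
  proof (induction "card Q" arbitrary: Q)
    case 0
    then have "Q = {}" using finP finite_subset[of Q P] by simp
    then show ?case by simp
  next
    case (Suc n)
    have finQ: "finite Q" using Suc.prems(1) finP finite_subset by blast
    have "Q \<noteq> {}" using Suc.hyps(2) by auto
    then obtain \<rho>\<^sub>0 where "\<rho>\<^sub>0 \<in> Q" by blast
    then obtain \<rho> where \<rho>: "\<rho> \<in> Q" "\<And>\<rho>'. \<rho>' \<in> Q \<Longrightarrow> card \<rho> \<le> card \<rho>'"
      using ex_has_least_nat[of "\<lambda>\<rho>. \<rho> \<in> Q" \<rho>\<^sub>0 card] by auto
    have \<rho>P: "\<rho> \<in> P" using \<rho>(1) Suc.prems(1) by blast
    define Q' where "Q' = Q - {\<rho>}"
    have Q'P: "Q' \<subseteq> P" "Q' \<subseteq> Q" "\<rho> \<notin> Q'" "Q = insert \<rho> Q'" using Suc.prems(1) \<rho>(1) by (auto simp: Q'_def)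
    have up: "\<rho>'' \<in> Q'" if "\<rho>' \<in> Q'" "\<rho>'' \<in> P" "\<rho>' \<subset> \<rho>''" for \<rho>' \<rho>''
    proof -
      have "\<rho>' \<in> Q" using that(1) Q'P(2) by blast
      then have "\<rho>'' \<in> Q" using Suc.prems(2) that(2,3) by blast
      moreover have "\<rho>'' \<noteq> \<rho>"
        using \<rho>(2)[OF \<open>\<rho>' \<in> Q\<close>] psubset_card_mono[OF _ that(3)] bigD(3)[OF Pbig(1)[OF that(2)]] by auto
      ultimately show ?thesis by (simp add: Q'_def)
    qed
    let ?K = "?Y - Q' - m ` Q'"
    have IH: "elementary_collapse\<^sup>*\<^sup>* ?Y ?K"
    proof (rule Suc.hyps(1))
      show "n = card Q'" using Suc.hyps(2) finQ \<rho>(1) by (simp add: Q'_def)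
    qed (rule Q'P(1), rule up)
    have "elementary_collapse ?K (?Y - Q - m ` Q)"
      unfolding elementary_collapse_def
    proof (intro exI conjI ballI impI)
      have "\<rho> \<notin> m ` Q'" using m_notin \<rho>P Q'P(1) by blast
      then show "\<rho> \<in> ?K" using PY(1)[OF \<rho>P] Q'P(3) by blast
      have "m \<rho> \<notin> Q'" using m_notin[OF \<rho>P] Q'P(1) by blast
      moreover have "m \<rho> \<notin> m ` Q'" using m_inj[OF \<rho>P] Q'P(1,3) by blast
      ultimately show "m \<rho> \<in> ?K" using PY(2)[OF \<rho>P] by blast
      show "\<rho> \<subset> m \<rho>" by (rule mbig(3)[OF \<rho>P])
      show "dimension (m \<rho>) = dimension \<rho> + 1" using mbig(2)[OF \<rho>P] by (simp add: dimension_def)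
      show "?Y - Q - m ` Q = ?K - {\<rho>, m \<rho>}" unfolding Q'P(4) by blast
      fix \<kappa> assume \<kappa>: "\<kappa> \<in> ?K" "\<rho> \<subset> \<kappa>"
      have "\<kappa> \<in> ?Y" using \<kappa>(1) by blast
      then obtain \<sigma> where \<sigma>: "\<sigma> \<in> X" "\<kappa> \<subseteq> \<sigma>" by (rule generated_complexE)
      have fin\<kappa>: "finite \<kappa>" using \<sigma> X finite_subset by blast
      have k\<kappa>: "k + 1 \<le> card \<kappa>"
        using psubset_card_mono[OF fin\<kappa> \<kappa>(2)] Pbig(1)[OF \<rho>P] by (simp add: big_def)
      then have b\<kappa>: "big \<sigma> \<kappa>"
        using \<sigma> X[OF \<sigma>(1)] card_mono[of \<sigma> \<kappa>] by (simp add: big_def)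
      have "big \<sigma> \<rho>" using big_sub[OF b\<kappa>] \<kappa>(2) Pbig(1)[OF \<rho>P] by (auto simp: big_def)
      then have top: "top \<rho> = \<sigma>" by (rule top_eq)
      \<comment> \<open>A remaining coface avoiding the least vertex would be the lower member of a
        pair removed earlier. So the coface is the upper member of a pair with lower member
        \<kappa>' containing \<rho>, and that pair is also gone unless \<kappa>' is \<rho>.\<close>
      have "Min \<sigma> \<in> \<kappa>"
      proof (rule ccontr)
        assume "Min \<sigma> \<notin> \<kappa>"
        then have "\<kappa> \<in> P" using b\<kappa> by (auto simp: P_def)
        then have "\<kappa> \<in> Q" using Suc.prems(2)[OF \<rho>(1)] \<kappa>(2) by blast
        then show False using \<kappa> Q'P(4) by blast
      qed
      define \<kappa>' where "\<kappa>' = \<kappa> - {Min \<sigma>}"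
      have \<kappa>': "\<rho> \<subseteq> \<kappa>'" "\<kappa> = insert (Min \<sigma>) \<kappa>'" "Min \<sigma> \<notin> \<kappa>'"
        using \<kappa>(2) Pbig(2)[OF \<rho>P] top \<open>Min \<sigma> \<in> \<kappa>\<close> by (auto simp: \<kappa>'_def)
      have "k \<le> card \<kappa>'" using k\<kappa> fin\<kappa> \<open>Min \<sigma> \<in> \<kappa>\<close> by (simp add: \<kappa>'_def)
      then have b': "big \<sigma> \<kappa>'" using big_sub[OF b\<kappa>] by (auto simp: \<kappa>'_def)
      then have \<kappa>'P: "\<kappa>' \<in> P" using \<kappa>'(3) by (auto simp: P_def)
      have m\<kappa>': "m \<kappa>' = \<kappa>" using top_eq[OF b'] \<kappa>'(2) by (simp add: m_def)
      show "\<kappa> = m \<rho>"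
      proof (rule ccontr)
        assume "\<kappa> \<noteq> m \<rho>"
        then have "\<rho> \<noteq> \<kappa>'" using m\<kappa>' by blast
        then have "\<kappa>' \<in> Q" using Suc.prems(2)[OF \<rho>(1) \<kappa>'P] \<kappa>'(1) by blast
        then have "\<kappa>' \<in> Q'" using \<open>\<rho> \<noteq> \<kappa>'\<close> by (simp add: Q'_def)
        then show False using \<kappa>(1) m\<kappa>' by blast
      qed
    qed
    with IH show ?case by (rule rtranclp.rtrancl_into_rtrancl)
  qed
  have "?Y - P - m ` P \<subseteq> skeleton (int k - 1) ?Y"
  proof
    fix \<kappa> assume \<kappa>: "\<kappa> \<in> ?Y - P - m ` P"
    show "\<kappa> \<in> skeleton (int k - 1) ?Y"
    proof (rule ccontr)
      assume "\<kappa> \<notin> skeleton (int k - 1) ?Y"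
      then have k\<kappa>: "k + 1 \<le> card \<kappa>" using \<kappa> by (auto simp: skeleton_def dimension_def)
      have "\<kappa> \<in> ?Y" using \<kappa> by blast
      then obtain \<sigma> where \<sigma>: "\<sigma> \<in> X" "\<kappa> \<subseteq> \<sigma>" by (rule generated_complexE)
      have b\<kappa>: "big \<sigma> \<kappa>" using \<sigma> X[OF \<sigma>(1)] card_mono[of \<sigma> \<kappa>] k\<kappa> by (simp add: big_def)
      have "Min \<sigma> \<in> \<kappa>" using \<kappa> b\<kappa> by (auto simp: P_def)
      have b': "big \<sigma> (\<kappa> - {Min \<sigma>})"
        using k\<kappa> bigD(3)[OF b\<kappa>] \<open>Min \<sigma> \<in> \<kappa>\<close> by (intro big_sub[OF b\<kappa>]) auto
      then have "\<kappa> - {Min \<sigma>} \<in> P" by (auto simp: P_def)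
      moreover have "m (\<kappa> - {Min \<sigma>}) = \<kappa>"
        using top_eq[OF b'] \<open>Min \<sigma> \<in> \<kappa>\<close> by (simp add: m_def insert_absorb)
      ultimately show False using \<kappa> by blast
    qed
  qed
  moreover have "elementary_collapse\<^sup>*\<^sup>* ?Y (?Y - P - m ` P)" by (rule collapse) auto
  ultimately show ?thesis unfolding collapses_into_skeleton_def by blast
qed

end

section \<open>Fresh simplices and relabelling\<close>

lemma in_span_if_subset_sums_eq:
  assumes fin: "finite I" and T: "T \<subseteq> I" "T' \<subseteq> I" "i \<in> T" "i \<notin> T'"
    and eq: "(\<Sum>j\<in>T. v j) = (\<Sum>j\<in>T'. v j)"
  shows "v i \<in> frag.span (v ` (I - {i}))"
proof -
  have "finite T" using fin T(1) by (rule rev_finite_subset)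
  then have "(\<Sum>j\<in>T. v j) = v i + (\<Sum>j\<in>T - {i}. v j)" using T(3) by (rule sum.remove)
  then have "v i = (\<Sum>j\<in>T'. v j) - (\<Sum>j\<in>T - {i}. v j)" using eq by simp
  also have "\<dots> \<in> frag.span (v ` (I - {i}))"
  proof (intro frag.span_diff frag.span_sum)
    fix j assume "j \<in> T'"
    then have "j \<in> I - {i}" using T by blast
    then show "v j \<in> frag.span (v ` (I - {i}))" by (intro frag.span_base imageI)
  next
    fix j assume "j \<in> T - {i}"
    then have "j \<in> I - {i}" using T by blast
    then show "v j \<in> frag.span (v ` (I - {i}))" by (intro frag.span_base imageI)
  qed
  finally show ?thesis .
qed

text \<open>All subset sums of the vectors are distinct, and they lie in a box.\<close>

lemma two_power_card_le:
  fixes v :: "'i \<Rightarrow> ('a \<Rightarrow>\<^sub>0 int)"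
  assumes I: "finite I" and F: "finite F"
    and keys: "\<And>i. i \<in> I \<Longrightarrow> Poly_Mapping.keys (v i) \<subseteq> F"
    and bnd: "\<And>i x. i \<in> I \<Longrightarrow> \<bar>Poly_Mapping.lookup (v i) x\<bar> \<le> 1"
    and fresh: "\<And>i. i \<in> I \<Longrightarrow> v i \<notin> frag.span (v ` (I - {i}))"
  shows "2 ^ card I \<le> (2 * card I + 1) ^ card F"
proof -
  define g where "g T = restrict (Poly_Mapping.lookup (\<Sum>i\<in>T. v i)) F" for T
  let ?box = "F \<rightarrow>\<^sub>E {- int (card I)..int (card I)}"
  have "inj_on g (Pow I)"
  proof (rule inj_onI)
    fix T T' assume T: "T \<in> Pow I" "T' \<in> Pow I" "g T = g T'"
    have eq: "(\<Sum>i\<in>T. v i) = (\<Sum>i\<in>T'. v i)"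
    proof (rule poly_mapping_eqI)
      fix x
      show "Poly_Mapping.lookup (\<Sum>i\<in>T. v i) x = Poly_Mapping.lookup (\<Sum>i\<in>T'. v i) x"
      proof (cases "x \<in> F")
        case True
        then show ?thesis using fun_cong[OF T(3), of x] by (simp add: g_def)
      next
        case False
        have "Poly_Mapping.lookup (v i) x = 0" if "i \<in> I" for i
          using keys[OF that] False by (meson in_keys_iff subsetD)
        then have "(\<Sum>i\<in>T. Poly_Mapping.lookup (v i) x) = 0" "(\<Sum>i\<in>T'. Poly_Mapping.lookup (v i) x) = 0"
          using T(1,2) by (auto intro!: sum.neutral)
        then show ?thesis by (simp add: lookup_sum)
      qed
    qed
    have sub: "T \<subseteq> I" "T' \<subseteq> I" using T by auto
    show "T = T'"
    proof (rule ccontr)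
      assume "T \<noteq> T'"
      then consider i where "i \<in> T" "i \<notin> T'" | i where "i \<in> T'" "i \<notin> T" by blast
      then show False
      proof cases
        case 1
        then show False using in_span_if_subset_sums_eq[OF I sub 1 eq] fresh[of i] sub by blast
      next
        case 2
        then show False using in_span_if_subset_sums_eq[OF I sub(2,1) 2 eq[symmetric]] fresh[of i] sub by blast
      qed
    qed
  qed
  moreover have "g ` Pow I \<subseteq> ?box"
  proof
    fix h assume "h \<in> g ` Pow I"
    then obtain T where T: "T \<subseteq> I" "h = g T" by blast
    have "\<bar>Poly_Mapping.lookup (\<Sum>i\<in>T. v i) x\<bar> \<le> int (card I)" for x
    proof -
      have "\<bar>Poly_Mapping.lookup (\<Sum>i\<in>T. v i) x\<bar> \<le> (\<Sum>i\<in>T. \<bar>Poly_Mapping.lookup (v i) x\<bar>)"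
        unfolding lookup_sum by (rule sum_abs)
      also have "\<dots> \<le> (\<Sum>i\<in>T. 1)" using T(1) bnd by (intro sum_mono) blast
      also have "\<dots> \<le> int (card I)" using card_mono[OF I T(1)] by simp
      finally show ?thesis .
    qed
    then show "h \<in> ?box" unfolding T(2) g_def by (simp add: PiE_iff abs_le_iff minus_le_iff)
  qed
  moreover have "finite ?box" using F by (intro finite_PiE) auto
  ultimately have "card (Pow I) \<le> card ?box" by (rule card_inj_on_le)
  moreover have "card ?box = (2 * card I + 1) ^ card F"
    using F by (simp add: card_PiE nat_add_distrib nat_mult_distrib)
  ultimately show ?thesis using I by (simp add: card_Pow)
qed

lemma abs_lookup_bd_le: "\<bar>Poly_Mapping.lookup (bd (frag_of \<sigma>)) \<kappa>\<bar> \<le> 1"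
proof (cases "\<exists>v\<in>\<sigma>. \<kappa> = \<sigma> - {v}")
  case True
  then obtain v where v: "v \<in> \<sigma>" "\<kappa> = \<sigma> - {v}" by blast
  show ?thesis
  proof (cases "finite \<sigma>")
    case True
    have "Poly_Mapping.lookup (bd (frag_of \<sigma>)) \<kappa> = (\<Sum>u\<in>\<sigma>. if u = v then facet_sign \<sigma> u else 0)"
      unfolding bd_frag_of lookup_sum lookup_frag_cmul
      using v by (intro sum.cong) auto
    also have "\<dots> = facet_sign \<sigma> v" using True v by simp
    finally show ?thesis by (simp add: facet_sign_def power_abs)
  qed (simp add: bd_frag_of)
next
  case False
  then have "Poly_Mapping.lookup (bd (frag_of \<sigma>)) \<kappa> = 0" by (intro lookup_bd_frag_of_eq_0) blast
  then show ?thesis by simp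
qed

definition sub_faces :: "nat \<Rightarrow> nat set set \<Rightarrow> nat set set" where
  "sub_faces s X = {\<rho>. card \<rho> = s \<and> (\<exists>\<sigma>\<in>X. \<rho> \<subseteq> \<sigma>)}"

lemma sub_faces_mono: "X \<subseteq> X' \<Longrightarrow> sub_faces s X \<subseteq> sub_faces s X'"
  unfolding sub_faces_def by blast

text \<open>\<open>X\<close> stands for the other simplices: it is applied to
  \<open>X - {\<sigma>}\<close>, or to a sample from which \<sigma> is excluded. This makes the
  event independent of the presence of \<sigma>. The size \<open>s\<close> counts vertices, so
  \<open>l\<close>-faces have \<open>s = Suc l\<close>.\<close>

definition fresh :: "nat \<Rightarrow> nat set set \<Rightarrow> nat set \<Rightarrow> bool" where
  "fresh s X \<sigma> \<longleftrightarrow> (\<exists>\<rho>\<subseteq>\<sigma>. card \<rho> = s \<and> bd (frag_of \<rho>) \<notin> boundary_span (sub_faces s X))"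

text \<open>Each fresh simplex contributes the boundary of one witnessing face. The witnesses of the
  other simplices are faces of \<open>X - {\<sigma>}\<close>, so no boundary lies in the span of the
  others; all of them have coordinates indexed by the \<open>l\<close>-subsets of
  \<open>U\<close>.\<close>

lemma two_power_card_fresh_le:
  fixes l :: nat
  assumes U: "finite U" and X: "\<And>\<sigma>. \<sigma> \<in> X \<Longrightarrow> \<sigma> \<subseteq> U"
  defines "N \<equiv> card {\<sigma>\<in>X. fresh (Suc l) (X - {\<sigma>}) \<sigma>}"
  shows "2 ^ N \<le> (2 * N + 1) ^ (card U choose l)"
proof -
  let ?I = "{\<sigma>\<in>X. fresh (Suc l) (X - {\<sigma>}) \<sigma>}"
  have "X \<subseteq> Pow U" using X by blast
  then have finX: "finite X" using U by (meson finite_Pow_iff finite_subset)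
  define witness where "witness \<sigma> \<rho> \<longleftrightarrow> \<rho> \<subseteq> \<sigma> \<and> card \<rho> = Suc l \<and>
    bd (frag_of \<rho>) \<notin> boundary_span (sub_faces (Suc l) (X - {\<sigma>}))" for \<sigma> \<rho>
  define w where "w \<sigma> = (SOME \<rho>. witness \<sigma> \<rho>)" for \<sigma>
  have w: "w \<sigma> \<subseteq> \<sigma>" "card (w \<sigma>) = Suc l"
    "bd (frag_of (w \<sigma>)) \<notin> boundary_span (sub_faces (Suc l) (X - {\<sigma>}))" if "\<sigma> \<in> ?I" for \<sigma>
  proof -
    have "\<exists>\<rho>. witness \<sigma> \<rho>" using that unfolding fresh_def witness_def by simp
    then have "witness \<sigma> (w \<sigma>)" unfolding w_def by (rule someI_ex)
    then show "w \<sigma> \<subseteq> \<sigma>" "card (w \<sigma>) = Suc l"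
      "bd (frag_of (w \<sigma>)) \<notin> boundary_span (sub_faces (Suc l) (X - {\<sigma>}))"
      unfolding witness_def by simp_all
  qed
  define v where "v \<sigma> = bd (frag_of (w \<sigma>))" for \<sigma>
  let ?F = "{\<tau>. \<tau> \<subseteq> U \<and> card \<tau> = l}"
  have "2 ^ card ?I \<le> (2 * card ?I + 1) ^ card ?F"
  proof (rule two_power_card_le[where v = v])
    show "finite ?I" using finX by simp
    show "finite ?F" using U by simp
    fix \<sigma> assume \<sigma>: "\<sigma> \<in> ?I"
    have wU: "w \<sigma> \<subseteq> U" using w(1)[OF \<sigma>] X[of \<sigma>] \<sigma> by auto
    then have fin: "finite (w \<sigma>)" using U by (rule finite_subset)
    show "Poly_Mapping.keys (v \<sigma>) \<subseteq> ?F"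
      unfolding v_def
    proof (rule subset_trans[OF keys_bd_frag_of], rule image_subsetI)
      fix u assume "u \<in> w \<sigma>"
      then show "w \<sigma> - {u} \<in> ?F" using w(2)[OF \<sigma>] fin wU by auto
    qed
    show "\<bar>Poly_Mapping.lookup (v \<sigma>) x\<bar> \<le> 1" for x
      unfolding v_def by (rule abs_lookup_bd_le)
    have "v ` (?I - {\<sigma>}) \<subseteq> boundary_span (sub_faces (Suc l) (X - {\<sigma>}))"
    proof (rule image_subsetI)
      fix \<sigma>' assume \<sigma>': "\<sigma>' \<in> ?I - {\<sigma>}"
      then have "\<sigma>' \<in> X - {\<sigma>}" "\<sigma>' \<in> ?I" by auto
      then have "w \<sigma>' \<in> sub_faces (Suc l) (X - {\<sigma>})"
        using w(1)[of \<sigma>'] w(2)[of \<sigma>'] unfolding sub_faces_def by blast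
      then show "v \<sigma>' \<in> boundary_span (sub_faces (Suc l) (X - {\<sigma>}))"
        unfolding v_def by (intro bd_in_boundary_span) simp
    qed
    then have "frag.span (v ` (?I - {\<sigma>})) \<subseteq> boundary_span (sub_faces (Suc l) (X - {\<sigma>}))"
      by (rule frag.span_minimal) (rule subspace_boundary_span)
    then show "v \<sigma> \<notin> frag.span (v ` (?I - {\<sigma>}))"
      using w(3)[OF \<sigma>] unfolding v_def by blast
  qed
  moreover have "card ?F = card U choose l" using n_subsets[OF U] by simp
  ultimately show ?thesis by (simp add: N_def)
qed

section \<open>Chain maps induced by bijections of the vertices\<close>

definition inversions :: "(nat \<Rightarrow> nat) \<Rightarrow> nat set \<Rightarrow> nat" where
  "inversions f \<sigma> = card {(u, v). u \<in> \<sigma> \<and> v \<in> \<sigma> \<and> u < v \<and> f v < f u}"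

text \<open>The sign compensates for the orientation by vertex order, which \<open>f\<close> need
  not preserve: for injective \<open>f\<close> it is the sign of the permutation sorting the images
  of the vertices, and it makes \<open>relabel\<close> commute with \<open>bd\<close>.\<close>

definition relabel :: "(nat \<Rightarrow> nat) \<Rightarrow> (nat set \<Rightarrow>\<^sub>0 int) \<Rightarrow> (nat set \<Rightarrow>\<^sub>0 int)" where
  "relabel f = frag_extend (\<lambda>\<sigma>. frag_cmul ((-1) ^ inversions f \<sigma>) (frag_of (f ` \<sigma>)))"

interpretation relabel: module_hom "frag_cmul :: int \<Rightarrow> (nat set \<Rightarrow>\<^sub>0 int) \<Rightarrow> _" frag_cmul "relabel f" for f
  unfolding relabel_def by (rule module_hom_frag_extend)

lemma relabel_frag_of: "relabel f (frag_of \<sigma>) = frag_cmul ((-1) ^ inversions f \<sigma>) (frag_of (f ` \<sigma>))"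
  by (simp add: relabel_def)

text \<open>The vertices preceding \<open>v\<close> are \<open>A\<close> and \<open>B\<close> before
  relabelling, \<open>A\<close> and \<open>C\<close> after it, while the inversions involving
  \<open>v\<close> are counted by \<open>B\<close> and \<open>C\<close>. Both sides thus have the
  same parity.\<close>

lemma facet_sign_relabel:
  assumes f: "inj f" and \<sigma>: "finite \<sigma>" "v \<in> \<sigma>"
  shows "(-1) ^ inversions f \<sigma> * facet_sign (f ` \<sigma>) (f v) =
    facet_sign \<sigma> v * (-1) ^ inversions f (\<sigma> - {v})"
proof -
  define A where "A = {u\<in>\<sigma>. u < v \<and> f u < f v}"
  define B where "B = {u\<in>\<sigma>. u < v \<and> f v < f u}"
  define C where "C = {u\<in>\<sigma>. v < u \<and> f u < f v}"
  have fin: "finite A" "finite B" "finite C" using \<sigma> by (simp_all add: A_def B_def C_def)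
  have neq: "f u \<noteq> f v" if "u \<noteq> v" for u using f that by (simp add: inj_eq)
  have "{u \<in> f ` \<sigma>. u < f v} = f ` (A \<union> C)"
  proof (intro equalityI subsetI)
    fix x assume "x \<in> {u \<in> f ` \<sigma>. u < f v}"
    then obtain u where u: "u \<in> \<sigma>" "x = f u" "f u < f v" by blast
    then have "u \<noteq> v" by blast
    then show "x \<in> f ` (A \<union> C)" using u by (auto simp: A_def C_def)
  qed (auto simp: A_def C_def)
  moreover have "card (f ` (A \<union> C)) = card A + card C"
  proof -
    have "A \<inter> C = {}" by (auto simp: A_def C_def)
    then show ?thesis using fin inj_on_subset[OF f subset_UNIV] by (simp add: card_image card_Un_disjoint)
  qed
  ultimately have 1: "facet_sign (f ` \<sigma>) (f v) = (-1) ^ (card A + card C)"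
    by (simp add: facet_sign_def)
  have "{u\<in>\<sigma>. u < v} = A \<union> B"
  proof (intro equalityI subsetI)
    fix u assume u: "u \<in> {u\<in>\<sigma>. u < v}"
    then have "f u \<noteq> f v" by (intro neq) simp
    then show "u \<in> A \<union> B" using u by (auto simp: A_def B_def)
  qed (auto simp: A_def B_def)
  moreover have "A \<inter> B = {}" by (auto simp: A_def B_def)
  ultimately have 2: "facet_sign \<sigma> v = (-1) ^ (card A + card B)"
    using fin by (simp add: facet_sign_def card_Un_disjoint)
  let ?I = "\<lambda>\<sigma>. {(u, v). u \<in> \<sigma> \<and> v \<in> \<sigma> \<and> u < v \<and> f v < f u}"
  have finI: "finite (?I (\<sigma> - {v}))"
    by (rule finite_subset[of _ "\<sigma> \<times> \<sigma>"]) (use \<sigma> in auto)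
  have I: "?I \<sigma> = ?I (\<sigma> - {v}) \<union> ((\<lambda>u. (u, v)) ` B \<union> (\<lambda>u. (v, u)) ` C)"
    using \<sigma>(2) by (auto simp: B_def C_def)
  have "card ((\<lambda>u. (u, v)) ` B \<union> (\<lambda>u. (v, u)) ` C) = card ((\<lambda>u. (u, v)) ` B) + card ((\<lambda>u. (v, u)) ` C)"
    using fin by (intro card_Un_disjoint) (auto simp: B_def C_def)
  moreover have "card ((\<lambda>u. (u, v)) ` B) = card B" "card ((\<lambda>u. (v, u)) ` C) = card C"
    by (simp_all add: card_image inj_on_def)
  ultimately have "card ((\<lambda>u. (u, v)) ` B \<union> (\<lambda>u. (v, u)) ` C) = card B + card C" by simp
  moreover have "card (?I (\<sigma> - {v}) \<union> ((\<lambda>u. (u, v)) ` B \<union> (\<lambda>u. (v, u)) ` C)) =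
      card (?I (\<sigma> - {v})) + card ((\<lambda>u. (u, v)) ` B \<union> (\<lambda>u. (v, u)) ` C)"
    using fin finI by (intro card_Un_disjoint) auto
  ultimately have 3: "inversions f \<sigma> = inversions f (\<sigma> - {v}) + card B + card C"
    unfolding inversions_def I[symmetric] by simp
  have "(-1 :: int) ^ (card C) * (-1) ^ (card C) = 1" by (simp flip: power_mult_distrib)
  then show ?thesis unfolding 1 2 3 by (simp add: power_add mult.assoc mult.left_commute mult.commute)
qed

lemma relabel_bd:
  assumes f: "inj f" and \<sigma>: "finite \<sigma>"
  shows "relabel f (bd (frag_of \<sigma>)) = frag_cmul ((-1) ^ inversions f \<sigma>) (bd (frag_of (f ` \<sigma>)))"
proof -
  have im: "f ` (\<sigma> - {v}) = f ` \<sigma> - {f v}" for v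
    using f by (metis image_empty image_insert image_set_diff)
  have "bd (frag_of (f ` \<sigma>)) = (\<Sum>v\<in>\<sigma>. frag_cmul (facet_sign (f ` \<sigma>) (f v)) (frag_of (f ` \<sigma> - {f v})))"
    unfolding bd_frag_of using inj_on_subset[OF f subset_UNIV] by (subst sum.reindex) (simp_all add: o_def)
  then have "frag_cmul ((-1) ^ inversions f \<sigma>) (bd (frag_of (f ` \<sigma>))) =
      (\<Sum>v\<in>\<sigma>. frag_cmul ((-1) ^ inversions f \<sigma> * facet_sign (f ` \<sigma>) (f v)) (frag_of (f ` \<sigma> - {f v})))"
    by (simp add: frag_cmul_sum)
  also have "\<dots> = (\<Sum>v\<in>\<sigma>. frag_cmul (facet_sign \<sigma> v * (-1) ^ inversions f (\<sigma> - {v})) (frag_of (f ` (\<sigma> - {v}))))"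
    by (rule sum.cong) (simp_all only: facet_sign_relabel[OF f \<sigma>] im)
  also have "\<dots> = relabel f (bd (frag_of \<sigma>))"
    by (simp add: bd_frag_of relabel.sum relabel.scale relabel_frag_of)
  finally show ?thesis by simp
qed

lemma bd_relabel_in_boundary_span:
  assumes f: "inj f" and F: "\<And>\<tau>. \<tau> \<in> F \<Longrightarrow> finite \<tau>" and \<rho>: "finite \<rho>"
    and bd: "bd (frag_of \<rho>) \<in> boundary_span F"
  shows "bd (frag_of (f ` \<rho>)) \<in> boundary_span ((`) f ` F)"
proof -
  have "relabel f (bd (frag_of \<rho>)) \<in> frag.span (relabel f ` bd ` frag_of ` F)"
    using bd unfolding boundary_span_def relabel.span_image by (rule imageI)
  also have "frag.span (relabel f ` bd ` frag_of ` F) \<subseteq> boundary_span ((`) f ` F)"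
  proof (rule frag.span_minimal[OF _ subspace_boundary_span], clarify)
    fix \<tau> assume \<tau>: "\<tau> \<in> F"
    then have "bd (frag_of (f ` \<tau>)) \<in> boundary_span ((`) f ` F)"
      by (intro bd_in_boundary_span) simp
    then show "relabel f (bd (frag_of \<tau>)) \<in> boundary_span ((`) f ` F)"
      unfolding relabel_bd[OF f F[OF \<tau>]] by (rule frag.subspace_scale[OF subspace_boundary_span])
  qed
  finally have "frag_cmul ((-1) ^ inversions f \<rho>) (relabel f (bd (frag_of \<rho>))) \<in> boundary_span ((`) f ` F)"
    by (rule frag.subspace_scale[OF subspace_boundary_span])
  moreover have "frag_cmul ((-1) ^ inversions f \<rho>) (relabel f (bd (frag_of \<rho>))) = bd (frag_of (f ` \<rho>))"
    unfolding relabel_bd[OF f \<rho>] by (simp flip: power_mult_distrib)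
  ultimately show ?thesis by simp
qed

lemma fresh_relabel:
  assumes f: "bij f" and X: "\<And>\<sigma>. \<sigma> \<in> X \<Longrightarrow> finite \<sigma>" and \<sigma>: "finite \<sigma>"
    and fr: "fresh s X (f ` \<sigma>)"
  shows "fresh s ((`) f -` X) \<sigma>"
proof (rule ccontr)
  assume nf: "\<not> fresh s ((`) f -` X) \<sigma>"
  have inj: "inj f" using f by (rule bij_is_inj)
  obtain \<rho>' where \<rho>': "\<rho>' \<subseteq> f ` \<sigma>" "card \<rho>' = s" "bd (frag_of \<rho>') \<notin> boundary_span (sub_faces s X)"
    using fr unfolding fresh_def by blast
  obtain \<rho> where \<rho>: "\<rho> \<subseteq> \<sigma>" "\<rho>' = f ` \<rho>" using \<rho>'(1) by (rule subset_imageE)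
  have card: "card (f ` \<tau>) = card \<tau>" for \<tau> using inj_on_subset[OF inj subset_UNIV] by (rule card_image)
  have fin: "finite \<tau>" if \<tau>: "\<tau> \<in> sub_faces s ((`) f -` X)" for \<tau>
  proof -
    obtain \<kappa> where "f ` \<kappa> \<in> X" "\<tau> \<subseteq> \<kappa>" using \<tau> unfolding sub_faces_def by blast
    then have "finite \<kappa>" using X[of "f ` \<kappa>"] finite_imageD[of f \<kappa>] inj_on_subset[OF inj subset_UNIV] by blast
    then show ?thesis using \<open>\<tau> \<subseteq> \<kappa>\<close> finite_subset by blast
  qed
  have "bd (frag_of \<rho>) \<in> boundary_span (sub_faces s ((`) f -` X))"
    using nf \<rho> \<rho>'(2) card unfolding fresh_def by auto
  then have "bd (frag_of (f ` \<rho>)) \<in> boundary_span ((`) f ` sub_faces s ((`) f -` X))"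
    using fin finite_subset[OF \<rho>(1) \<sigma>] by (intro bd_relabel_in_boundary_span inj)
  moreover have "(`) f ` sub_faces s ((`) f -` X) \<subseteq> sub_faces s X"
  proof (rule image_subsetI)
    fix \<tau> assume "\<tau> \<in> sub_faces s ((`) f -` X)"
    then obtain \<kappa> where "card \<tau> = s" "f ` \<kappa> \<in> X" "\<tau> \<subseteq> \<kappa>" unfolding sub_faces_def by blast
    then have "card (f ` \<tau>) = s" "f ` \<tau> \<subseteq> f ` \<kappa>" using card[of \<tau>] by (simp_all add: image_mono)
    then show "f ` \<tau> \<in> sub_faces s X" using \<open>f ` \<kappa> \<in> X\<close> unfolding sub_faces_def by blast
  qed
  ultimately show False using \<rho>'(3) \<rho>(2) boundary_span_mono by blast
qed

section \<open>Random subsets\<close>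

definition random_subset :: "'a set \<Rightarrow> ('a \<Rightarrow> real) \<Rightarrow> 'a set pmf" where
  "random_subset A p = map_pmf (\<lambda>f. {x. f x}) (Pi_pmf A False (\<lambda>x. bernoulli_pmf (p x)))"

abbreviation prob :: "'a pmf \<Rightarrow> ('a \<Rightarrow> bool) \<Rightarrow> real" where
  "prob M P \<equiv> measure_pmf.prob M {x. P x}"

lemma prob_cong_set_pmf:
  assumes "\<And>x. x \<in> set_pmf M \<Longrightarrow> P x \<longleftrightarrow> Q x"
  shows "prob M P = prob M Q"
proof -
  have "{x. P x} \<inter> set_pmf M = {x. Q x} \<inter> set_pmf M" using assms by auto
  then show ?thesis using measure_Int_set_pmf[of M "{x. P x}"] measure_Int_set_pmf[of M "{x. Q x}"] by simp
qed

lemma prob_mono_set_pmf: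
  assumes "\<And>x. x \<in> set_pmf M \<Longrightarrow> P x \<Longrightarrow> Q x"
  shows "prob M P \<le> prob M Q"
proof -
  have "{x. P x} \<inter> set_pmf M \<subseteq> {x. Q x}" using assms by auto
  then have "measure_pmf.prob M ({x. P x} \<inter> set_pmf M) \<le> prob M Q"
    by (intro measure_pmf.finite_measure_mono) auto
  then show ?thesis by (simp add: measure_Int_set_pmf)
qed

lemma prob_map_pmf: "prob (map_pmf f M) P = prob M (\<lambda>x. P (f x))"
  by (simp add: vimage_def)

lemma prob_pair_pmf: "prob (pair_pmf M N) (\<lambda>x. P (fst x) \<and> Q (snd x)) = prob M P * prob N Q"
proof -
  have "prob (pair_pmf M N) (\<lambda>x. P (fst x) \<and> Q (snd x)) =
      measure_pmf.prob (pair_pmf M N) ({x. P (fst x) \<and> Q (snd x)} \<inter> set_pmf (pair_pmf M N))"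
    by (simp only: measure_Int_set_pmf)
  also have "{x. P (fst x) \<and> Q (snd x)} \<inter> set_pmf (pair_pmf M N) =
      ({x. P x} \<inter> set_pmf M) \<times> ({x. Q x} \<inter> set_pmf N)"
    by auto
  also have "measure_pmf.prob (pair_pmf M N) \<dots> =
      measure_pmf.prob M ({x. P x} \<inter> set_pmf M) * measure_pmf.prob N ({x. Q x} \<inter> set_pmf N)"
    by (intro measure_pmf_prob_product) (auto intro: countable_Int2)
  finally show ?thesis by (simp only: measure_Int_set_pmf)
qed

lemma sum_prob_eq_expectation_card:
  assumes A: "finite A" and M: "finite (set_pmf M)"
  shows "(\<Sum>a\<in>A. prob M (P a)) = measure_pmf.expectation M (\<lambda>x. real (card {a\<in>A. P a x}))"
proof -
  have "real (card {a\<in>A. P a x}) = (\<Sum>a\<in>A. indicator {x. P a x} x)" for x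
    using A by (simp add: indicator_def sum.If_cases Int_def)
  then have "measure_pmf.expectation M (\<lambda>x. real (card {a\<in>A. P a x})) =
      (\<Sum>a\<in>A. measure_pmf.expectation M (indicator {x. P a x}))"
    using M by (simp add: integrable_measure_pmf_finite Bochner_Integration.integral_sum)
  then show ?thesis by simp
qed

lemma prob_ge_le_expectation:
  fixes f :: "'a \<Rightarrow> real"
  assumes M: "finite (set_pmf M)" and f: "\<And>x. 0 \<le> f x" and t: "0 < t"
  shows "prob M (\<lambda>x. t \<le> f x) \<le> measure_pmf.expectation M f / t"
  using integral_Markov_inequality_measure[of "measure_pmf M" f "{}" t] M f t
  by (simp add: integrable_measure_pmf_finite)

lemma prob_Ex_le_sum:
  assumes "finite A"
  shows "prob M (\<lambda>x. \<exists>a\<in>A. P a x) \<le> (\<Sum>a\<in>A. prob M (P a))"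
proof -
  have "{x. \<exists>a\<in>A. P a x} = (\<Union>a\<in>A. {x. P a x})" by auto
  then show ?thesis
    using measure_pmf.finite_measure_subadditive_finite[of A "\<lambda>a. {x. P a x}" M] assms by simp
qed

lemma set_random_subset:
  assumes "finite A" "X \<in> set_pmf (random_subset A p)"
  shows "X \<subseteq> A"
proof -
  obtain f where f: "f \<in> set_pmf (Pi_pmf A False (\<lambda>x. bernoulli_pmf (p x)))" "X = {x. f x}"
    using assms(2) by (auto simp: random_subset_def)
  have "f x = False" if "x \<notin> A" for x
    using f(1) that set_Pi_pmf_subset[OF assms(1), of False "\<lambda>x. bernoulli_pmf (p x)"] by blast
  then show ?thesis using f(2) by auto
qed

lemma finite_set_random_subset: "finite A \<Longrightarrow> finite (set_pmf (random_subset A p))"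
  by (rule finite_subset[of _ "Pow A"]) (auto dest: set_random_subset)

lemma random_subset_restrict:
  assumes "finite A" "B \<subseteq> A"
  shows "map_pmf (\<lambda>X. X \<inter> B) (random_subset A p) = random_subset B p"
proof -
  have "random_subset B p = map_pmf (\<lambda>f. {x. f x}) (map_pmf (\<lambda>f x. if x \<in> B then f x else False)
      (Pi_pmf A False (\<lambda>x. bernoulli_pmf (p x))))"
    unfolding random_subset_def by (subst Pi_pmf_subset[OF assms]) simp
  also have "\<dots> = map_pmf (\<lambda>X. X \<inter> B) (random_subset A p)"
    unfolding random_subset_def map_pmf_comp by (intro map_pmf_cong) auto
  finally show ?thesis by simp
qed

lemma prob_random_subset_restrict:
  assumes "finite A" "B \<subseteq> A"
  shows "prob (random_subset A p) (\<lambda>X. Q (X \<inter> B)) = prob (random_subset B p) Q"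
  by (subst random_subset_restrict[OF assms, symmetric]) (simp add: prob_map_pmf)

lemma random_subset_Un:
  assumes "finite A" "finite B" "A \<inter> B = {}"
  shows "random_subset (A \<union> B) p =
    map_pmf (\<lambda>x. fst x \<union> snd x) (pair_pmf (random_subset A p) (random_subset B p))"
proof -
  let ?P = "\<lambda>A. Pi_pmf A False (\<lambda>x. bernoulli_pmf (p x))"
  have out: "\<not> f x" if "finite A" "f \<in> set_pmf (?P A)" "x \<notin> A" for f x A
    using that set_Pi_pmf_subset[OF that(1), of False "\<lambda>x. bernoulli_pmf (p x)"] by blast
  have "random_subset (A \<union> B) p =
      map_pmf (\<lambda>(f, g). {x. if x \<in> A then f x else g x}) (pair_pmf (?P A) (?P B))"
    unfolding random_subset_def by (simp add: Pi_pmf_union assms map_pmf_comp case_prod_unfold)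
  also have "\<dots> = map_pmf (\<lambda>(f, g). {x. f x} \<union> {x. g x}) (pair_pmf (?P A) (?P B))"
  proof (rule map_pmf_cong[OF refl], goal_cases)
    case (1 x)
    then have fg: "fst x \<in> set_pmf (?P A)" "snd x \<in> set_pmf (?P B)" by auto
    have "(if y \<in> A then fst x y else snd x y) \<longleftrightarrow> fst x y \<or> snd x y" for y
      using out[OF assms(1) fg(1), of y] out[OF assms(2) fg(2), of y] assms(3) by auto
    then show ?case by (simp add: case_prod_unfold Un_def)
  qed
  also have "\<dots> = map_pmf (\<lambda>x. fst x \<union> snd x) (pair_pmf (random_subset A p) (random_subset B p))"
    unfolding random_subset_def
    by (simp add: pair_map_pmf1 pair_map_pmf2 map_pmf_comp case_prod_unfold)
  finally show ?thesis .
qed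

lemma prob_random_subset_disjoint:
  assumes A: "finite A" and B: "B1 \<subseteq> A" "B2 \<subseteq> A" "B1 \<inter> B2 = {}"
  shows "prob (random_subset A p) (\<lambda>X. Q1 (X \<inter> B1) \<and> Q2 (X \<inter> B2)) =
    prob (random_subset B1 p) Q1 * prob (random_subset B2 p) Q2"
proof -
  have fin: "finite B1" "finite B2" using A B finite_subset by blast+
  have "prob (random_subset A p) (\<lambda>X. Q1 (X \<inter> B1) \<and> Q2 (X \<inter> B2)) =
      prob (random_subset A p) (\<lambda>X. Q1 (X \<inter> (B1 \<union> B2) \<inter> B1) \<and> Q2 (X \<inter> (B1 \<union> B2) \<inter> B2))"
    by (simp add: Int_assoc Int_absorb1)
  also have "\<dots> = prob (random_subset (B1 \<union> B2) p) (\<lambda>X. Q1 (X \<inter> B1) \<and> Q2 (X \<inter> B2))"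
    using prob_random_subset_restrict[OF A, of "B1 \<union> B2" p "\<lambda>X. Q1 (X \<inter> B1) \<and> Q2 (X \<inter> B2)"] B by simp
  also have "\<dots> = prob (pair_pmf (random_subset B1 p) (random_subset B2 p))
      (\<lambda>x. Q1 ((fst x \<union> snd x) \<inter> B1) \<and> Q2 ((fst x \<union> snd x) \<inter> B2))"
    by (simp add: random_subset_Un[OF fin B(3)] prob_map_pmf)
  also have "\<dots> = prob (pair_pmf (random_subset B1 p) (random_subset B2 p)) (\<lambda>x. Q1 (fst x) \<and> Q2 (snd x))"
  proof (rule prob_cong_set_pmf)
    fix x assume "x \<in> set_pmf (pair_pmf (random_subset B1 p) (random_subset B2 p))"
    then have x: "fst x \<in> set_pmf (random_subset B1 p)" "snd x \<in> set_pmf (random_subset B2 p)" by auto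
    have "fst x \<subseteq> B1" "snd x \<subseteq> B2"
      by (rule set_random_subset[OF fin(1) x(1)], rule set_random_subset[OF fin(2) x(2)])
    then have "(fst x \<union> snd x) \<inter> B1 = fst x" "(fst x \<union> snd x) \<inter> B2 = snd x" using B(3) by blast+
    then show "Q1 ((fst x \<union> snd x) \<inter> B1) \<and> Q2 ((fst x \<union> snd x) \<inter> B2) \<longleftrightarrow> Q1 (fst x) \<and> Q2 (snd x)" by simp
  qed
  finally show ?thesis by (simp only: prob_pair_pmf)
qed

lemma prob_random_subset_disjoint_family:
  assumes "finite J" "finite A" "\<And>j. j \<in> J \<Longrightarrow> B j \<subseteq> A"
    "\<And>i j. i \<in> J \<Longrightarrow> j \<in> J \<Longrightarrow> i \<noteq> j \<Longrightarrow> B i \<inter> B j = {}"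
  shows "prob (random_subset A p) (\<lambda>X. \<forall>j\<in>J. Q j (X \<inter> B j)) = (\<Prod>j\<in>J. prob (random_subset (B j) p) (Q j))"
  using assms
proof (induction J arbitrary: A rule: finite_induct)
  case empty
  then show ?case by simp
next
  case (insert j J)
  let ?D = "\<Union>i\<in>J. B i"
  have "B j \<inter> B i = {}" if "i \<in> J" for i
    using insert.prems(3)[of j i] that insert.hyps(2) by blast
  then have D: "?D \<subseteq> A" "B j \<subseteq> A" "B j \<inter> ?D = {}" using insert.prems(2) by auto
  have "X \<inter> ?D \<inter> B i = X \<inter> B i" if "i \<in> J" for i X using that by auto
  then have "prob (random_subset A p) (\<lambda>X. \<forall>i\<in>insert j J. Q i (X \<inter> B i)) =
      prob (random_subset A p) (\<lambda>X. Q j (X \<inter> B j) \<and> (\<forall>i\<in>J. Q i (X \<inter> ?D \<inter> B i)))"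
    by simp
  also have "\<dots> = prob (random_subset (B j) p) (Q j) *
      prob (random_subset ?D p) (\<lambda>X. \<forall>i\<in>J. Q i (X \<inter> B i))"
    by (rule prob_random_subset_disjoint[OF insert.prems(1) D(2,1,3)])
  also have "prob (random_subset ?D p) (\<lambda>X. \<forall>i\<in>J. Q i (X \<inter> B i)) =
      (\<Prod>i\<in>J. prob (random_subset (B i) p) (Q i))"
    using D(1) insert.prems finite_subset by (intro insert.IH) auto
  finally show ?case using insert.hyps by simp
qed

lemma prob_mem_random_subset:
  assumes A: "finite A" "x \<in> A" and p: "0 \<le> p x" "p x \<le> 1"
  shows "prob (random_subset A p) (\<lambda>X. x \<in> X) = p x"
proof -
  have "prob (random_subset A p) (\<lambda>X. x \<in> X) =
      prob (map_pmf (\<lambda>f. f x) (Pi_pmf A False (\<lambda>x. bernoulli_pmf (p x)))) (\<lambda>b. b)"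
    by (simp add: random_subset_def vimage_def)
  also have "\<dots> = measure_pmf.prob (bernoulli_pmf (p x)) {True}"
    using A by (simp add: Pi_pmf_component) (metis (full_types) Collect_cong singleton_conv)
  also have "\<dots> = p x" using p by (simp add: measure_pmf_single)
  finally show ?thesis .
qed

lemma prob_mem2_random_subset:
  assumes A: "finite A" "x \<in> A" "y \<in> A" "x \<noteq> y" and p: "\<And>x. x \<in> A \<Longrightarrow> 0 \<le> p x \<and> p x \<le> 1"
  shows "prob (random_subset A p) (\<lambda>X. x \<in> X \<and> y \<in> X) = p x * p y"
proof -
  have "prob (random_subset A p) (\<lambda>X. x \<in> X \<and> y \<in> X) =
      prob (random_subset {x} p) (\<lambda>X. x \<in> X) * prob (random_subset {y} p) (\<lambda>X. y \<in> X)"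
    using prob_random_subset_disjoint[OF A(1), of "{x}" "{y}" p "\<lambda>X. x \<in> X" "\<lambda>X. y \<in> X"] A by simp
  then show ?thesis using A p by (simp add: prob_mem_random_subset)
qed

lemma prob_mem_and_rest_random_subset:
  assumes A: "finite A" "x \<in> A" and p: "0 \<le> p x" "p x \<le> 1"
  shows "prob (random_subset A p) (\<lambda>X. x \<in> X \<and> Q (X - {x})) = p x * prob (random_subset (A - {x}) p) Q"
proof -
  have "prob (random_subset A p) (\<lambda>X. x \<in> X \<and> Q (X - {x})) =
      prob (random_subset A p) (\<lambda>X. x \<in> X \<inter> {x} \<and> Q (X \<inter> (A - {x})))"
  proof (rule prob_cong_set_pmf)
    fix X assume "X \<in> set_pmf (random_subset A p)"
    then have "X - {x} = X \<inter> (A - {x})" using set_random_subset[OF A(1)] by blast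
    then show "x \<in> X \<and> Q (X - {x}) \<longleftrightarrow> x \<in> X \<inter> {x} \<and> Q (X \<inter> (A - {x}))" by simp
  qed
  also have "\<dots> = prob (random_subset {x} p) (\<lambda>X. x \<in> X) * prob (random_subset (A - {x}) p) Q"
    using A by (intro prob_random_subset_disjoint) auto
  finally show ?thesis using p by (simp add: prob_mem_random_subset)
qed

text \<open>The constant probability makes the law invariant under bijections of the ground set;
  this is why the symmetry argument is confined to simplices of one dimension.\<close>

lemma random_subset_vimage:
  assumes A: "finite A" and g: "bij_betw g A A" "\<And>x. x \<notin> A \<Longrightarrow> g x \<notin> A"
  shows "map_pmf (\<lambda>X. g -` X) (random_subset A (\<lambda>_. c)) = random_subset A (\<lambda>_. c)"
proof -
  have "random_subset A (\<lambda>_. c) = map_pmf (\<lambda>f. {x. f x}) (map_pmf (\<lambda>f. f \<circ> g) (Pi_pmf A False (\<lambda>_. bernoulli_pmf c)))"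
    unfolding random_subset_def by (subst Pi_pmf_bij_betw[OF A g]) simp_all
  also have "\<dots> = map_pmf (\<lambda>X. g -` X) (random_subset A (\<lambda>_. c))"
    unfolding random_subset_def by (simp add: map_pmf_comp vimage_def o_def)
  finally show ?thesis by simp
qed

lemma obtain_bij_transport:
  fixes U :: "'a set"
  assumes U: "finite U" and \<sigma>: "\<sigma> \<subseteq> U" "\<sigma>' \<subseteq> U" "card \<sigma> = card \<sigma>'"
  obtains f where "bij f" "f ` U = U" "f ` \<sigma> = \<sigma>'"
proof -
  have fin: "finite \<sigma>" "finite \<sigma>'" using U \<sigma> finite_subset by blast+
  obtain g where g: "bij_betw g \<sigma> \<sigma>'" using finite_same_card_bij[OF fin \<sigma>(3)] by blast
  have "card (U - \<sigma>) = card (U - \<sigma>')" using \<sigma> fin by (simp add: card_Diff_subset)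
  then obtain h where h: "bij_betw h (U - \<sigma>) (U - \<sigma>')"
    using finite_same_card_bij[of "U - \<sigma>" "U - \<sigma>'"] U by blast
  define f where "f x = (if x \<in> \<sigma> then g x else if x \<in> U then h x else x)" for x
  have f1: "bij_betw f \<sigma> \<sigma>'" using g by (subst bij_betw_cong[of \<sigma> f g]) (auto simp: f_def)
  have f2: "bij_betw f (U - \<sigma>) (U - \<sigma>')" using h by (subst bij_betw_cong[of _ f h]) (auto simp: f_def)
  have f3: "bij_betw f (- U) (- U)"
    using \<sigma>(1) by (subst bij_betw_cong[of _ f "\<lambda>x. x"]) (auto simp: f_def bij_betw_def inj_on_def)
  have "bij_betw f (\<sigma> \<union> (U - \<sigma>)) (\<sigma>' \<union> (U - \<sigma>'))" using f1 f2 by (rule bij_betw_combine) auto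
  moreover have "\<sigma> \<union> (U - \<sigma>) = U" "\<sigma>' \<union> (U - \<sigma>') = U" using \<sigma> by auto
  ultimately have f12: "bij_betw f U U" by simp
  have "bij_betw f (U \<union> - U) (U \<union> - U)" using f12 f3 by (rule bij_betw_combine) auto
  then have "bij f" by simp
  moreover have "f ` U = U" "f ` \<sigma> = \<sigma>'" using f12 f1 by (auto simp: bij_betw_def)
  ultimately show thesis by (rule that)
qed

context
  fixes U :: "nat set" and s :: nat and A :: "nat set set"
  assumes U: "finite U"
  defines "A \<equiv> {\<sigma>. \<sigma> \<subseteq> U \<and> card \<sigma> = s}"
begin

lemma finite_uniform_faces: "finite A"
  using U by (simp add: A_def)

text \<open>A bijection of \<open>U\<close> taking \<sigma> to \<sigma>' preserves the law and
  transports freshness. An inequality suffices, since exchanging the two simplices gives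
  equality.\<close>

lemma prob_fresh_le_transport:
  assumes \<sigma>: "\<sigma> \<in> A" "\<sigma>' \<in> A"
  shows "prob (random_subset A (\<lambda>_. c)) (\<lambda>X. fresh t (X - {\<sigma>'}) \<sigma>') \<le>
    prob (random_subset A (\<lambda>_. c)) (\<lambda>X. fresh t (X - {\<sigma>}) \<sigma>)"
proof -
  obtain f where f: "bij f" "f ` U = U" "f ` \<sigma> = \<sigma>'"
    using obtain_bij_transport[OF U, of \<sigma> \<sigma>'] \<sigma> by (auto simp: A_def)
  let ?g = "(`) f"
  have inj: "inj f" using f(1) by (rule bij_is_inj)
  have card: "card (f ` \<tau>) = card \<tau>" for \<tau> using inj_on_subset[OF inj subset_UNIV] by (rule card_image)
  have gA: "f ` \<tau> \<in> A \<longleftrightarrow> \<tau> \<in> A" for \<tau>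
    using f(2) inj_image_subset_iff[OF inj, of \<tau> U] card[of \<tau>] by (simp add: A_def)
  have "inj_on ?g A" using inj by (simp add: inj_image_eq_iff inj_on_def)
  moreover have "?g ` A \<subseteq> A" using gA by blast
  ultimately have bij: "bij_betw ?g A A" using finite_uniform_faces by (simp add: bij_betw_def endo_inj_surj)
  have "prob (random_subset A (\<lambda>_. c)) (\<lambda>X. fresh t (X - {\<sigma>'}) \<sigma>') \<le>
      prob (random_subset A (\<lambda>_. c)) (\<lambda>X. fresh t ((?g -` X) - {\<sigma>}) \<sigma>)"
  proof (rule prob_mono_set_pmf)
    fix X assume X: "X \<in> set_pmf (random_subset A (\<lambda>_. c))" "fresh t (X - {\<sigma>'}) \<sigma>'"
    have XA: "X \<subseteq> A" using set_random_subset[OF finite_uniform_faces X(1)] .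
    have "fresh t (?g -` (X - {\<sigma>'})) \<sigma>"
    proof (rule fresh_relabel[OF f(1)])
      have "\<tau> \<subseteq> U" if "\<tau> \<in> A" for \<tau> using that by (simp add: A_def)
      then have fin: "finite \<tau>" if "\<tau> \<in> A" for \<tau> using that U by (meson finite_subset)
      show "finite \<tau>" if "\<tau> \<in> X - {\<sigma>'}" for \<tau> using that XA by (intro fin) blast
      show "finite \<sigma>" using \<sigma>(1) by (rule fin)
      show "fresh t (X - {\<sigma>'}) (f ` \<sigma>)" using X(2) f(3) by simp
    qed
    moreover have "?g -` (X - {\<sigma>'}) = (?g -` X) - {\<sigma>}"
      using inj_image_eq_iff[OF inj] f(3) by auto
    ultimately show "fresh t ((?g -` X) - {\<sigma>}) \<sigma>" by simp
  qed
  also have "\<dots> = prob (map_pmf (\<lambda>X. ?g -` X) (random_subset A (\<lambda>_. c))) (\<lambda>X. fresh t (X - {\<sigma>}) \<sigma>)"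
    by (simp only: prob_map_pmf)
  also have "map_pmf (\<lambda>X. ?g -` X) (random_subset A (\<lambda>_. c)) = random_subset A (\<lambda>_. c)"
    using gA by (intro random_subset_vimage finite_uniform_faces bij) simp
  finally show ?thesis .
qed

text \<open>Double counting. By symmetry all simplices have the same probability of being fresh
  relative to the others, and this is independent of their presence; so the left side is the
  expected number of simplices that are present and fresh. The pigeonhole bounds this number for
  every outcome.\<close>

lemma prob_fresh_le:
  assumes c: "0 \<le> c" "c \<le> 1" and \<sigma>: "\<sigma> \<in> A"
  shows "c * real (card U choose s) * prob (random_subset (A - {\<sigma>}) (\<lambda>_. c)) (\<lambda>X. fresh (Suc l) X \<sigma>) \<le>
    real (card U choose l) * log 2 (2 * real (card U choose s) + 1)"
proof -
  let ?M = "random_subset A (\<lambda>_. c)"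
  let ?m = "real (card U choose l) * log 2 (2 * real (card U choose s) + 1)"
  have cA: "card A = card U choose s" unfolding A_def by (rule n_subsets[OF U])
  define \<pi> where "\<pi> = prob ?M (\<lambda>X. fresh (Suc l) (X - {\<sigma>}) \<sigma>)"
  have rest: "prob (random_subset (A - {\<tau>}) (\<lambda>_. c)) Q = prob ?M (\<lambda>X. Q (X - {\<tau>}))" if "\<tau> \<in> A" for \<tau> Q
  proof -
    have "prob ?M (\<lambda>X. Q (X - {\<tau>})) = prob ?M (\<lambda>X. Q (X \<inter> (A - {\<tau>})))"
    proof (rule prob_cong_set_pmf)
      fix X assume "X \<in> set_pmf ?M"
      then have "X - {\<tau>} = X \<inter> (A - {\<tau>})" using set_random_subset[OF finite_uniform_faces] by blast
      then show "Q (X - {\<tau>}) \<longleftrightarrow> Q (X \<inter> (A - {\<tau>}))" by simp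
    qed
    then show ?thesis using prob_random_subset_restrict[OF finite_uniform_faces, of "A - {\<tau>}"] by simp
  qed
  have \<pi>_eq: "prob ?M (\<lambda>X. fresh (Suc l) (X - {\<tau>}) \<tau>) = \<pi>" if "\<tau> \<in> A" for \<tau>
    unfolding \<pi>_def using prob_fresh_le_transport that \<sigma> by (intro antisym) blast+
  have "c * real (card U choose s) * \<pi> = (\<Sum>\<tau>\<in>A. c * \<pi>)" by (simp add: cA)
  also have "\<dots> = (\<Sum>\<tau>\<in>A. prob ?M (\<lambda>X. \<tau> \<in> X \<and> fresh (Suc l) (X - {\<tau>}) \<tau>))"
  proof (rule sum.cong[OF refl])
    fix \<tau> assume \<tau>: "\<tau> \<in> A"
    show "c * \<pi> = prob ?M (\<lambda>X. \<tau> \<in> X \<and> fresh (Suc l) (X - {\<tau>}) \<tau>)"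
      using prob_mem_and_rest_random_subset[OF finite_uniform_faces \<tau>, of "\<lambda>_. c" "\<lambda>X. fresh (Suc l) X \<tau>"]
        rest[OF \<tau>, of "\<lambda>X. fresh (Suc l) X \<tau>"] \<pi>_eq[OF \<tau>] c by simp
  qed
  also have "\<dots> = measure_pmf.expectation ?M (\<lambda>X. real (card {\<tau>\<in>A. \<tau> \<in> X \<and> fresh (Suc l) (X - {\<tau>}) \<tau>}))"
    by (rule sum_prob_eq_expectation_card[OF finite_uniform_faces finite_set_random_subset[OF finite_uniform_faces]])
  also have "\<dots> \<le> measure_pmf.expectation ?M (\<lambda>X. ?m)"
  proof (rule integral_mono_AE)
    show "AE X in measure_pmf ?M. real (card {\<tau>\<in>A. \<tau> \<in> X \<and> fresh (Suc l) (X - {\<tau>}) \<tau>}) \<le> ?m"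
    proof (rule AE_pmfI)
      fix X assume "X \<in> set_pmf ?M"
      then have XA: "X \<subseteq> A" by (rule set_random_subset[OF finite_uniform_faces])
      define N where "N = card {\<tau>\<in>X. fresh (Suc l) (X - {\<tau>}) \<tau>}"
      have "{\<tau>\<in>A. \<tau> \<in> X \<and> fresh (Suc l) (X - {\<tau>}) \<tau>} = {\<tau>\<in>X. fresh (Suc l) (X - {\<tau>}) \<tau>}" using XA by blast
      then have N: "card {\<tau>\<in>A. \<tau> \<in> X \<and> fresh (Suc l) (X - {\<tau>}) \<tau>} = N" by (simp add: N_def)
      have XU: "\<tau> \<subseteq> U" if "\<tau> \<in> X" for \<tau> using that XA by (auto simp: A_def)
      have "2 ^ N \<le> (2 * N + 1) ^ (card U choose l)"
        unfolding N_def by (rule two_power_card_fresh_le[OF U XU])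
      \<comment> \<open>The unknown \<open>N\<close> in the base is replaced by the number of all
        candidates; the loss is confined to the logarithm.\<close>
      also have "\<dots> \<le> (2 * (card U choose s) + 1) ^ (card U choose l)"
      proof (rule power_mono)
        have "N \<le> card A" unfolding N_def using XA by (intro card_mono finite_uniform_faces) auto
        then show "2 * N + 1 \<le> 2 * (card U choose s) + 1" using cA by simp
      qed simp
      finally have "real (2 ^ N) \<le> real ((2 * (card U choose s) + 1) ^ (card U choose l))"
        by (rule of_nat_mono)
      then have "2 ^ N \<le> (2 * real (card U choose s) + 1) ^ (card U choose l)" by (simp add: add.commute)
      then have "log 2 (2 ^ N) \<le> log 2 ((2 * real (card U choose s) + 1) ^ (card U choose l))"
        by (subst log_le_cancel_iff) (simp_all add: add_pos_nonneg)
      then have "real N \<le> ?m" by (simp add: log_nat_power add_nonneg_pos)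
      then show "real (card {\<tau>\<in>A. \<tau> \<in> X \<and> fresh (Suc l) (X - {\<tau>}) \<tau>}) \<le> ?m" unfolding N .
    qed
  qed (simp_all add: integrable_measure_pmf_finite finite_set_random_subset[OF finite_uniform_faces])
  finally show ?thesis using rest[OF \<sigma>, of "\<lambda>X. fresh (Suc l) X \<sigma>"] by (simp add: \<pi>_def)
qed

end

section \<open>Filled spheres, limits in probability and deviations\<close>

lemma boundary_span_subset:
  assumes "\<And>\<kappa>. \<kappa> \<in> F \<Longrightarrow> bd (frag_of \<kappa>) \<in> boundary_span D"
  shows "boundary_span F \<subseteq> boundary_span D"
  unfolding boundary_span_def[of F]
  by (rule frag.span_minimal[OF _ subspace_boundary_span]) (use assms in auto)

text \<open>The facet opposite \<open>v\<close> has coefficient 1 or -1 in the boundary of \<rho>,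
  so some face of \<open>F\<close> must contribute to it.\<close>

lemma mem_if_boundary_in_span:
  assumes \<rho>: "finite \<rho>" "v \<in> \<rho>" and bd: "bd (frag_of \<rho>) \<in> boundary_span F"
  shows "\<exists>\<sigma>\<in>F. \<rho> - {v} \<subseteq> \<sigma>"
proof -
  have "Poly_Mapping.lookup (bd (frag_of \<rho>)) (\<rho> - {v}) = (\<Sum>u\<in>\<rho>. if u = v then facet_sign \<rho> u else 0)"
    unfolding bd_frag_of lookup_sum lookup_frag_cmul
    using \<rho>(2) by (intro sum.cong) auto
  also have "\<dots> = facet_sign \<rho> v" using \<rho> by simp
  finally have "\<rho> - {v} \<in> Poly_Mapping.keys (bd (frag_of \<rho>))"
    by (simp add: in_keys_iff facet_sign_def)
  moreover obtain c where c: "bd (frag_of \<rho>) = bd c" "Poly_Mapping.keys c \<subseteq> F"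
    using bd unfolding boundary_span_eq by blast
  ultimately have "\<rho> - {v} \<in> {\<sigma> - {v} | \<sigma> v. \<sigma> \<in> F \<and> v \<in> \<sigma>}"
    using keys_bd[OF c(2)] by auto
  then show ?thesis by blast
qed

context
  fixes X :: "nat set set" and n l :: nat
  assumes finX: "finite X" and X: "\<And>\<sigma>. \<sigma> \<in> X \<Longrightarrow> \<sigma> \<noteq> {} \<and> \<sigma> \<subseteq> {0..n}" and ln: "l \<le> n"
    and fill: "\<And>\<rho>. \<rho> \<subseteq> {0..n} \<Longrightarrow> card \<rho> = Suc l \<Longrightarrow> bd (frag_of \<rho>) \<in> boundary_span (sub_faces (Suc l) X)"
begin

text \<open>A face with at most \<open>l\<close> vertices extends to some \<rho> with
  \<open>l + 1\<close> vertices and lies in a facet of it. Since the boundary of \<rho> is filled,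
  that facet is covered by a simplex of \<open>X\<close>.\<close>

lemma full_skeleton_if_fill: "has_full_skeleton n (int l - 1) (generated_complex X)"
  unfolding has_full_skeleton_def
proof (intro allI impI, elim conjE)
  fix \<tau> :: "nat set" assume \<tau>: "\<tau> \<noteq> {}" "\<tau> \<subseteq> {0..n}" "dimension \<tau> \<le> int l - 1"
  have fin: "finite \<tau>" using \<tau>(2) finite_subset by blast
  have "card \<tau> \<le> Suc l" "Suc l \<le> card {0..n}" using \<tau>(3) ln by (simp_all add: dimension_def)
  then obtain \<rho> where \<rho>: "\<tau> \<subseteq> \<rho>" "\<rho> \<subseteq> {0..n}" "card \<rho> = Suc l"
    using exists_subset_between[of \<tau> "Suc l" "{0..n}"] \<tau>(2) by blast
  have "card \<tau> < card \<rho>" using \<tau>(3) \<rho>(3) by (simp add: dimension_def)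
  then have "\<tau> \<noteq> \<rho>" by blast
  then obtain v where v: "v \<in> \<rho>" "v \<notin> \<tau>" using \<rho>(1) by blast
  have "finite \<rho>" using \<rho>(2) finite_subset by blast
  then obtain \<sigma> where "\<sigma> \<in> sub_faces (Suc l) X" "\<rho> - {v} \<subseteq> \<sigma>"
    using mem_if_boundary_in_span[OF _ v(1) fill[OF \<rho>(2,3)]] by blast
  then obtain \<sigma>' where "\<sigma>' \<in> X" "\<tau> \<subseteq> \<sigma>'" using \<rho>(1) v unfolding sub_faces_def by blast
  then show "\<tau> \<in> generated_complex X" using \<tau>(1) by (rule generated_complexI)
qed

text \<open>In the full simplex on \<open>{0..n}\<close> a cycle bounds its cone from vertex 0. The
  faces of that cone lie in the full skeleton if \<open>k + 1 < l\<close>; if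
  \<open>k + 1 = l\<close> they may be missing, but their boundaries are filled by
  \<open>l\<close>-faces that are present.\<close>

lemma trivial_homology_if_fill:
  assumes k: "k < int l"
  shows "trivial_group (reduced_face_homology k (generated_complex X))"
proof (rule trivial_reduced_face_homology)
  let ?Y = "generated_complex X" and ?D = "{\<sigma> \<in> insert {} (generated_complex X). dimension \<sigma> = k + 1}"
  have finX': "finite \<sigma>" if "\<sigma> \<in> X" for \<sigma> using X[OF that] finite_subset by blast
  show "simplicial_complex ?Y" using finX finX' by (rule simplicial_generated_complex)
  fix c assume c: "Poly_Mapping.keys c \<subseteq> {\<sigma> \<in> insert {} ?Y. dimension \<sigma> = k}" "bd c = 0"
  have keys: "\<tau> \<subseteq> {0..n} \<and> finite \<tau> \<and> dimension \<tau> = k" if "\<tau> \<in> Poly_Mapping.keys c" for \<tau>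
  proof -
    have \<tau>: "\<tau> \<in> insert {} ?Y" "dimension \<tau> = k" using c(1) that by auto
    have "\<tau> \<subseteq> {0..n}"
    proof (cases "\<tau> = {}")
      case False
      then have "\<tau> \<in> ?Y" using \<tau>(1) by blast
      then obtain \<sigma> where "\<sigma> \<in> X" "\<tau> \<subseteq> \<sigma>" by (rule generated_complexE)
      then show ?thesis using X[of \<sigma>] by blast
    qed simp
    then show ?thesis using \<tau>(2) finite_subset by blast
  qed
  have "bd (coned 0 c) + coned 0 (bd c) = c" using keys by (intro cone_homotopy) simp
  then have "c = bd (coned 0 c)" using c(2) by simp
  also have "\<dots> \<in> boundary_span {insert 0 \<tau> | \<tau>. \<tau> \<in> Poly_Mapping.keys c \<and> 0 \<notin> \<tau>}"
    by (rule bd_in_boundary_span[OF keys_coned[OF subset_refl]])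
  also have "\<dots> \<subseteq> boundary_span ?D"
  proof (rule boundary_span_subset)
    fix \<kappa> assume "\<kappa> \<in> {insert 0 \<tau> | \<tau>. \<tau> \<in> Poly_Mapping.keys c \<and> 0 \<notin> \<tau>}"
    then obtain \<tau> where \<tau>: "\<kappa> = insert 0 \<tau>" "\<tau> \<in> Poly_Mapping.keys c" "0 \<notin> \<tau>" by blast
    have \<kappa>: "\<kappa> \<subseteq> {0..n}" "dimension \<kappa> = k + 1" "\<kappa> \<noteq> {}"
      using keys[OF \<tau>(2)] \<tau>(1,3) by (auto simp: dimension_def)
    show "bd (frag_of \<kappa>) \<in> boundary_span ?D"
    proof (cases "k + 1 = int l")
      case True
      then have card: "card \<kappa> = Suc l" using \<kappa>(2) by (simp add: dimension_def)
      have "sub_faces (Suc l) X \<subseteq> ?D"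
      proof
        fix \<rho> assume "\<rho> \<in> sub_faces (Suc l) X"
        then obtain \<sigma> where \<rho>: "card \<rho> = Suc l" "\<sigma> \<in> X" "\<rho> \<subseteq> \<sigma>" unfolding sub_faces_def by blast
        then have "\<rho> \<noteq> {}" by (metis card.empty nat.simps(3))
        then have "\<rho> \<in> ?Y" using \<rho> by (intro generated_complexI)
        then show "\<rho> \<in> ?D" using \<rho>(1) True by (simp add: dimension_def)
      qed
      then show ?thesis using fill[OF \<kappa>(1) card] boundary_span_mono by blast
    next
      case False
      then have "dimension \<kappa> \<le> int l - 1" using k \<kappa>(2) by linarith
      then have "\<kappa> \<in> ?Y" using full_skeleton_if_fill \<kappa> unfolding has_full_skeleton_def by blast
      then show ?thesis using \<kappa>(2) by (intro bd_in_boundary_span) simp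
    qed
  qed
  finally show "c \<in> boundary_span ?D" .
qed

end

section \<open>Calculus of asymptotically almost sure events\<close>

lemma aas_iff: "aas Z T \<longleftrightarrow> (\<lambda>n. prob (Z n) (\<lambda>z. \<not> T n z)) \<longlonglongrightarrow> 0"
proof -
  have eq: "prob (Z n) (\<lambda>z. \<not> T n z) = 1 - prob (Z n) (T n)" for n
    using measure_pmf.prob_compl[of "{z. T n z}" "Z n"] by (simp add: Compl_eq_Diff_UNIV[symmetric] Collect_neg_eq)
  show ?thesis
  proof
    assume "aas Z T"
    then have "(\<lambda>n. 1 - prob (Z n) (T n)) \<longlonglongrightarrow> 1 - 1"
      unfolding aas_def by (intro tendsto_intros)
    then show "(\<lambda>n. prob (Z n) (\<lambda>z. \<not> T n z)) \<longlonglongrightarrow> 0" by (simp add: eq)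
  next
    assume "(\<lambda>n. prob (Z n) (\<lambda>z. \<not> T n z)) \<longlonglongrightarrow> 0"
    then have "(\<lambda>n. 1 - prob (Z n) (\<lambda>z. \<not> T n z)) \<longlonglongrightarrow> 1 - 0" by (intro tendsto_intros)
    then show "aas Z T" by (simp add: eq aas_def)
  qed
qed

lemma aas_bound:
  assumes "\<forall>\<^sub>F n in sequentially. prob (Z n) (\<lambda>z. \<not> T n z) \<le> b n" "b \<longlonglongrightarrow> 0"
  shows "aas Z T"
  unfolding aas_iff
  by (rule tendsto_sandwich[OF _ assms(1) tendsto_const assms(2)]) simp

lemma aas_mono:
  assumes "aas Z T" "\<forall>\<^sub>F n in sequentially. \<forall>z\<in>set_pmf (Z n). T n z \<longrightarrow> S n z"
  shows "aas Z S"
proof (rule aas_bound)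
  show "\<forall>\<^sub>F n in sequentially. prob (Z n) (\<lambda>z. \<not> S n z) \<le> prob (Z n) (\<lambda>z. \<not> T n z)"
    using assms(2) by eventually_elim (intro prob_mono_set_pmf, blast)
  show "(\<lambda>n. prob (Z n) (\<lambda>z. \<not> T n z)) \<longlonglongrightarrow> 0" using assms(1) unfolding aas_iff .
qed

lemma aas_ball:
  assumes "finite K" "\<And>k. k \<in> K \<Longrightarrow> aas Z (T k)"
  shows "aas Z (\<lambda>n z. \<forall>k\<in>K. T k n z)"
proof (rule aas_bound)
  have "prob (Z n) (\<lambda>z. \<exists>k\<in>K. \<not> T k n z) \<le> (\<Sum>k\<in>K. prob (Z n) (\<lambda>z. \<not> T k n z))" for n
    using assms(1) by (rule prob_Ex_le_sum)
  then show "\<forall>\<^sub>F n in sequentially. prob (Z n) (\<lambda>z. \<not> (\<forall>k\<in>K. T k n z)) \<le> (\<Sum>k\<in>K. prob (Z n) (\<lambda>z. \<not> T k n z))"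
    by simp
  have "(\<lambda>n. \<Sum>k\<in>K. prob (Z n) (\<lambda>z. \<not> T k n z)) \<longlonglongrightarrow> (\<Sum>k\<in>K. 0)"
    using assms(2) unfolding aas_iff by (intro tendsto_sum)
  then show "(\<lambda>n. \<Sum>k\<in>K. prob (Z n) (\<lambda>z. \<not> T k n z)) \<longlonglongrightarrow> 0" by simp
qed

lemma aas_conj:
  assumes "aas Z S" "aas Z T"
  shows "aas Z (\<lambda>n z. S n z \<and> T n z)"
proof -
  have "aas Z (\<lambda>n z. \<forall>b\<in>{0, 1 :: nat}. (if b = 0 then S else T) n z)"
    using assms by (intro aas_ball) auto
  then show ?thesis by (rule aas_mono) auto
qed

lemma aas_map_pmf: "aas (\<lambda>n. map_pmf f (Z n)) T \<longleftrightarrow> aas Z (\<lambda>n z. T n (f z))"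
  by (simp add: aas_def vimage_def)

lemma aas_sim_if_expectation:
  assumes fin: "\<And>n. finite (set_pmf (Z n))"
    and bound: "\<forall>\<^sub>F n in sequentially. measure_pmf.expectation (Z n) (\<lambda>z. \<bar>a z / b n - 1\<bar>) \<le> \<delta> n"
    and lim: "\<delta> \<longlonglongrightarrow> 0"
  shows "aas_sim Z a b"
proof -
  \<comment> \<open>The square root balances the Markov bound: the deviation threshold and the
    resulting failure probability are both \<epsilon>. The summand
    \<open>inverse (real (Suc n))\<close> keeps the threshold positive.\<close>
  define \<epsilon> where "\<epsilon> n = sqrt (\<bar>\<delta> n\<bar> + inverse (real (Suc n)))" for n
  have pos: "0 < \<epsilon> n" for n unfolding \<epsilon>_def by (simp add: add_nonneg_pos)
  have "(\<lambda>n. sqrt (\<bar>\<delta> n\<bar> + inverse (real (Suc n)))) \<longlonglongrightarrow> sqrt (\<bar>0\<bar> + 0)"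
    using lim LIMSEQ_inverse_real_of_nat by (intro tendsto_intros)
  then have \<epsilon>: "\<epsilon> \<longlonglongrightarrow> 0" by (simp add: \<epsilon>_def[abs_def])
  have "aas Z (\<lambda>n z. \<bar>a z / b n - 1\<bar> < \<epsilon> n)"
  proof (rule aas_bound[OF _ \<epsilon>])
    show "\<forall>\<^sub>F n in sequentially. prob (Z n) (\<lambda>z. \<not> \<bar>a z / b n - 1\<bar> < \<epsilon> n) \<le> \<epsilon> n"
      using bound
    proof eventually_elim
      case (elim n)
      have "prob (Z n) (\<lambda>z. \<epsilon> n \<le> \<bar>a z / b n - 1\<bar>) \<le>
          measure_pmf.expectation (Z n) (\<lambda>z. \<bar>a z / b n - 1\<bar>) / \<epsilon> n"
        by (rule prob_ge_le_expectation[OF fin _ pos]) simp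
      also have "\<dots> \<le> (\<epsilon> n)\<^sup>2 / \<epsilon> n"
      proof (rule divide_right_mono)
        have "(\<epsilon> n)\<^sup>2 = \<bar>\<delta> n\<bar> + inverse (real (Suc n))" by (simp add: \<epsilon>_def)
        moreover have "0 \<le> inverse (real (Suc n))" by simp
        ultimately show "measure_pmf.expectation (Z n) (\<lambda>z. \<bar>a z / b n - 1\<bar>) \<le> (\<epsilon> n)\<^sup>2"
          using elim by linarith
        show "0 \<le> \<epsilon> n" using pos[of n] by simp
      qed
      also have "\<dots> = \<epsilon> n" using pos[of n] by (simp add: power2_eq_square)
      finally show ?case by (simp add: not_less)
    qed
  qed
  then show ?thesis unfolding aas_sim_def using \<epsilon> by blast
qed

lemma aas_le_if_expectation:
  fixes f :: "nat \<Rightarrow> 'a \<Rightarrow> real"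
  assumes fin: "\<And>n. finite (set_pmf (Z n))" and nn: "\<And>n z. 0 \<le> f n z"
    and bound: "\<forall>\<^sub>F n in sequentially. measure_pmf.expectation (Z n) (f n) \<le> b n"
    and t: "\<forall>\<^sub>F n in sequentially. 0 < t n" and lim: "(\<lambda>n. b n / t n) \<longlonglongrightarrow> 0"
  shows "aas Z (\<lambda>n z. f n z < t n)"
proof (rule aas_bound[OF _ lim])
  show "\<forall>\<^sub>F n in sequentially. prob (Z n) (\<lambda>z. \<not> f n z < t n) \<le> b n / t n"
    using bound t
  proof eventually_elim
    case (elim n)
    have "prob (Z n) (\<lambda>z. t n \<le> f n z) \<le> measure_pmf.expectation (Z n) (f n) / t n"
      using fin nn elim(2) by (rule prob_ge_le_expectation)
    also have "\<dots> \<le> b n / t n" using elim by (intro divide_right_mono) auto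
    finally show ?case by (simp add: not_less)
  qed
qed

section \<open>Second moments of weighted sums over a random subset\<close>

context
  fixes A :: "'a set" and p :: "'a \<Rightarrow> real" and w :: "'a \<Rightarrow> real"
  assumes A: "finite A" and p: "\<And>x. x \<in> A \<Longrightarrow> 0 \<le> p x \<and> p x \<le> 1"
begin

lemma integrable_random_subset: "integrable (measure_pmf (random_subset A p)) (f :: _ \<Rightarrow> real)"
  using finite_set_random_subset[OF A] by (rule integrable_measure_pmf_finite)

lemma sum_random_subset_eq: "X \<in> set_pmf (random_subset A p) \<Longrightarrow> (\<Sum>x\<in>X. w x) = (\<Sum>x\<in>A. w x * indicator {X. x \<in> X} X)"
  using set_random_subset[OF A] A
  by (simp add: indicator_def sum.inter_restrict[symmetric] Int_absorb1 if_distrib[of "(*) _"] cong: if_cong)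

lemma expectation_sum_random_subset:
  "measure_pmf.expectation (random_subset A p) (\<lambda>X. \<Sum>x\<in>X. w x) = (\<Sum>x\<in>A. w x * p x)"
proof -
  have "measure_pmf.expectation (random_subset A p) (\<lambda>X. \<Sum>x\<in>X. w x) =
      measure_pmf.expectation (random_subset A p) (\<lambda>X. \<Sum>x\<in>A. w x * indicator {X. x \<in> X} X)"
    using sum_random_subset_eq by (intro integral_cong_AE) (auto simp: AE_measure_pmf_iff)
  also have "\<dots> = (\<Sum>x\<in>A. w x * prob (random_subset A p) (\<lambda>X. x \<in> X))"
    by (subst Bochner_Integration.integral_sum) (simp_all add: integrable_random_subset)
  also have "\<dots> = (\<Sum>x\<in>A. w x * p x)"
    using A p by (intro sum.cong) (simp_all add: prob_mem_random_subset)
  finally show ?thesis .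
qed

text \<open>Independence removes the off-diagonal covariances; on the diagonal, the variance of an
  indicator is at most its mean.\<close>

lemma variance_sum_random_subset_le:
  "measure_pmf.variance (random_subset A p) (\<lambda>X. \<Sum>x\<in>X. w x) \<le> (\<Sum>x\<in>A. (w x)\<^sup>2 * p x)"
proof -
  let ?E = "measure_pmf.expectation (random_subset A p)"
  have "?E (\<lambda>X. (\<Sum>x\<in>X. w x)\<^sup>2) = ?E (\<lambda>X. \<Sum>x\<in>A. \<Sum>y\<in>A. w x * w y * indicator {X. x \<in> X \<and> y \<in> X} X)"
  proof (intro integral_cong_AE)
    show "AE X in measure_pmf (random_subset A p). (\<Sum>x\<in>X. w x)\<^sup>2 =
        (\<Sum>x\<in>A. \<Sum>y\<in>A. w x * w y * indicator {X. x \<in> X \<and> y \<in> X} X)"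
    proof (rule AE_pmfI)
      fix X assume "X \<in> set_pmf (random_subset A p)"
      then have "(\<Sum>x\<in>X. w x)\<^sup>2 = (\<Sum>x\<in>A. w x * indicator {X. x \<in> X} X)\<^sup>2"
        by (simp only: sum_random_subset_eq)
      then show "(\<Sum>x\<in>X. w x)\<^sup>2 = (\<Sum>x\<in>A. \<Sum>y\<in>A. w x * w y * indicator {X. x \<in> X \<and> y \<in> X} X)"
        by (auto simp: power2_eq_square sum_product indicator_def intro!: sum.cong)
    qed
  qed simp_all
  also have "\<dots> = (\<Sum>x\<in>A. \<Sum>y\<in>A. w x * w y * prob (random_subset A p) (\<lambda>X. x \<in> X \<and> y \<in> X))"
    by (subst Bochner_Integration.integral_sum, simp add: integrable_random_subset,
        subst Bochner_Integration.integral_sum) (simp_all add: integrable_random_subset)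
  also have "\<dots> = (\<Sum>x\<in>A. \<Sum>y\<in>A. w x * w y * (p x * p y) + (if x = y then (w x)\<^sup>2 * (p x - (p x)\<^sup>2) else 0))"
    using A p by (intro sum.cong refl)
      (auto simp: prob_mem_random_subset prob_mem2_random_subset power2_eq_square algebra_simps)
  also have "\<dots> = (\<Sum>x\<in>A. w x * p x)\<^sup>2 + (\<Sum>x\<in>A. (w x)\<^sup>2 * (p x - (p x)\<^sup>2))"
    using A by (simp add: sum.distrib power2_eq_square sum_product mult_ac)
  finally have "?E (\<lambda>X. (\<Sum>x\<in>X. w x)\<^sup>2) - (\<Sum>x\<in>A. w x * p x)\<^sup>2 = (\<Sum>x\<in>A. (w x)\<^sup>2 * (p x - (p x)\<^sup>2))"
    by simp
  also have "\<dots> \<le> (\<Sum>x\<in>A. (w x)\<^sup>2 * p x)"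
    by (intro sum_mono mult_left_mono) simp_all
  finally show ?thesis
    by (subst measure_pmf.variance_eq) (simp_all add: integrable_random_subset expectation_sum_random_subset)
qed

lemma expectation_abs_deviation_le:
  "measure_pmf.expectation (random_subset A p) (\<lambda>X. \<bar>(\<Sum>x\<in>X. w x) - (\<Sum>x\<in>A. w x * p x)\<bar>) \<le>
    sqrt (\<Sum>x\<in>A. (w x)\<^sup>2 * p x)"
proof (rule real_le_rsqrt)
  let ?E = "measure_pmf.expectation (random_subset A p)" and ?\<mu> = "\<Sum>x\<in>A. w x * p x"
  let ?f = "\<lambda>X. \<bar>(\<Sum>x\<in>X. w x) - ?\<mu>\<bar>"
  \<comment> \<open>Non-negativity of the variance of the absolute deviation bounds its squared mean
    by the second moment, which is the variance of the sum.\<close>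
  have "0 \<le> measure_pmf.variance (random_subset A p) ?f" by (rule measure_pmf.variance_positive)
  also have "\<dots> = ?E (\<lambda>X. (?f X)\<^sup>2) - (?E ?f)\<^sup>2"
    by (rule measure_pmf.variance_eq) (simp_all add: integrable_random_subset)
  finally have "(?E ?f)\<^sup>2 \<le> ?E (\<lambda>X. (?f X)\<^sup>2)" by simp
  also have "\<dots> \<le> (\<Sum>x\<in>A. (w x)\<^sup>2 * p x)"
    using variance_sum_random_subset_le by (simp add: expectation_sum_random_subset)
  finally show "(?E ?f)\<^sup>2 \<le> (\<Sum>x\<in>A. (w x)\<^sup>2 * p x)" .
qed

end

section \<open>Expectations in the upper model\<close>

definition simplices :: "nat \<Rightarrow> nat \<Rightarrow> nat set set" where
  "simplices r n = {\<sigma>. \<sigma> \<noteq> {} \<and> \<sigma> \<subseteq> {0..n} \<and> dimension \<sigma> \<le> int r}"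

definition simplex_prob :: "(nat \<Rightarrow> ereal) \<Rightarrow> nat \<Rightarrow> nat set \<Rightarrow> real" where
  "simplex_prob \<alpha> n \<sigma> = inclusion_prob n (\<alpha> (nat (dimension \<sigma>)))"

lemma random_hypergraph_eq: "random_hypergraph r \<alpha> n = random_subset (simplices r n) (simplex_prob \<alpha> n)"
  by (simp add: random_hypergraph_def random_subset_def simplices_def simplex_prob_def[abs_def])

lemma simplicesD:
  assumes "\<sigma> \<in> simplices r n"
  shows "finite \<sigma>" "\<sigma> \<noteq> {}" "\<sigma> \<subseteq> {0..n}" "card \<sigma> \<le> Suc r" "0 < card \<sigma>"
proof -
  show 1: "\<sigma> \<noteq> {}" "\<sigma> \<subseteq> {0..n}" using assms by (auto simp: simplices_def)
  then show 2: "finite \<sigma>" using finite_subset by blast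
  show "card \<sigma> \<le> Suc r" using assms by (simp add: simplices_def dimension_def)
  show "0 < card \<sigma>" using 1(1) 2 by (simp add: card_gt_0_iff)
qed

lemma finite_simplices: "finite (simplices r n)"
  by (rule finite_subset[of _ "Pow {0..n}"]) (auto simp: simplices_def)

lemma simplex_prob_eq: "card \<sigma> = Suc i \<Longrightarrow> simplex_prob \<alpha> n \<sigma> = inclusion_prob n (\<alpha> i)"
  by (simp add: simplex_prob_def dimension_def)

lemma inclusion_prob_bounds:
  assumes "0 \<le> a"
  shows "0 \<le> inclusion_prob n a" "inclusion_prob n a \<le> 1"
proof -
  show "0 \<le> inclusion_prob n a" by (simp add: inclusion_prob_def)
  have "real n powr - real_of_ereal a \<le> 1"
  proof (cases "n = 0")
    case False
    then have "real n powr - real_of_ereal a \<le> real n powr 0"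
      using assms by (intro powr_mono) (auto simp: real_of_ereal_pos)
    then show ?thesis using False by simp
  qed simp
  then show "inclusion_prob n a \<le> 1" by (simp add: inclusion_prob_def)
qed

text \<open>The probability is n to the power \<beta>_i - (i + 1), or 0 if \<alpha>_i is infinite.
  Working with a real upper bound \<open>g\<close> avoids separate treatment of \<beta>_i =
  -\<infinity>.\<close>

lemma inclusion_prob_le:
  assumes "1 \<le> n" "0 \<le> \<alpha> i" "beta_at \<alpha> i \<le> ereal g"
  shows "inclusion_prob n (\<alpha> i) \<le> real n powr (g - real (Suc i))"
proof (cases "\<alpha> i")
  case (real x)
  then show ?thesis
    using assms by (auto simp: inclusion_prob_def beta_at_def intro!: powr_mono)
qed (use assms in \<open>auto simp: inclusion_prob_def\<close>)

lemma binomial_le_power: "n choose k \<le> n ^ k"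
  by (cases "k \<le> n") (simp_all add: binomial_le_pow binomial_eq_0)

lemma sum_UN_le:
  fixes f :: "'a \<Rightarrow> real"
  assumes "finite I" "\<And>i. i \<in> I \<Longrightarrow> finite (B i)" "\<And>x. 0 \<le> f x"
  shows "sum f (\<Union>i\<in>I. B i) \<le> (\<Sum>i\<in>I. sum f (B i))"
  using assms(1,2)
proof (induction I rule: finite_induct)
  case (insert i I)
  have "sum f (B i \<union> (\<Union>i\<in>I. B i)) + sum f (B i \<inter> (\<Union>i\<in>I. B i)) = sum f (B i) + sum f (\<Union>i\<in>I. B i)"
    using insert by (intro sum.union_inter) auto
  moreover have "0 \<le> sum f (B i \<inter> (\<Union>i\<in>I. B i))" using assms(3) by (intro sum_nonneg)
  moreover have "sum f (\<Union>i\<in>I. B i) \<le> (\<Sum>i\<in>I. sum f (B i))" using insert by simp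
  ultimately show ?case using insert.hyps by simp
qed simp

lemma card_supersets_le:
  assumes \<kappa>: "card \<kappa> = s" "finite \<kappa>" and V: "finite V"
  shows "card {\<sigma>. \<kappa> \<subseteq> \<sigma> \<and> \<sigma> \<subseteq> V \<and> card \<sigma> = t} \<le> card V ^ (t - s)"
proof -
  let ?S = "{\<sigma>. \<kappa> \<subseteq> \<sigma> \<and> \<sigma> \<subseteq> V \<and> card \<sigma> = t}" and ?T = "{\<tau>. \<tau> \<subseteq> V \<and> card \<tau> = t - s}"
  have "inj_on (\<lambda>\<sigma>. \<sigma> - \<kappa>) ?S" by (intro inj_onI) blast
  moreover have "(\<lambda>\<sigma>. \<sigma> - \<kappa>) ` ?S \<subseteq> ?T"
    using \<kappa> by (auto simp: card_Diff_subset)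
  moreover have "finite ?T" using V by simp
  ultimately have "card ?S \<le> card ?T" by (rule card_inj_on_le)
  also have "\<dots> = card V choose (t - s)" by (rule n_subsets[OF V])
  also have "\<dots> \<le> card V ^ (t - s)" by (rule binomial_le_power)
  finally show ?thesis .
qed

lemma obtain_disjoint_subsets:
  assumes V: "finite V" "J * w \<le> card V"
  obtains W where "\<And>j. j < J \<Longrightarrow> W j \<subseteq> V" "\<And>j. j < J \<Longrightarrow> card (W j) = w"
    "\<And>i j. i < J \<Longrightarrow> j < J \<Longrightarrow> i \<noteq> j \<Longrightarrow> W i \<inter> W j = {}"
proof -
  obtain h where h: "bij_betw h {0..<card V} V" using ex_bij_betw_nat_finite[OF V(1)] by blast
  define W where "W j = h ` {j * w..<Suc j * w}" for j
  have sub: "{j * w..<Suc j * w} \<subseteq> {0..<card V}" if "j < J" for j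
  proof -
    have "Suc j * w \<le> J * w" using that by (intro mult_le_mono1) simp
    then show ?thesis using V(2) by auto
  qed
  have inj: "inj_on h {0..<card V}" using h by (rule bij_betw_imp_inj_on)
  show thesis
  proof (rule that[of W])
    fix j assume j: "j < J"
    show "W j \<subseteq> V" unfolding W_def using sub[OF j] h by (metis bij_betw_imp_surj_on image_mono)
    show "card (W j) = w" unfolding W_def using card_image[OF inj_on_subset[OF inj sub[OF j]]] by simp
    fix i assume i: "i < J" "i \<noteq> j"
    have "{i * w..<Suc i * w} \<inter> {j * w..<Suc j * w} = {}"
    proof (rule ccontr)
      assume "{i * w..<Suc i * w} \<inter> {j * w..<Suc j * w} \<noteq> {}"
      then obtain x where "x \<in> {i * w..<Suc i * w}" "x \<in> {j * w..<Suc j * w}" by blast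
      then have "i * w < Suc j * w" "j * w < Suc i * w" unfolding atLeastLessThan_iff by linarith+
      then have "i < Suc j" "j < Suc i" using mult_less_cancel2 by blast+
      then show False using i(2) by simp
    qed
    then show "W i \<inter> W j = {}"
      unfolding W_def using inj_on_image_Int[OF inj sub[OF i(1)] sub[OF j]] by (metis image_empty)
  qed
qed

lemma random_subset_cong:
  assumes "finite A" "\<And>x. x \<in> A \<Longrightarrow> p x = q x"
  shows "random_subset A p = random_subset A q"
  unfolding random_subset_def using assms by (simp cong: Pi_pmf_cong)

context
  fixes r :: nat and \<alpha> :: "nat \<Rightarrow> ereal"
  assumes \<alpha>: "\<And>i. i \<le> r \<Longrightarrow> 0 \<le> \<alpha> i"
begin

abbreviation "HG n \<equiv> random_subset (simplices r n) (simplex_prob \<alpha> n)"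

lemma simplex_prob_bounds:
  assumes "\<sigma> \<in> simplices r n"
  shows "0 \<le> simplex_prob \<alpha> n \<sigma> \<and> simplex_prob \<alpha> n \<sigma> \<le> 1"
proof -
  have "nat (dimension \<sigma>) \<le> r"
    using assms nat_mono[of "dimension \<sigma>" "int r"] by (simp add: simplices_def)
  then show ?thesis unfolding simplex_prob_def using inclusion_prob_bounds[OF \<alpha>] by blast
qed

text \<open>At most \<open>(2 * n) ^ (t - s)\<close> sets of size \<open>t\<close> contain \<kappa>,
  each of probability at most n to the power g - t. The product has order n to the power g - s for
  every \<open>t\<close>, and at most \<open>Suc r\<close> sizes occur.\<close>

lemma sum_prob_supersets_le:
  assumes n: "1 \<le> n" and \<kappa>: "card \<kappa> = s" "finite \<kappa>" and m: "s \<le> m" "1 \<le> m"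
    and g: "\<And>i. i \<le> r \<Longrightarrow> m \<le> Suc i \<Longrightarrow> beta_at \<alpha> i \<le> ereal g"
  shows "(\<Sum>\<sigma>\<in>{\<sigma>\<in>simplices r n. \<kappa> \<subseteq> \<sigma> \<and> m \<le> card \<sigma>}. simplex_prob \<alpha> n \<sigma>) \<le>
    real (Suc r) * 2 ^ Suc r * real n powr (g - real s)"
proof -
  let ?S = "{\<sigma>\<in>simplices r n. \<kappa> \<subseteq> \<sigma> \<and> m \<le> card \<sigma>}" and ?T = "{m..Suc r}"
  have "(\<Sum>\<sigma>\<in>?S. simplex_prob \<alpha> n \<sigma>) = (\<Sum>t\<in>?T. \<Sum>\<sigma>\<in>{\<sigma>\<in>?S. card \<sigma> = t}. simplex_prob \<alpha> n \<sigma>)"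
    using finite_simplices[of r n] simplicesD(4) by (intro sum.group[symmetric]) auto
  also have "\<dots> \<le> (\<Sum>t\<in>?T. 2 ^ Suc r * real n powr (g - real s))"
  proof (rule sum_mono)
    fix t assume t: "t \<in> ?T"
    then have t': "s \<le> t" "1 \<le> t" "t \<le> Suc r" "m \<le> t" using m by auto
    define i where "i = t - 1"
    have i: "t = Suc i" "i \<le> r" using t' by (simp_all add: i_def)
    let ?St = "{\<sigma>\<in>?S. card \<sigma> = t}"
    have "(\<Sum>\<sigma>\<in>?St. simplex_prob \<alpha> n \<sigma>) = real (card ?St) * inclusion_prob n (\<alpha> i)"
      using i(1) by (simp add: simplex_prob_eq)
    also have "\<dots> \<le> real ((2 * n) ^ (t - s)) * real n powr (g - real t)"
    proof (rule mult_mono)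
      have "card ?St \<le> card {\<sigma>. \<kappa> \<subseteq> \<sigma> \<and> \<sigma> \<subseteq> {0..n} \<and> card \<sigma> = t}"
        using simplicesD(3) by (intro card_mono) auto
      also have "\<dots> \<le> card {0..n} ^ (t - s)" by (rule card_supersets_le[OF \<kappa>]) simp
      also have "\<dots> \<le> (2 * n) ^ (t - s)" using n by (intro power_mono) auto
      finally show "real (card ?St) \<le> real ((2 * n) ^ (t - s))" by (rule of_nat_mono)
      show "inclusion_prob n (\<alpha> i) \<le> real n powr (g - real t)"
        using inclusion_prob_le[OF n \<alpha>[OF i(2)] g[OF i(2)]] t' i(1) by simp
      show "0 \<le> inclusion_prob n (\<alpha> i)" by (rule inclusion_prob_bounds(1)[OF \<alpha>[OF i(2)]])
    qed simp
    also have "\<dots> = 2 ^ (t - s) * (real n powr real (t - s) * real n powr (g - real t))"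
      using n by (simp add: power_mult_distrib powr_realpow)
    also have "\<dots> = 2 ^ (t - s) * real n powr (g - real s)"
      using t' by (simp add: powr_add[symmetric] of_nat_diff)
    also have "\<dots> \<le> 2 ^ Suc r * real n powr (g - real s)"
      using t' by (intro mult_right_mono power_increasing) auto
    finally show "(\<Sum>\<sigma>\<in>?St. simplex_prob \<alpha> n \<sigma>) \<le> 2 ^ Suc r * real n powr (g - real s)" .
  qed
  also have "\<dots> = real (card ?T) * (2 ^ Suc r * real n powr (g - real s))" by simp
  also have "\<dots> \<le> real (Suc r) * (2 ^ Suc r * real n powr (g - real s))"
    using m by (intro mult_right_mono) auto
  finally show ?thesis by (simp add: mult.assoc)
qed

text \<open>An overlapping pair contains a common \<kappa> with exactly \<open>s\<close> vertices.
  Summing over \<kappa> gives about n^s times the square of the bound for supersets of \<kappa>. For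
  \<open>s = k\<close> and \<open>g\<close> equal to \<gamma>_k the exponent is \<nu>_k.\<close>

lemma expectation_overlaps_le:
  assumes n: "1 \<le> n" and m: "s \<le> m" "1 \<le> m"
    and g: "\<And>i. i \<le> r \<Longrightarrow> m \<le> Suc i \<Longrightarrow> beta_at \<alpha> i \<le> ereal g"
  shows "measure_pmf.expectation (HG n) (\<lambda>X. real (card (overlaps m s X))) \<le>
    2 ^ s * (real (Suc r) * 2 ^ Suc r)\<^sup>2 * real n powr (2 * g - real s)"
proof -
  let ?A = "simplices r n" and ?p = "simplex_prob \<alpha> n" and ?D = "real (Suc r) * 2 ^ Suc r"
  note A = finite_simplices[of r n]
  \<comment> \<open>The absolute value makes the weight non-negative on all pairs, as the union
    bound for sums requires; on pairs of simplices it changes nothing.\<close>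
  let ?P = "overlaps m s ?A" and ?f = "\<lambda>q. \<bar>?p (fst q) * ?p (snd q)\<bar>"
  let ?K = "{\<kappa>. \<kappa> \<subseteq> {0..n} \<and> card \<kappa> = s}"
  let ?S = "\<lambda>\<kappa>. {\<sigma>\<in>?A. \<kappa> \<subseteq> \<sigma> \<and> m \<le> card \<sigma>}"
  have finP: "finite ?P" using A by (rule finite_overlaps)
  have p: "0 \<le> ?p \<sigma>" if "\<sigma> \<in> ?A" for \<sigma> using simplex_prob_bounds[OF that] by simp
  have "measure_pmf.expectation (HG n) (\<lambda>X. real (card (overlaps m s X))) =
      measure_pmf.expectation (HG n) (\<lambda>X. real (card {q\<in>?P. fst q \<in> X \<and> snd q \<in> X}))"
  proof (intro integral_cong_AE AE_pmfI)
    fix X assume "X \<in> set_pmf (HG n)"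
    then have "X \<subseteq> ?A" by (rule set_random_subset[OF A])
    then have "overlaps m s X = {q\<in>?P. fst q \<in> X \<and> snd q \<in> X}" by (auto simp: overlaps_def)
    then show "real (card (overlaps m s X)) = real (card {q\<in>?P. fst q \<in> X \<and> snd q \<in> X})" by simp
  qed simp_all
  also have "\<dots> = (\<Sum>q\<in>?P. prob (HG n) (\<lambda>X. fst q \<in> X \<and> snd q \<in> X))"
    by (rule sum_prob_eq_expectation_card[OF finP finite_set_random_subset[OF A], symmetric])
  also have "\<dots> = sum ?f ?P"
  proof (rule sum.cong[OF refl])
    fix q assume "q \<in> ?P"
    then have "fst q \<in> ?A" "snd q \<in> ?A" "fst q \<noteq> snd q" by (auto simp: overlaps_def)
    then show "prob (HG n) (\<lambda>X. fst q \<in> X \<and> snd q \<in> X) = ?f q"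
      using prob_mem2_random_subset[OF A, of "fst q" "snd q" ?p] simplex_prob_bounds p by simp
  qed
  also have "\<dots> \<le> sum ?f (\<Union>\<kappa>\<in>?K. ?S \<kappa> \<times> ?S \<kappa>)"
  proof (rule sum_mono2)
    show "finite (\<Union>\<kappa>\<in>?K. ?S \<kappa> \<times> ?S \<kappa>)" using A by auto
    show "?P \<subseteq> (\<Union>\<kappa>\<in>?K. ?S \<kappa> \<times> ?S \<kappa>)"
    proof
      fix q assume q: "q \<in> ?P"
      obtain \<sigma> \<sigma>' where q_eq: "q = (\<sigma>, \<sigma>')" by (cases q)
      have \<sigma>: "\<sigma> \<in> ?A" "\<sigma>' \<in> ?A" "m \<le> card \<sigma>" "m \<le> card \<sigma>'" "s \<le> card (\<sigma> \<inter> \<sigma>')"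
        using q unfolding q_eq by (simp_all add: overlaps_def)
      obtain \<kappa> where \<kappa>: "\<kappa> \<subseteq> \<sigma> \<inter> \<sigma>'" "card \<kappa> = s" using \<sigma>(5) by (rule obtain_subset_with_card_n)
      have "\<kappa> \<in> ?K" using \<kappa> simplicesD(3)[OF \<sigma>(1)] by auto
      moreover have "q \<in> ?S \<kappa> \<times> ?S \<kappa>" using \<sigma> \<kappa>(1) unfolding q_eq by auto
      ultimately show "q \<in> (\<Union>\<kappa>\<in>?K. ?S \<kappa> \<times> ?S \<kappa>)" by blast
    qed
  qed simp
  also have "\<dots> \<le> (\<Sum>\<kappa>\<in>?K. sum ?f (?S \<kappa> \<times> ?S \<kappa>))"
    using A by (intro sum_UN_le) auto
  also have "\<dots> \<le> (\<Sum>\<kappa>\<in>?K. (?D * real n powr (g - real s))\<^sup>2)"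
  proof (rule sum_mono)
    fix \<kappa> assume \<kappa>: "\<kappa> \<in> ?K"
    then have fin: "finite \<kappa>" using finite_subset[of \<kappa> "{0..n}"] by simp
    have "sum ?f (?S \<kappa> \<times> ?S \<kappa>) = (\<Sum>\<sigma>\<in>?S \<kappa>. \<Sum>\<sigma>'\<in>?S \<kappa>. \<bar>?p \<sigma> * ?p \<sigma>'\<bar>)"
      by (simp add: sum.cartesian_product case_prod_unfold)
    also have "\<dots> = (\<Sum>\<sigma>\<in>?S \<kappa>. \<Sum>\<sigma>'\<in>?S \<kappa>. ?p \<sigma> * ?p \<sigma>')"
      using p by (intro sum.cong refl) simp
    also have "\<dots> = (\<Sum>\<sigma>\<in>?S \<kappa>. ?p \<sigma>)\<^sup>2" by (simp only: power2_eq_square sum_product)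
    also have "\<dots> \<le> (?D * real n powr (g - real s))\<^sup>2"
      using sum_prob_supersets_le[OF n _ fin m g] \<kappa> p by (intro power_mono sum_nonneg) auto
    finally show "sum ?f (?S \<kappa> \<times> ?S \<kappa>) \<le> (?D * real n powr (g - real s))\<^sup>2" .
  qed
  also have "\<dots> = real (card ?K) * (?D * real n powr (g - real s))\<^sup>2" by simp
  also have "\<dots> \<le> (2 * real n) ^ s * (?D * real n powr (g - real s))\<^sup>2"
  proof (rule mult_right_mono)
    have "card ?K = Suc n choose s" using n_subsets[of "{0..n}" s] by simp
    also have "\<dots> \<le> Suc n ^ s" by (rule binomial_le_power)
    also have "\<dots> \<le> (2 * n) ^ s" using n by (intro power_mono) auto
    finally have "real (card ?K) \<le> real ((2 * n) ^ s)" by (rule of_nat_mono)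
    then show "real (card ?K) \<le> (2 * real n) ^ s" by simp
  qed simp
  also have "\<dots> = 2 ^ s * ?D\<^sup>2 * (real n powr real s * (real n powr (g - real s) * real n powr (g - real s)))"
    using n by (simp add: power_mult_distrib powr_realpow power2_eq_square mult_ac)
  also have "\<dots> = 2 ^ s * ?D\<^sup>2 * real n powr (2 * g - real s)"
    by (simp add: powr_add[symmetric] algebra_simps)
  finally show ?thesis .
qed

section \<open>Filling the boundaries of all \<open>l\<close>-faces\<close>

context
  fixes i l :: nat and a b :: real
  assumes i: "i \<le> r" "\<alpha> i = ereal a" and b: "b = real i + 1 - a" "real l < b" and li: "l \<le> i"
begin

text \<open>\<open>J\<close> vertex blocks meeting only in \<rho> give \<open>J\<close> independent
  attempts. If the boundary of \<rho> is not filled, then in every block a fixed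
  \<open>i\<close>-simplex \<tau> through \<rho> is fresh relative to the other
  \<open>i\<close>-simplices of that block, and each such event is unlikely by the symmetry
  bound.\<close>

lemma prob_not_filled_le:
  assumes J: "0 < J" and n: "1 \<le> n" "J * Suc i \<le> n" and \<rho>: "\<rho> \<subseteq> {0..n}" "card \<rho> = Suc l"
  shows "prob (HG n) (\<lambda>X. bd (frag_of \<rho>) \<notin> boundary_span (sub_faces (Suc l) X)) \<le>
    ((2 * real n) ^ l * (real (i + 3) * log 2 (2 * real n)) * (real J * real (Suc i)) ^ Suc i / real n powr b) ^ J"
    (is "_ \<le> ?h ^ J")
proof -
  let ?A = "simplices r n" and ?c = "inclusion_prob n (\<alpha> i)" and ?s = "Suc i"
  note A = finite_simplices[of r n]
  have fin\<rho>: "finite \<rho>" using \<rho>(1) finite_subset by blast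
  define w where "w = (n - l) div J"
  have ln: "l < n" using n(2) li J by (metis Suc_le_eq le_less_trans le_trans less_le_trans lessI mult_le_mono1 nat_mult_1 One_nat_def)
  have "card ({0..n} - \<rho>) = n - l" using \<rho> fin\<rho> by (simp add: card_Diff_subset)
  then have "J * w \<le> card ({0..n} - \<rho>)" by (simp add: w_def)
  then obtain W where W: "\<And>j. j < J \<Longrightarrow> W j \<subseteq> {0..n} - \<rho>" "\<And>j. j < J \<Longrightarrow> card (W j) = w"
    "\<And>i j. i < J \<Longrightarrow> j < J \<Longrightarrow> i \<noteq> j \<Longrightarrow> W i \<inter> W j = {}"
    using obtain_disjoint_subsets[of "{0..n} - \<rho>" J w] by blast
  define U where "U j = \<rho> \<union> W j" for j
  define u where "u = Suc l + w"
  have U: "U j \<subseteq> {0..n}" "finite (U j)" "card (U j) = u" "\<rho> \<subseteq> U j" if j: "j < J" for j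
  proof -
    show 1: "U j \<subseteq> {0..n}" using W(1)[OF j] \<rho>(1) by (auto simp: U_def)
    then show "finite (U j)" using finite_subset by blast
    have "\<rho> \<inter> W j = {}" using W(1)[OF j] by blast
    moreover have "finite (W j)" using W(1)[OF j] finite_subset by blast
    ultimately show "card (U j) = u" using fin\<rho> W(2)[OF j] \<rho>(2) by (simp add: U_def u_def card_Un_disjoint)
    show "\<rho> \<subseteq> U j" by (simp add: U_def)
  qed
  have u_le: "u \<le> 2 * n" using U(1,3)[OF J] card_mono[of "{0..n}" "U 0"] n(1) by simp
  have u_ge: "n \<le> J * u"
  proof -
    have "n - l < J * Suc w"
      unfolding w_def using J by (metis dividend_less_times_div mult_Suc_right)
    then have "n < J * Suc w + l" using ln by linarith
    also have "\<dots> \<le> J * Suc w + J * l" using J by simp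
    also have "\<dots> = J * u" by (simp add: u_def algebra_simps)
    finally show ?thesis by simp
  qed
  have su: "?s \<le> u"
  proof -
    have "J * ?s \<le> J * u" using n(2) u_ge by linarith
    then show ?thesis using J by (simp only: mult_le_cancel1)
  qed
  have "\<exists>\<sigma>. \<rho> \<subseteq> \<sigma> \<and> \<sigma> \<subseteq> U j \<and> card \<sigma> = ?s" if j: "j < J" for j
    using exists_subset_between[of \<rho> ?s "U j"] U[OF j] \<rho>(2) li su by auto
  then obtain \<tau> where \<tau>: "\<And>j. j < J \<Longrightarrow> \<rho> \<subseteq> \<tau> j" "\<And>j. j < J \<Longrightarrow> \<tau> j \<subseteq> U j" "\<And>j. j < J \<Longrightarrow> card (\<tau> j) = ?s"
    by metis
  define A' where "A' j = {\<sigma>. \<sigma> \<subseteq> U j \<and> card \<sigma> = ?s}" for j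
  \<comment> \<open>Removing \<tau> matches the form of the freshness bound. It also removes the
    only simplex that two blocks could share, namely \<rho> itself in the case \<open>i = l\<close>,
    so that the attempts are independent.\<close>
  define B where "B j = A' j - {\<tau> j}" for j
  have B_sub: "B j \<subseteq> ?A" if j: "j < J" for j
    using U(1)[OF j] i(1) by (auto simp: B_def A'_def simplices_def dimension_def)
  have B_disj: "B j \<inter> B k = {}" if jk: "j < J" "k < J" "j \<noteq> k" for j k
  proof (rule ccontr)
    assume "B j \<inter> B k \<noteq> {}"
    then obtain \<sigma> where \<sigma>: "\<sigma> \<subseteq> U j" "\<sigma> \<subseteq> U k" "card \<sigma> = ?s" "\<sigma> \<noteq> \<tau> j"
      by (auto simp: B_def A'_def)
    have "\<sigma> \<subseteq> \<rho>" using \<sigma>(1,2) W(3)[OF jk] by (auto simp: U_def)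
    moreover have "card \<rho> \<le> card \<sigma>" using \<sigma>(3) \<rho>(2) li by simp
    ultimately have "\<sigma> = \<rho>" using fin\<rho> by (intro card_seteq)
    moreover have "\<rho> = \<tau> j"
    proof (rule card_seteq)
      show "finite (\<tau> j)" using \<tau>(2)[OF jk(1)] U(2)[OF jk(1)] finite_subset by blast
      show "\<rho> \<subseteq> \<tau> j" by (rule \<tau>(1)[OF jk(1)])
      show "card (\<tau> j) \<le> card \<rho>" using \<tau>(3)[OF jk(1)] \<sigma>(3) \<open>\<sigma> = \<rho>\<close> by simp
    qed
    ultimately show False using \<sigma>(4) by simp
  qed
  have c: "?c = real n powr - a" using i(2) by (simp add: inclusion_prob_def)
  have c_bounds: "0 \<le> ?c" "?c \<le> 1" using inclusion_prob_bounds[OF \<alpha>[OF i(1)]] by blast+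
  have each: "prob (random_subset (B j) (simplex_prob \<alpha> n)) (\<lambda>X. fresh (Suc l) X (\<tau> j)) \<le> ?h" if j: "j < J" for j
  proof -
    define \<pi> where "\<pi> = prob (random_subset (B j) (\<lambda>_. ?c)) (\<lambda>X. fresh (Suc l) X (\<tau> j))"
    have finB: "finite (B j)" using B_sub[OF j] A finite_subset by blast
    have "random_subset (B j) (simplex_prob \<alpha> n) = random_subset (B j) (\<lambda>_. ?c)"
      using finB by (intro random_subset_cong) (auto simp: B_def A'_def simplex_prob_eq)
    then have eq: "prob (random_subset (B j) (simplex_prob \<alpha> n)) (\<lambda>X. fresh (Suc l) X (\<tau> j)) = \<pi>"
      by (simp add: \<pi>_def)
    have "?c * real (u choose ?s) * \<pi> \<le> real (u choose l) * log 2 (2 * real (u choose ?s) + 1)"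
      using prob_fresh_le[OF U(2)[OF j] c_bounds, of "\<tau> j" ?s l] \<tau>(2,3)[OF j] U(3)[OF j]
      by (simp add: \<pi>_def B_def A'_def)
    also have "\<dots> \<le> (2 * real n) ^ l * (real (i + 3) * log 2 (2 * real n))"
    proof (rule mult_mono)
      have "u choose l \<le> (2 * n) ^ l"
        using binomial_le_power[of u l] power_mono[OF u_le, of l] by linarith
      then have "real (u choose l) \<le> real ((2 * n) ^ l)" by (rule of_nat_mono)
      then show "real (u choose l) \<le> (2 * real n) ^ l" by simp
      have "u choose ?s \<le> (2 * n) ^ ?s"
        using binomial_le_power[of u ?s] power_mono[OF u_le, of ?s] by linarith
      then have "real (u choose ?s) \<le> real ((2 * n) ^ ?s)" by (rule of_nat_mono)
      then have "real (u choose ?s) \<le> (2 * real n) ^ ?s" unfolding of_nat_power of_nat_mult of_nat_numeral .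
      moreover have "1 \<le> (2 * real n) ^ ?s" using n(1) by (intro one_le_power) simp
      \<comment> \<open>Since \<open>2 * n\<close> is at least 2, the factor 4 is absorbed by two
        more powers of it; hence the exponent \<open>i + 3\<close>.\<close>
      ultimately have "2 * real (u choose ?s) + 1 \<le> 4 * (2 * real n) ^ ?s" by linarith
      also have "\<dots> \<le> (2 * real n) ^ 2 * (2 * real n) ^ ?s"
        using power_mono[of 2 "2 * real n" 2] n(1) by (intro mult_right_mono) auto
      also have "\<dots> = (2 * real n) ^ (2 + ?s)" by (rule power_add[symmetric])
      also have "2 + ?s = i + 3" by simp
      finally have le: "2 * real (u choose ?s) + 1 \<le> (2 * real n) ^ (i + 3)" .
      have "log 2 (2 * real (u choose ?s) + 1) \<le> log 2 ((2 * real n) ^ (i + 3))"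
        by (rule log_mono[OF _ _ le]) (simp_all add: add_nonneg_pos)
      also have "\<dots> = real (i + 3) * log 2 (2 * real n)" using n(1) by (intro log_nat_power) simp
      finally show "log 2 (2 * real (u choose ?s) + 1) \<le> real (i + 3) * log 2 (2 * real n)" .
      show "0 \<le> log 2 (2 * real (u choose ?s) + 1)" by (rule zero_le_log_cancel_iff[THEN iffD2]) auto
    qed simp
    finally have 1: "?c * real (u choose ?s) * \<pi> \<le> (2 * real n) ^ l * (real (i + 3) * log 2 (2 * real n))" .
    \<comment> \<open>A block retains a fraction of about 1 / J of the vertices, hence still has
      order n^(i+1) simplices of dimension \<open>i\<close>. Multiplied by their probability, this
      yields the denominator \<open>real n powr b\<close>.\<close>
    have "real n / (real J * real ?s) \<le> real u / real ?s"
    proof -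
      have "real n \<le> real J * real u" using of_nat_mono[OF u_ge, where 'a = real] by simp
      then have "real n / real J \<le> real u" using J by (simp add: pos_divide_le_eq mult.commute)
      then have "real n / real J / real ?s \<le> real u / real ?s" by (rule divide_right_mono) simp
      then show ?thesis by (simp only: divide_divide_eq_left)
    qed
    then have "(real n / (real J * real ?s)) ^ ?s \<le> (real u / real ?s) ^ ?s"
      by (intro power_mono) auto
    also have "\<dots> \<le> real (u choose ?s)" using binomial_ge_n_over_k_pow_k[OF su, where 'a = real] by simp
    finally have 2: "(real n / (real J * real ?s)) ^ ?s \<le> real (u choose ?s)" .
    have "real n powr b / (real J * real ?s) ^ ?s = ?c * (real n / (real J * real ?s)) ^ ?s"
    proof -
      have "real n powr b = real n powr - a * real n powr real ?s"
      proof -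
        have "b = - a + real ?s" using b(1) by simp
        then show ?thesis by (simp only: powr_add)
      qed
      also have "real n powr real ?s = real n ^ ?s" using n(1) by (simp only: powr_realpow of_nat_0_less_iff)
      finally show ?thesis unfolding c by (simp only: power_divide times_divide_eq_right)
    qed
    also have "\<dots> \<le> ?c * real (u choose ?s)" using 2 c_bounds(1) by (rule mult_left_mono)
    finally have "real n powr b / (real J * real ?s) ^ ?s * \<pi> \<le> ?c * real (u choose ?s) * \<pi>"
      by (rule mult_right_mono) (simp add: \<pi>_def)
    then have "real n powr b / (real J * real ?s) ^ ?s * \<pi> \<le> (2 * real n) ^ l * (real (i + 3) * log 2 (2 * real n))"
      using 1 by linarith
    moreover have "0 < real n powr b" "0 < (real J * real ?s) ^ ?s" using n(1) J by simp_all
    ultimately have "\<pi> \<le> ?h"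
      by (simp only: pos_le_divide_eq times_divide_eq_left pos_divide_le_eq) (simp only: mult_ac)
    then show ?thesis unfolding eq .
  qed
  have "prob (HG n) (\<lambda>X. bd (frag_of \<rho>) \<notin> boundary_span (sub_faces (Suc l) X)) \<le>
      prob (HG n) (\<lambda>X. \<forall>j\<in>{..<J}. fresh (Suc l) (X \<inter> B j) (\<tau> j))"
  \<comment> \<open>\<rho> itself witnesses freshness in every block: passing to
    \<open>X \<inter> B j\<close> only shrinks the span.\<close>
  proof (rule prob_mono_set_pmf, intro ballI)
    fix X j assume X: "bd (frag_of \<rho>) \<notin> boundary_span (sub_faces (Suc l) X)" and "j \<in> {..<J}"
    then have j: "j < J" by simp
    have "boundary_span (sub_faces (Suc l) (X \<inter> B j)) \<subseteq> boundary_span (sub_faces (Suc l) X)"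
      by (intro boundary_span_mono sub_faces_mono) simp
    then show "fresh (Suc l) (X \<inter> B j) (\<tau> j)"
      unfolding fresh_def using X \<tau>(1)[OF j] \<rho>(2) by blast
  qed
  also have "\<dots> = (\<Prod>j\<in>{..<J}. prob (random_subset (B j) (simplex_prob \<alpha> n)) (\<lambda>X. fresh (Suc l) X (\<tau> j)))"
    by (rule prob_random_subset_disjoint_family[OF _ A]) (use B_sub B_disj in auto)
  also have "\<dots> \<le> (\<Prod>j\<in>{..<J}. ?h)" using each by (intro prod_mono) auto
  finally show ?thesis by simp
qed

lemma aas_filled:
  "aas HG (\<lambda>n X. \<forall>\<rho>. \<rho> \<subseteq> {0..n} \<longrightarrow> card \<rho> = Suc l \<longrightarrow> bd (frag_of \<rho>) \<in> boundary_span (sub_faces (Suc l) X))"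
proof -
  \<comment> \<open>Half of the exponent gap absorbs the logarithm and the constants; the other half
    is the gain per attempt.\<close>
  define \<theta> where "\<theta> = (b - real l) / 2"
  have \<theta>: "0 < \<theta>" using b(2) by (simp add: \<theta>_def)
  \<comment> \<open>Enough attempts to beat the union bound over about n^(l+1) faces \<rho>.\<close>
  obtain J where "(real l + 1) / \<theta> < real J" using reals_Archimedean2 by blast
  then have J: "real l + 1 < \<theta> * real J" using \<theta> by (simp add: field_simps)
  have J0: "0 < J" using J \<theta> by (cases J) auto
  define C where "C = 2 ^ l * real (i + 3) * (real J * real (Suc i)) ^ Suc i"
  let ?h = "\<lambda>n. (2 * real n) ^ l * (real (i + 3) * log 2 (2 * real n)) * (real J * real (Suc i)) ^ Suc i / real n powr b"
  have "(\<lambda>n. log 2 (2 * real n) * real n powr - \<theta>) \<longlonglongrightarrow> 0"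
    using \<theta> by real_asymp
  then have "(\<lambda>n. C * (log 2 (2 * real n) * real n powr - \<theta>)) \<longlonglongrightarrow> C * 0"
    by (intro tendsto_intros)
  then have "\<forall>\<^sub>F n in sequentially. C * (log 2 (2 * real n) * real n powr - \<theta>) < 1"
    by (rule order_tendstoD(2)) simp
  then have h: "\<forall>\<^sub>F n in sequentially. 0 \<le> ?h n \<and> ?h n \<le> real n powr - \<theta>"
    using eventually_ge_at_top[of 1]
  proof eventually_elim
    case (elim n)
    have "?h n = C * (log 2 (2 * real n) * (real n ^ l / real n powr b))"
      by (simp add: C_def power_mult_distrib)
    also have "real n ^ l / real n powr b = real n powr (- \<theta>) * real n powr (- \<theta>)"
    proof -
      have "real n ^ l = real n powr real l" using elim(2) by (simp add: powr_realpow)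
      then show ?thesis by (simp add: powr_diff[symmetric] powr_add[symmetric] \<theta>_def)
    qed
    finally have "?h n = C * (log 2 (2 * real n) * real n powr - \<theta>) * real n powr - \<theta>" by simp
    also have "\<dots> \<le> 1 * real n powr - \<theta>" using elim(1) by (intro mult_right_mono) auto
    finally have "?h n \<le> real n powr - \<theta>" by simp
    moreover have "0 \<le> log 2 (2 * real n)" using elim(2) by (intro zero_le_log_cancel_iff[THEN iffD2]) auto
    ultimately show ?case by simp
  qed
  show ?thesis
  proof (rule aas_bound)
    show "(\<lambda>n. 2 ^ Suc l * real n powr (real l + 1 - \<theta> * real J)) \<longlonglongrightarrow> 0"
    proof -
      have "(\<lambda>n. real n powr (real l + 1 - \<theta> * real J)) \<longlonglongrightarrow> 0"
        using J by (intro tendsto_neg_powr filterlim_real_sequentially) simp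
      then show ?thesis by (rule tendsto_mult_right_zero)
    qed
    show "\<forall>\<^sub>F n in sequentially. prob (HG n) (\<lambda>X. \<not> (\<forall>\<rho>. \<rho> \<subseteq> {0..n} \<longrightarrow> card \<rho> = Suc l \<longrightarrow>
        bd (frag_of \<rho>) \<in> boundary_span (sub_faces (Suc l) X))) \<le> 2 ^ Suc l * real n powr (real l + 1 - \<theta> * real J)"
      using h eventually_ge_at_top[of 1] eventually_ge_at_top[of "J * Suc i"]
    proof eventually_elim
      case (elim n)
      let ?K = "{\<rho>. \<rho> \<subseteq> {0..n} \<and> card \<rho> = Suc l}"
      have "prob (HG n) (\<lambda>X. \<not> (\<forall>\<rho>. \<rho> \<subseteq> {0..n} \<longrightarrow> card \<rho> = Suc l \<longrightarrow>
          bd (frag_of \<rho>) \<in> boundary_span (sub_faces (Suc l) X))) =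
          prob (HG n) (\<lambda>X. \<exists>\<rho>\<in>?K. bd (frag_of \<rho>) \<notin> boundary_span (sub_faces (Suc l) X))"
        by (rule prob_cong_set_pmf) blast
      also have "\<dots> \<le> (\<Sum>\<rho>\<in>?K. prob (HG n) (\<lambda>X. bd (frag_of \<rho>) \<notin> boundary_span (sub_faces (Suc l) X)))"
        by (rule prob_Ex_le_sum) simp
      also have "\<dots> \<le> (\<Sum>\<rho>\<in>?K. ?h n ^ J)"
        using elim(2,3) J0 by (intro sum_mono prob_not_filled_le) auto
      also have "\<dots> = real (card ?K) * ?h n ^ J" by simp
      also have "\<dots> \<le> (2 * real n) ^ Suc l * (real n powr - \<theta>) ^ J"
      proof (rule mult_mono)
        have "card ?K = Suc n choose Suc l" using n_subsets[of "{0..n}" "Suc l"] by simp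
        also have "\<dots> \<le> Suc n ^ Suc l" by (rule binomial_le_power)
        also have "\<dots> \<le> (2 * n) ^ Suc l" using elim(2) by (intro power_mono) auto
        finally have "real (card ?K) \<le> real ((2 * n) ^ Suc l)" by (rule of_nat_mono)
        then show "real (card ?K) \<le> (2 * real n) ^ Suc l" by simp
        show "?h n ^ J \<le> (real n powr - \<theta>) ^ J" using elim(1) by (intro power_mono) auto
        show "0 \<le> ?h n ^ J" using elim(1) by (intro zero_le_power) blast
      qed simp
      also have "\<dots> = 2 ^ Suc l * (real n powr real (Suc l) * real n powr (- \<theta> * real J))"
      proof -
        have "(real n powr - \<theta>) ^ J = real n powr (- \<theta> * real J)"
          using elim(2) by (simp add: powr_power mult.commute)
        moreover have "real n ^ Suc l = real n powr real (Suc l)"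
          using elim(2) by (simp only: powr_realpow of_nat_0_less_iff)
        ultimately show ?thesis by (simp only: power_mult_distrib mult.assoc)
      qed
      also have "\<dots> = 2 ^ Suc l * real n powr (real l + 1 - \<theta> * real J)"
        by (simp add: powr_add[symmetric] algebra_simps)
      finally show ?case .
    qed
  qed
qed

end
end

section \<open>Asymptotics\<close>

text \<open>\<open>Suc n\<close> is the number of vertices in \<open>{0..n}\<close>.\<close>

lemma tendsto_binomial_over_power:
  "(\<lambda>n. real (Suc n choose k) / real n ^ k) \<longlonglongrightarrow> 1 / fact k"
proof -
  have lim: "(\<lambda>n. \<Prod>j=0..<k. ((real n + 1 - real j) / real n) / real (k - j)) \<longlonglongrightarrow> (\<Prod>j=0..<k. 1 / real (k - j))"
  proof (intro tendsto_prod tendsto_divide tendsto_const)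
    fix j assume "j \<in> {0..<k}"
    show "(\<lambda>n. (real n + 1 - real j) / real n) \<longlonglongrightarrow> 1" by real_asymp
    show "real (k - j) \<noteq> 0" using \<open>j \<in> {0..<k}\<close> by simp
  qed
  have prod: "(\<Prod>j=0..<k. 1 / real (k - j)) = 1 / fact k"
    by (simp add: prod_dividef fact_prod_rev)
  have "\<forall>\<^sub>F n in sequentially. (\<Prod>j=0..<k. ((real n + 1 - real j) / real n) / real (k - j)) =
      real (Suc n choose k) / real n ^ k"
    using eventually_ge_at_top[of k]
  proof eventually_elim
    case (elim n)
    then have "real (Suc n choose k) = (\<Prod>j=0..<k. real (Suc n - j) / real (k - j))"
      by (intro binomial_altdef_of_nat) simp
    also have "\<dots> = (\<Prod>j=0..<k. (real n + 1 - real j) / real (k - j))"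
      using elim by (intro prod.cong) (auto simp: of_nat_diff)
    finally have eq: "real (Suc n choose k) = (\<Prod>j=0..<k. (real n + 1 - real j) / real (k - j))" .
    have "(\<Prod>j=0..<k. ((real n + 1 - real j) / real n) / real (k - j)) =
        (\<Prod>j=0..<k. ((real n + 1 - real j) / real (k - j)) / real n)"
      by (rule prod.cong[OF refl]) (simp only: divide_divide_eq_left mult.commute)
    also have "\<dots> = (\<Prod>j=0..<k. (real n + 1 - real j) / real (k - j)) / real n ^ k"
      by (simp only: prod_dividef prod_constant card_atLeastLessThan diff_zero)
    finally show ?case unfolding eq .
  qed
  with lim show ?thesis unfolding prod by (rule Lim_transform_eventually)
qed

lemma set_random_hypergraphD:
  assumes "X \<in> set_pmf (random_subset (simplices r n) p)"
  shows "finite X" "\<And>\<sigma>. \<sigma> \<in> X \<Longrightarrow> finite \<sigma> \<and> \<sigma> \<noteq> {}" "\<And>\<sigma>. \<sigma> \<in> X \<Longrightarrow> card \<sigma> \<le> Suc r"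
    "\<And>\<sigma>. \<sigma> \<in> X \<Longrightarrow> \<sigma> \<noteq> {} \<and> \<sigma> \<subseteq> {0..n}"
proof -
  have X: "X \<subseteq> simplices r n" using set_random_subset[OF finite_simplices assms] .
  then show "finite X" using finite_simplices by (rule finite_subset)
  fix \<sigma> assume "\<sigma> \<in> X"
  then have \<sigma>: "\<sigma> \<in> simplices r n" using X by blast
  show "finite \<sigma> \<and> \<sigma> \<noteq> {}" "card \<sigma> \<le> Suc r" "\<sigma> \<noteq> {} \<and> \<sigma> \<subseteq> {0..n}"
    using simplicesD[OF \<sigma>] by simp_all
qed

context
  fixes r l :: nat and \<alpha> :: "nat \<Rightarrow> ereal" and \<beta> :: real
  assumes \<alpha>: "\<And>i. i \<le> r \<Longrightarrow> 0 \<le> \<alpha> i"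
    and \<beta>: "beta_max r \<alpha> = ereal \<beta>" "real l < \<beta>" "\<beta> < real l + 1"
begin

lemma beta_at_le: "i \<le> r \<Longrightarrow> beta_at \<alpha> i \<le> ereal \<beta>"
  using \<beta>(1) unfolding beta_max_def by (metis Max_ge atLeastAtMost_iff finite_atLeastAtMost finite_imageI imageI le0)

lemma obtain_maximizer:
  obtains i where "i \<le> r" "beta_at \<alpha> i = ereal \<beta>"
proof -
  have "beta_max r \<alpha> \<in> beta_at \<alpha> ` {0..r}" unfolding beta_max_def by (intro Max_in) auto
  then show thesis using \<beta>(1) that by force
qed

text \<open>Non-negativity of \<alpha>_i gives \<beta> \<le> i + 1; as \<beta> exceeds
  \<open>l\<close>, the dimension is at least \<open>l\<close>.\<close>

lemma maximizer:
  assumes "i \<le> r" "beta_at \<alpha> i = ereal \<beta>"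
  shows "\<alpha> i = ereal (real i + 1 - \<beta>)" "l \<le> i"
proof -
  show 1: "\<alpha> i = ereal (real i + 1 - \<beta>)"
    using assms(2) by (cases "\<alpha> i") (auto simp: beta_at_def)
  then have "0 \<le> real i + 1 - \<beta>" using \<alpha>[OF assms(1)] by simp
  then show "l \<le> i" using \<beta>(2) by linarith
qed

section \<open>The Betti number in degree \<open>l\<close>\<close>

text \<open>For an i-simplex this is \<open>i choose l\<close>, the rank of its
  \<open>l\<close>-chains modulo boundaries: what an isolated simplex would contribute if
  \<open>(l - 1)\<close>-faces imposed no cycle condition.\<close>

definition face_weight :: "nat set \<Rightarrow> real" where
  "face_weight \<sigma> = real ((card \<sigma> - 1) choose l)"

definition mean_weight :: "nat \<Rightarrow> real" where
  "mean_weight n = (\<Sum>\<sigma>\<in>simplices r n. face_weight \<sigma> * simplex_prob \<alpha> n \<sigma>)"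

lemma mean_weight_eq:
  "mean_weight n = (\<Sum>i\<le>r. real (Suc n choose Suc i) * real (i choose l) * inclusion_prob n (\<alpha> i))"
proof -
  have "mean_weight n = (\<Sum>i\<le>r. \<Sum>\<sigma>\<in>{\<sigma>\<in>simplices r n. card \<sigma> - 1 = i}. face_weight \<sigma> * simplex_prob \<alpha> n \<sigma>)"
    unfolding mean_weight_def using finite_simplices simplicesD(4) by (intro sum.group[symmetric]) fastforce+
  also have "\<dots> = (\<Sum>i\<le>r. real (Suc n choose Suc i) * real (i choose l) * inclusion_prob n (\<alpha> i))"
  proof (rule sum.cong[OF refl])
    fix i assume i: "i \<in> {..r}"
    have eq: "{\<sigma>\<in>simplices r n. card \<sigma> - 1 = i} = {\<sigma>. \<sigma> \<subseteq> {0..n} \<and> card \<sigma> = Suc i}"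
    proof (intro equalityI subsetI)
      fix \<sigma> assume \<sigma>: "\<sigma> \<in> {\<sigma>\<in>simplices r n. card \<sigma> - 1 = i}"
      then have "\<sigma> \<in> simplices r n" by simp
      then show "\<sigma> \<in> {\<sigma>. \<sigma> \<subseteq> {0..n} \<and> card \<sigma> = Suc i}" using simplicesD(3,5)[of \<sigma> r n] \<sigma> by simp
    next
      fix \<sigma> assume \<sigma>: "\<sigma> \<in> {\<sigma>. \<sigma> \<subseteq> {0..n} \<and> card \<sigma> = Suc i}"
      then have "\<sigma> \<noteq> {}" by auto
      then show "\<sigma> \<in> {\<sigma>\<in>simplices r n. card \<sigma> - 1 = i}"
        using \<sigma> i by (simp add: simplices_def dimension_def)
    qed
    have "(\<Sum>\<sigma>\<in>{\<sigma>\<in>simplices r n. card \<sigma> - 1 = i}. face_weight \<sigma> * simplex_prob \<alpha> n \<sigma>) =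
        (\<Sum>\<sigma>\<in>{\<sigma>. \<sigma> \<subseteq> {0..n} \<and> card \<sigma> = Suc i}. real (i choose l) * inclusion_prob n (\<alpha> i))"
      unfolding eq by (intro sum.cong refl) (simp add: face_weight_def simplex_prob_eq)
    also have "\<dots> = real (Suc n choose Suc i) * real (i choose l) * inclusion_prob n (\<alpha> i)"
      using n_subsets[of "{0..n}" "Suc i"] by (simp only: sum_constant) simp
    finally show "(\<Sum>\<sigma>\<in>{\<sigma>\<in>simplices r n. card \<sigma> - 1 = i}. face_weight \<sigma> * simplex_prob \<alpha> n \<sigma>) =
        real (Suc n choose Suc i) * real (i choose l) * inclusion_prob n (\<alpha> i)" .
  qed
  finally show ?thesis .
qed

text \<open>The dimension \<open>i\<close> contributes \<open>(i choose l) / fact (Suc i)\<close>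
  times n to the power \<beta>_i, so only maximisers survive. Cancelling factorials in this
  coefficient produces the summands of \<open>d_coeff\<close>.\<close>

lemma tendsto_mean_weight: "(\<lambda>n. mean_weight n / real n powr \<beta>) \<longlonglongrightarrow> d_coeff r \<alpha> l"
proof -
  define L where "L i = (if beta_at \<alpha> i = ereal \<beta> then real (i choose l) / fact (Suc i) else 0)" for i
  have limit: "(\<lambda>n. real (Suc n choose Suc i) * real (i choose l) * inclusion_prob n (\<alpha> i) / real n powr \<beta>)
      \<longlonglongrightarrow> L i" if i: "i \<le> r" for i
  proof (cases "\<alpha> i")
    case (real x)
    have le: "real i + 1 - x \<le> \<beta>" using beta_at_le[OF i] real by (simp add: beta_at_def)
    have L: "L i = real (i choose l) * (1 / fact (Suc i)) * (if real i + 1 - x = \<beta> then 1 else 0)"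
      using real by (simp add: L_def beta_at_def)
    have "(\<lambda>n. real n powr (real i + 1 - x - \<beta>)) \<longlonglongrightarrow> (if real i + 1 - x = \<beta> then 1 else 0)"
    proof (cases "real i + 1 - x = \<beta>")
      case True
      have "\<forall>\<^sub>F n in sequentially. 1 = real n powr (real i + 1 - x - \<beta>)"
        using eventually_ge_at_top[of 1] by eventually_elim (use True in simp)
      then have "(\<lambda>n. real n powr (real i + 1 - x - \<beta>)) \<longlonglongrightarrow> 1"
        by (rule Lim_transform_eventually[OF tendsto_const])
      then show ?thesis by (simp add: True)
    next
      case False
      then have "(\<lambda>n. real n powr (real i + 1 - x - \<beta>)) \<longlonglongrightarrow> 0"
        using le by (intro tendsto_neg_powr filterlim_real_sequentially) linarith
      then show ?thesis by (simp only: False if_False)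
    qed
    then have "(\<lambda>n. real (i choose l) * (real (Suc n choose Suc i) / real n ^ Suc i) * real n powr (real i + 1 - x - \<beta>))
        \<longlonglongrightarrow> L i"
      unfolding L by (rule tendsto_mult[OF tendsto_mult[OF tendsto_const tendsto_binomial_over_power]])
    moreover have "\<forall>\<^sub>F n in sequentially.
        real (i choose l) * (real (Suc n choose Suc i) / real n ^ Suc i) * real n powr (real i + 1 - x - \<beta>) =
        real (Suc n choose Suc i) * real (i choose l) * inclusion_prob n (\<alpha> i) / real n powr \<beta>"
      using eventually_ge_at_top[of 1]
    proof eventually_elim
      case (elim n)
      have "real n powr (real i + 1 - x - \<beta>) = real n powr real (Suc i) * real n powr - x / real n powr \<beta>"
      proof -
        have "real i + 1 - x - \<beta> = real (Suc i) + (- x) - \<beta>" by simp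
        then show ?thesis by (simp only: powr_diff powr_add)
      qed
      moreover have "real n powr real (Suc i) = real n ^ Suc i"
        using elim by (simp only: powr_realpow of_nat_0_less_iff)
      ultimately show ?case using elim real by (simp add: inclusion_prob_def)
    qed
    ultimately show ?thesis by (rule Lim_transform_eventually)
  next
    case PInf
    then show ?thesis by (simp add: L_def beta_at_def inclusion_prob_def)
  qed (use \<alpha>[OF i] in simp)
  have "(\<lambda>n. \<Sum>i\<le>r. real (Suc n choose Suc i) * real (i choose l) * inclusion_prob n (\<alpha> i) / real n powr \<beta>)
      \<longlonglongrightarrow> (\<Sum>i\<le>r. L i)"
    using limit by (intro tendsto_sum) simp
  moreover have "(\<Sum>i\<le>r. L i) = d_coeff r \<alpha> l"
  proof -
    have "d_coeff r \<alpha> l = (\<Sum>i\<in>{i\<in>{..r}. beta_at \<alpha> i = ereal \<beta>}. 1 / ((real i + 1) * fact l * fact (i - l)))"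
      unfolding d_coeff_def \<beta>(1) by (rule sum.cong) auto
    also have "\<dots> = (\<Sum>i\<in>{i\<in>{..r}. beta_at \<alpha> i = ereal \<beta>}. real (i choose l) / fact (Suc i))"
    proof (rule sum.cong[OF refl])
      fix i assume "i \<in> {i\<in>{..r}. beta_at \<alpha> i = ereal \<beta>}"
      then have "l \<le> i" using maximizer(2) by simp
      then have "real (i choose l) = fact i / (fact l * fact (i - l))" by (rule binomial_fact)
      moreover have "fact (Suc i) = (real i + 1) * fact i" by (simp add: algebra_simps)
      ultimately show "1 / ((real i + 1) * fact l * fact (i - l)) = real (i choose l) / fact (Suc i)"
        by (simp only: divide_divide_eq_left) (simp add: divide_simps)
    qed
    also have "\<dots> = (\<Sum>i\<le>r. L i)" unfolding L_def by (rule sum.inter_filter) simp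
    finally show ?thesis by simp
  qed
  ultimately show ?thesis unfolding mean_weight_eq by (simp add: sum_divide_distrib)
qed

lemma d_coeff_pos: "0 < d_coeff r \<alpha> l"
proof -
  obtain i where "i \<le> r" "beta_at \<alpha> i = ereal \<beta>" by (rule obtain_maximizer)
  then have "{i. i \<le> r \<and> beta_at \<alpha> i = beta_max r \<alpha>} \<noteq> {}" using \<beta>(1) by auto
  then show ?thesis unfolding d_coeff_def by (intro sum_pos) (auto intro: add_nonneg_pos)
qed

text \<open>The upper estimate has no error term. For the lower one, Pascal's rule turns the number
  of \<open>l\<close>-faces minus the bound for the rank of boundaries into the sum of weights; the
  errors come from faces counted in several simplices and from the \<open>l\<close>-subsets of the
  vertices.\<close>

lemma betti_deviation_le:
  assumes X: "X \<in> set_pmf (random_subset (simplices r n) p)"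
  shows "\<bar>real (betti (int l) (generated_complex X)) - (\<Sum>\<sigma>\<in>X. face_weight \<sigma>)\<bar> \<le>
    2 ^ Suc r * real (card (overlaps (Suc l) (Suc l) X)) + real (Suc n choose l)"
proof -
  note X' = set_random_hypergraphD[OF X]
  let ?b = "betti (int l) (generated_complex X)" and ?O = "card (overlaps (Suc l) (Suc l) X)"
  have w: "(\<Sum>\<sigma>\<in>X. face_weight \<sigma>) = real (\<Sum>\<sigma>\<in>X. (card \<sigma> - 1) choose l)" by (simp add: face_weight_def)
  have 1: "?b \<le> (\<Sum>\<sigma>\<in>X. (card \<sigma> - 1) choose l)"
    by (rule betti_generated_le[OF X'(1,2)])
  have 2: "card (faces (generated_complex X) (l + 1)) \<le> ?b + (\<Sum>\<sigma>\<in>X. (card \<sigma> - 1) choose (l + 1)) + (Suc n choose l)"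
    using betti_generated_ge[OF X'(1,2), of "{0..n}" l] X'(4) by auto
  have 3: "(\<Sum>\<sigma>\<in>X. card \<sigma> choose (l + 1)) \<le> card (faces (generated_complex X) (l + 1)) + 2 ^ Suc r * ?O"
    using sum_choose_le_card_faces[OF X'(1,2,3), of "l + 1"] by simp
  have 4: "(\<Sum>\<sigma>\<in>X. card \<sigma> choose (l + 1)) = (\<Sum>\<sigma>\<in>X. (card \<sigma> - 1) choose l) + (\<Sum>\<sigma>\<in>X. (card \<sigma> - 1) choose (l + 1))"
  proof -
    have "card \<sigma> choose (l + 1) = ((card \<sigma> - 1) choose l) + ((card \<sigma> - 1) choose (l + 1))" if "\<sigma> \<in> X" for \<sigma>
    proof -
      have "card \<sigma> = Suc (card \<sigma> - 1)" using X'(2)[OF that] by (simp add: card_gt_0_iff)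
      then show ?thesis by (metis binomial_Suc_Suc Suc_eq_plus1)
    qed
    then show ?thesis by (simp add: sum.distrib)
  qed
  have "(\<Sum>\<sigma>\<in>X. (card \<sigma> - 1) choose l) \<le> ?b + (2 ^ Suc r * ?O + (Suc n choose l))"
    using 2 3 4 by linarith
  then have "real (\<Sum>\<sigma>\<in>X. (card \<sigma> - 1) choose l) \<le> real (?b + (2 ^ Suc r * ?O + (Suc n choose l)))"
    by (rule of_nat_mono)
  moreover have "real ?b \<le> real (\<Sum>\<sigma>\<in>X. (card \<sigma> - 1) choose l)" using 1 by (rule of_nat_mono)
  ultimately show ?thesis unfolding w by simp
qed

lemma aas_sim_betti:
  "aas_sim (upper_model r \<alpha>) (\<lambda>Y. real (betti (int l) Y)) (\<lambda>n. d_coeff r \<alpha> l * real n powr \<beta>)"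
proof -
  let ?H = "\<lambda>n. random_subset (simplices r n) (simplex_prob \<alpha> n)"
  let ?d = "d_coeff r \<alpha> l"
  define m where "m n = mean_weight n / real n powr \<beta>" for n
  define K where "K = 2 ^ Suc l * (real (Suc r) * 2 ^ Suc r)\<^sup>2"
  \<comment> \<open>Relative errors, in order: fluctuation of the weight sum, convergence of its
    mean, overlaps, and faces with \<open>l\<close> vertices. The last two vanish because \<beta> <
    l + 1 and \<beta> > l respectively.\<close>
  define \<delta> where "\<delta> n = sqrt (2 ^ Suc r * m n) * real n powr (- \<beta> / 2) / ?d + \<bar>m n / ?d - 1\<bar> +
    2 ^ Suc r * K * real n powr (\<beta> - real l - 1) / ?d + 2 ^ l * real n powr (real l - \<beta>) / ?d" for n
  note d = d_coeff_pos
  have m: "m \<longlonglongrightarrow> ?d" unfolding m_def by (rule tendsto_mean_weight)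
  have powr0: "(\<lambda>n. real n powr e) \<longlonglongrightarrow> 0" if "e < 0" for e
    using that by (intro tendsto_neg_powr filterlim_real_sequentially)
  have "(\<lambda>n. sqrt (2 ^ Suc r * m n) * real n powr (- \<beta> / 2) / ?d + \<bar>m n / ?d - 1\<bar> +
    2 ^ Suc r * K * real n powr (\<beta> - real l - 1) / ?d + 2 ^ l * real n powr (real l - \<beta>) / ?d) \<longlonglongrightarrow>
    sqrt (2 ^ Suc r * ?d) * 0 / ?d + \<bar>?d / ?d - 1\<bar> + 2 ^ Suc r * K * 0 / ?d + 2 ^ l * 0 / ?d"
    using d \<beta>(2,3) by (intro tendsto_intros m powr0) auto
  then have lim: "\<delta> \<longlonglongrightarrow> 0" using d by (simp add: \<delta>_def[abs_def])
  show ?thesis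
  proof (rule aas_sim_if_expectation[OF _ _ lim])
    show "finite (set_pmf (upper_model r \<alpha> n))" for n
      unfolding upper_model_def random_hypergraph_eq
      using finite_set_random_subset[OF finite_simplices] by simp
    show "\<forall>\<^sub>F n in sequentially. measure_pmf.expectation (upper_model r \<alpha> n)
        (\<lambda>Y. \<bar>real (betti (int l) Y) / (?d * real n powr \<beta>) - 1\<bar>) \<le> \<delta> n"
      using eventually_ge_at_top[of 1]
    proof eventually_elim
      case (elim n)
      let ?E = "measure_pmf.expectation (?H n)" and ?D = "?d * real n powr \<beta>"
      let ?U = "\<lambda>X. \<Sum>\<sigma>\<in>X. face_weight \<sigma>" and ?O = "\<lambda>X. real (card (overlaps (Suc l) (Suc l) X))"
      note A = finite_simplices[of r n]
      have int: "integrable (measure_pmf (?H n)) (f :: _ \<Rightarrow> real)" for f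
        using finite_set_random_subset[OF A] by (rule integrable_measure_pmf_finite)
      have pb: "0 \<le> simplex_prob \<alpha> n \<sigma> \<and> simplex_prob \<alpha> n \<sigma> \<le> 1" if "\<sigma> \<in> simplices r n" for \<sigma>
        using simplex_prob_bounds[of r \<alpha>] \<alpha> that by blast
      have n0: "0 < real n" using elim by simp
      then have D: "0 < ?D" using d by simp
      have choose: "real (Suc n choose l) \<le> 2 ^ l * real n ^ l"
      proof -
        have "Suc n choose l \<le> Suc n ^ l" by (rule binomial_le_power)
        also have "\<dots> \<le> (2 * n) ^ l" using elim by (intro power_mono) auto
        finally have "real (Suc n choose l) \<le> real ((2 * n) ^ l)" by (rule of_nat_mono)
        then show ?thesis by (simp add: power_mult_distrib)
      qed
      have "measure_pmf.expectation (upper_model r \<alpha> n) (\<lambda>Y. \<bar>real (betti (int l) Y) / ?D - 1\<bar>) =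
          ?E (\<lambda>X. \<bar>real (betti (int l) (generated_complex X)) / ?D - 1\<bar>)"
        by (simp add: upper_model_def random_hypergraph_eq)
      also have "\<dots> \<le> ?E (\<lambda>X. (\<bar>?U X - mean_weight n\<bar> + \<bar>mean_weight n - ?D\<bar> + 2 ^ Suc r * ?O X + 2 ^ l * real n ^ l) / ?D)"
      proof (intro integral_mono_AE int AE_pmfI)
        fix X assume X: "X \<in> set_pmf (?H n)"
        let ?b = "real (betti (int l) (generated_complex X))"
        have "\<bar>?b - ?U X\<bar> \<le> 2 ^ Suc r * ?O X + 2 ^ l * real n ^ l"
          using betti_deviation_le[OF X] choose by linarith
        then have "\<bar>?b - ?D\<bar> \<le> \<bar>?U X - mean_weight n\<bar> + \<bar>mean_weight n - ?D\<bar> + 2 ^ Suc r * ?O X + 2 ^ l * real n ^ l"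
          by linarith
        moreover have "\<bar>?b / ?D - 1\<bar> = \<bar>?b - ?D\<bar> / ?D"
        proof -
          have "?b / ?D - 1 = (?b - ?D) / ?D" using D by (simp only: diff_divide_distrib divide_self)
          then show ?thesis using D by (simp only: abs_divide abs_of_pos)
        qed
        ultimately show "\<bar>?b / ?D - 1\<bar> \<le> (\<bar>?U X - mean_weight n\<bar> + \<bar>mean_weight n - ?D\<bar> + 2 ^ Suc r * ?O X + 2 ^ l * real n ^ l) / ?D"
          using D by (simp only: divide_right_mono less_imp_le)
      qed
      also have "\<dots> = (?E (\<lambda>X. \<bar>?U X - mean_weight n\<bar>) + \<bar>mean_weight n - ?D\<bar> + 2 ^ Suc r * ?E ?O + 2 ^ l * real n ^ l) / ?D"
        by (simp add: int)
      also have "\<dots> \<le> (sqrt (2 ^ Suc r * mean_weight n) + \<bar>mean_weight n - ?D\<bar> +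
          2 ^ Suc r * (K * real n powr (2 * \<beta> - real (Suc l))) + 2 ^ l * real n ^ l) / ?D"
      proof (intro divide_right_mono add_mono mult_left_mono order_refl)
        have "?E (\<lambda>X. \<bar>?U X - mean_weight n\<bar>) \<le> sqrt (\<Sum>\<sigma>\<in>simplices r n. (face_weight \<sigma>)\<^sup>2 * simplex_prob \<alpha> n \<sigma>)"
          unfolding mean_weight_def by (rule expectation_abs_deviation_le[OF A pb])
        also have "\<dots> \<le> sqrt (2 ^ Suc r * mean_weight n)"
        proof (rule real_sqrt_le_mono)
          \<comment> \<open>Weights are bounded by \<open>2 ^ Suc r\<close>, so the second moment
            sum is at most a constant times the mean, which has order n^\<beta>.\<close>
          have "(\<Sum>\<sigma>\<in>simplices r n. (face_weight \<sigma>)\<^sup>2 * simplex_prob \<alpha> n \<sigma>) \<le>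
              (\<Sum>\<sigma>\<in>simplices r n. 2 ^ Suc r * (face_weight \<sigma> * simplex_prob \<alpha> n \<sigma>))"
          proof (rule sum_mono)
            fix \<sigma> assume \<sigma>: "\<sigma> \<in> simplices r n"
            have "(card \<sigma> - 1) choose l \<le> 2 ^ (card \<sigma> - 1)" by (rule binomial_le_pow2)
            also have "\<dots> \<le> 2 ^ Suc r" using simplicesD(4)[OF \<sigma>] by (intro power_increasing) auto
            finally have "real ((card \<sigma> - 1) choose l) \<le> real (2 ^ Suc r)" by (rule of_nat_mono)
            then have "face_weight \<sigma> \<le> 2 ^ Suc r" by (simp add: face_weight_def)
            moreover have "0 \<le> face_weight \<sigma> * simplex_prob \<alpha> n \<sigma>" using pb[OF \<sigma>] by (simp add: face_weight_def)
            ultimately have "face_weight \<sigma> * (face_weight \<sigma> * simplex_prob \<alpha> n \<sigma>) \<le> 2 ^ Suc r * (face_weight \<sigma> * simplex_prob \<alpha> n \<sigma>)"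
              by (rule mult_right_mono)
            then show "(face_weight \<sigma>)\<^sup>2 * simplex_prob \<alpha> n \<sigma> \<le> 2 ^ Suc r * (face_weight \<sigma> * simplex_prob \<alpha> n \<sigma>)"
              by (simp only: power2_eq_square mult.assoc)
          qed
          then show "(\<Sum>\<sigma>\<in>simplices r n. (face_weight \<sigma>)\<^sup>2 * simplex_prob \<alpha> n \<sigma>) \<le> 2 ^ Suc r * mean_weight n"
            by (simp only: mean_weight_def sum_distrib_left)
        qed
        finally show "?E (\<lambda>X. \<bar>?U X - mean_weight n\<bar>) \<le> sqrt (2 ^ Suc r * mean_weight n)" .
        show "?E ?O \<le> K * real n powr (2 * \<beta> - real (Suc l))"
          unfolding K_def by (rule expectation_overlaps_le[OF \<alpha> elim]) (use beta_at_le in auto)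
        show "0 \<le> ?D" using D by simp
      qed simp_all
      also have "\<dots> = \<delta> n"
      proof -
        have 1: "sqrt (2 ^ Suc r * mean_weight n) / ?D = sqrt (2 ^ Suc r * m n) * real n powr (- \<beta> / 2) / ?d"
        proof -
          have "sqrt (2 ^ Suc r * mean_weight n) = sqrt (2 ^ Suc r * m n * real n powr \<beta>)"
            using n0 by (simp add: m_def)
          also have "\<dots> = sqrt (2 ^ Suc r * m n) * sqrt (real n powr \<beta>)" by (rule real_sqrt_mult)
          also have "sqrt (real n powr \<beta>) = real n powr (\<beta> / 2)"
            using n0 by (simp add: powr_half_sqrt[symmetric] powr_powr)
          also have "sqrt (2 ^ Suc r * m n) * real n powr (\<beta> / 2) / ?D =
              sqrt (2 ^ Suc r * m n) * (real n powr (\<beta> / 2) / real n powr \<beta>) / ?d"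
            by (simp only: times_divide_eq_right divide_divide_eq_left mult.commute)
          also have "real n powr (\<beta> / 2) / real n powr \<beta> = real n powr (- \<beta> / 2)"
            by (simp add: powr_diff[symmetric] field_simps)
          finally show ?thesis .
        qed
        have 2: "\<bar>mean_weight n - ?D\<bar> / ?D = \<bar>m n / ?d - 1\<bar>"
        proof -
          have "m n / ?d - 1 = (mean_weight n - ?D) / ?D"
            using n0 d by (simp add: m_def field_simps)
          then show ?thesis using D by (simp only: abs_divide abs_of_pos)
        qed
        have 3: "2 ^ Suc r * (K * real n powr (2 * \<beta> - real (Suc l))) / ?D =
            2 ^ Suc r * K * real n powr (\<beta> - real l - 1) / ?d"
        proof -
          have "real n powr (2 * \<beta> - real (Suc l)) = real n powr (\<beta> - real l - 1) * real n powr \<beta>"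
            by (simp add: powr_add[symmetric] algebra_simps)
          then show ?thesis using n0 d by (simp add: field_simps)
        qed
        have 4: "2 ^ l * real n ^ l / ?D = 2 ^ l * real n powr (real l - \<beta>) / ?d"
        proof -
          have "real n powr (real l - \<beta>) = real n ^ l / real n powr \<beta>"
            using n0 by (simp add: powr_diff powr_realpow)
          then show ?thesis using n0 d by (simp add: field_simps)
        qed
        show ?thesis unfolding \<delta>_def by (simp only: add_divide_distrib 1 2 3 4)
      qed
      finally show ?case .
    qed
  qed
qed

section \<open>Overlaps and Betti numbers in degrees above \<open>l\<close>\<close>

lemma aas_no_overlaps:
  assumes k: "0 < k" and nu: "k \<le> r \<Longrightarrow> nu_at r \<alpha> k < 0"
  shows "aas (\<lambda>n. random_subset (simplices r n) (simplex_prob \<alpha> n)) (\<lambda>n X. overlaps (k + 1) k X = {})"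
proof -
  let ?H = "\<lambda>n. random_subset (simplices r n) (simplex_prob \<alpha> n)"
  \<comment> \<open>The expectation bound needs a real \<open>g\<close>, but \<gamma>_k may be
    -\<infinity>, or \<open>k\<close> may exceed \<open>r\<close>. In these cases anything below k /
    2 serves.\<close>
  obtain g where g: "2 * g - real k < 0" "\<And>i. i \<le> r \<Longrightarrow> k + 1 \<le> Suc i \<Longrightarrow> beta_at \<alpha> i \<le> ereal g"
  proof (cases "k \<le> r")
    case True
    have le: "beta_at \<alpha> i \<le> gamma_at r \<alpha> k" if "i \<le> r" "k + 1 \<le> Suc i" for i
      unfolding gamma_at_def using that by (intro Max_ge) auto
    show thesis
    proof (cases "gamma_at r \<alpha> k")
      case (real g)
      have "2 * g - real k < 0" using nu[OF True] real by (simp add: nu_at_def)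
      then show thesis using that[of g] le real by simp
    next
      case PInf
      then show thesis using nu[OF True] by (simp add: nu_at_def)
    next
      case MInf
      show thesis
      proof (rule that[of "real k / 2 - 1"])
        fix i assume "i \<le> r" "k + 1 \<le> Suc i"
        then have "beta_at \<alpha> i \<le> - \<infinity>" using le MInf by metis
        then show "beta_at \<alpha> i \<le> ereal (real k / 2 - 1)" by simp
      qed simp
    qed
  next
    case False
    then show thesis using that[of "real k / 2 - 1"] by simp
  qed
  define K where "K = 2 ^ k * (real (Suc r) * 2 ^ Suc r)\<^sup>2"
  have "aas ?H (\<lambda>n X. real (card (overlaps (k + 1) k X)) < 1)"
  proof (rule aas_le_if_expectation)
    show "finite (set_pmf (?H n))" for n by (rule finite_set_random_subset[OF finite_simplices])
    show "\<forall>\<^sub>F n in sequentially. measure_pmf.expectation (?H n) (\<lambda>X. real (card (overlaps (k + 1) k X))) \<le>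
        K * real n powr (2 * g - real k)"
      using eventually_ge_at_top[of 1]
    proof eventually_elim
      case (elim n)
      show ?case unfolding K_def by (rule expectation_overlaps_le[OF \<alpha> elim]) (use g in auto)
    qed
    have "(\<lambda>n. real n powr (2 * g - real k)) \<longlonglongrightarrow> 0"
      using g(1) by (intro tendsto_neg_powr filterlim_real_sequentially)
    then show "(\<lambda>n. K * real n powr (2 * g - real k) / 1) \<longlonglongrightarrow> 0"
      by (simp add: tendsto_mult_right_zero)
  qed simp_all
  then show ?thesis
  proof (rule aas_mono, intro always_eventually allI ballI impI)
    fix n X assume X: "X \<in> set_pmf (?H n)" "real (card (overlaps (k + 1) k X)) < 1"
    then have "card (overlaps (k + 1) k X) = 0" by simp
    then show "overlaps (k + 1) k X = {}" using finite_overlaps[OF set_random_hypergraphD(1)[OF X(1)]] by simp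
  qed
qed

text \<open>Markov's inequality at \<omega> times the order of the mean; the constant factors are
  absorbed because \<omega> tends to infinity.\<close>

lemma aas_betti_le:
  assumes k: "0 < k" "k \<le> r" and g: "gamma_at r \<alpha> k = ereal g" and \<omega>: "filterlim \<omega> at_top sequentially"
  shows "aas (\<lambda>n. random_subset (simplices r n) (simplex_prob \<alpha> n)) (\<lambda>n X.
    real (betti (int k) (generated_complex X)) \<le> \<omega> n * real n powr (2 * g - real k))"
proof -
  let ?H = "\<lambda>n. random_subset (simplices r n) (simplex_prob \<alpha> n)"
  have le: "beta_at \<alpha> i \<le> ereal g" if "i \<le> r" "k + 1 \<le> Suc i" for i
    using that unfolding g[symmetric] gamma_at_def by (intro Max_ge) auto
  define K where "K = 2 ^ k * (real (Suc r) * 2 ^ Suc r)\<^sup>2"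
  have "aas ?H (\<lambda>n X. 2 ^ Suc r * real (card (overlaps (k + 1) k X)) < \<omega> n * real n powr (2 * g - real k))"
  proof (rule aas_le_if_expectation)
    show "finite (set_pmf (?H n))" for n by (rule finite_set_random_subset[OF finite_simplices])
    show "\<forall>\<^sub>F n in sequentially. measure_pmf.expectation (?H n) (\<lambda>X. 2 ^ Suc r * real (card (overlaps (k + 1) k X))) \<le>
        2 ^ Suc r * (K * real n powr (2 * g - real k))"
      using eventually_ge_at_top[of 1]
    proof eventually_elim
      case (elim n)
      have "measure_pmf.expectation (?H n) (\<lambda>X. real (card (overlaps (k + 1) k X))) \<le> K * real n powr (2 * g - real k)"
        unfolding K_def by (rule expectation_overlaps_le[OF \<alpha> elim]) (use le in auto)
      then show ?case by simp
    qed
    show "\<forall>\<^sub>F n in sequentially. 0 < \<omega> n * real n powr (2 * g - real k)"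
      using eventually_ge_at_top[of 1] filterlim_at_top_dense[THEN iffD1, OF \<omega>, rule_format, of 0]
      by eventually_elim simp
    have "(\<lambda>n. 2 ^ Suc r * K * inverse (\<omega> n)) \<longlonglongrightarrow> 2 ^ Suc r * K * 0"
      using \<omega> by (intro tendsto_intros tendsto_inverse_0_at_top)
    moreover have "\<forall>\<^sub>F n in sequentially. 2 ^ Suc r * K * inverse (\<omega> n) =
        2 ^ Suc r * (K * real n powr (2 * g - real k)) / (\<omega> n * real n powr (2 * g - real k))"
      using eventually_ge_at_top[of 1] by eventually_elim (simp add: divide_inverse)
    ultimately have "(\<lambda>n. 2 ^ Suc r * (K * real n powr (2 * g - real k)) / (\<omega> n * real n powr (2 * g - real k))) \<longlonglongrightarrow> 2 ^ Suc r * K * 0"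
      by (rule Lim_transform_eventually)
    then show "(\<lambda>n. 2 ^ Suc r * (K * real n powr (2 * g - real k)) / (\<omega> n * real n powr (2 * g - real k))) \<longlonglongrightarrow> 0"
      by simp
  qed simp
  then show ?thesis
  proof (rule aas_mono, intro always_eventually allI ballI impI)
    fix n X assume X: "X \<in> set_pmf (?H n)"
      "2 ^ Suc r * real (card (overlaps (k + 1) k X)) < \<omega> n * real n powr (2 * g - real k)"
    have "betti (int k) (generated_complex X) \<le> 2 ^ Suc r * card (overlaps (k + 1) k X)"
      by (rule betti_le_overlaps[OF set_random_hypergraphD(1,2,3)[OF X(1)] k(1)])
    then have "real (betti (int k) (generated_complex X)) \<le> real (2 ^ Suc r * card (overlaps (k + 1) k X))"
      by (rule of_nat_mono)
    then show "real (betti (int k) (generated_complex X)) \<le> \<omega> n * real n powr (2 * g - real k)"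
      using X(2) by simp
  qed
qed

end

lemma nu_at_Suc_le:
  assumes "k < r"
  shows "nu_at r \<alpha> (k + 1) \<le> nu_at r \<alpha> k - 1"
proof -
  have "gamma_at r \<alpha> (k + 1) \<le> gamma_at r \<alpha> k"
    unfolding gamma_at_def using assms by (intro Max_mono image_mono) auto
  then show ?thesis
    unfolding nu_at_def by (cases "gamma_at r \<alpha> (k + 1)"; cases "gamma_at r \<alpha> k") (auto simp: one_ereal_def)
qed

theorem theorem2p3:
  fixes r l l' :: nat and \<alpha> :: "nat \<Rightarrow> ereal" and \<beta> :: real
  assumes alpha_nonneg: "\<And>i. i \<le> r \<Longrightarrow> 0 \<le> \<alpha> i"
    and beta: "beta_max r \<alpha> = ereal \<beta>"
    and beta_pos: "0 < \<beta>"
    and beta_not_int: "\<beta> \<notin> \<int>"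
    and l: "l = nat \<lfloor>\<beta>\<rfloor>"
    and l': "l' = ell' r \<alpha>"
  shows
    "aas (upper_model r \<alpha>) (\<lambda>n Y.
        has_full_skeleton n (int l - 1) Y \<and>
        collapses_into_skeleton (int l') Y)
     \<and> l \<le> l' \<and> int l' \<le> \<lfloor>2 * \<beta>\<rfloor> \<and> \<lfloor>2 * \<beta>\<rfloor> \<le> 2 * int l + 1
     \<and> (l + 1 \<le> r \<longrightarrow> nu_at r \<alpha> (l + 1) < ereal \<beta>)
     \<and> (\<forall>k<r. nu_at r \<alpha> (k + 1) \<le> nu_at r \<alpha> k - 1)
     \<and> (\<forall>\<omega> :: nat \<Rightarrow> real. filterlim \<omega> at_top sequentially \<longrightarrow>
          aas_sim (upper_model r \<alpha>) (\<lambda>Y. real (betti (int l) Y))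
            (\<lambda>n. d_coeff r \<alpha> l * real n powr \<beta>) \<and>
          aas (upper_model r \<alpha>) (\<lambda>n Y.
            (\<forall>k < int l. trivial_group (reduced_face_homology k Y)) \<and>
            (\<forall>k. l < k \<and> k \<le> l' \<longrightarrow>
               real (betti (int k) Y) \<le> \<omega> n * real n powr real_of_ereal (nu_at r \<alpha> k)) \<and>
            (\<forall>k > int l'. trivial_group (reduced_face_homology k Y))))"
proof -
  let ?H = "\<lambda>n. random_subset (simplices r n) (simplex_prob \<alpha> n)"
  have upper: "upper_model r \<alpha> = (\<lambda>n. map_pmf generated_complex (?H n))"
    by (simp add: upper_model_def[abs_def] random_hypergraph_eq)
  have \<beta>l: "real l < \<beta>" "\<beta> < real l + 1"
  proof -
    have "real l = of_int \<lfloor>\<beta>\<rfloor>" using beta_pos by (simp add: l)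
    moreover have "of_int \<lfloor>\<beta>\<rfloor> \<noteq> \<beta>" using beta_not_int by (metis Ints_of_int)
    ultimately show "real l < \<beta>" "\<beta> < real l + 1" using of_int_floor_le[of \<beta>] by linarith+
  qed
  note setting = alpha_nonneg beta \<beta>l
  obtain i where i: "i \<le> r" "beta_at \<alpha> i = ereal \<beta>"
    using obtain_maximizer[OF setting] by blast
  note \<alpha>i = maximizer[OF setting i]
  have gamma_le: "gamma_at r \<alpha> k \<le> ereal \<beta>" if "k \<le> r" for k
    unfolding gamma_at_def using that beta_at_le[OF setting] by (subst Max_le_iff) auto
  \<comment> \<open>A maximising dimension is at least \<open>l\<close>, so restricting the maximum
    to \<open>{l..r}\<close> loses nothing.\<close>
  have gamma_l: "gamma_at r \<alpha> l = ereal \<beta>"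
  proof (rule antisym)
    show "gamma_at r \<alpha> l \<le> ereal \<beta>" using \<alpha>i(2) i(1) by (intro gamma_le) simp
    show "ereal \<beta> \<le> gamma_at r \<alpha> l"
      unfolding gamma_at_def i(2)[symmetric] using \<alpha>i(2) i(1) by (intro Max_ge) auto
  qed
  let ?S = "{k. k \<le> r \<and> 0 \<le> nu_at r \<alpha> k}"
  have finS: "finite ?S" by simp
  have lS: "l \<in> ?S" using \<alpha>i(2) i(1) \<beta>l by (simp add: nu_at_def gamma_l)
  have l'S: "l' \<in> ?S" unfolding l' ell'_def using finS lS by (intro Max_in) auto
  have ll': "l \<le> l'" unfolding l' ell'_def using finS lS by (rule Max_ge)
  have above_l': "nu_at r \<alpha> k < 0" if "l' < k" "k \<le> r" for k
  proof (rule ccontr)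
    assume "\<not> nu_at r \<alpha> k < 0"
    then have "k \<in> ?S" using that by (simp add: not_less)
    then have "k \<le> l'" unfolding l' ell'_def using finS by (intro Max_ge)
    then show False using that by simp
  qed
  \<comment> \<open>Ensures that \<open>real_of_ereal\<close> in the bounds of (e) is applied to
    finite values: \<gamma> decreases in \<open>k\<close>, is finite at \<open>l'\<close>, and never
    exceeds \<beta>.\<close>
  have gamma_real: "\<exists>g. gamma_at r \<alpha> k = ereal g" if "k \<le> l'" for k
  proof -
    have "gamma_at r \<alpha> l' \<le> gamma_at r \<alpha> k"
      unfolding gamma_at_def using that l'S by (intro Max_mono image_mono) auto
    moreover have "gamma_at r \<alpha> l' \<noteq> - \<infinity>" using l'S by (auto simp: nu_at_def)
    moreover have "gamma_at r \<alpha> k \<le> ereal \<beta>" using that l'S by (intro gamma_le) simp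
    ultimately show ?thesis by (cases "gamma_at r \<alpha> k") auto
  qed
  have l'_le: "int l' \<le> \<lfloor>2 * \<beta>\<rfloor>"
  proof -
    obtain g where g: "gamma_at r \<alpha> l' = ereal g" using gamma_real[of l'] by auto
    then have "g \<le> \<beta>" using gamma_le[of l'] l'S by simp
    moreover have "0 \<le> 2 * g - real l'" using l'S g by (simp add: nu_at_def)
    ultimately show ?thesis by (simp add: le_floor_iff)
  qed
  have floor_le: "\<lfloor>2 * \<beta>\<rfloor> \<le> 2 * int l + 1" using \<beta>l by (simp add: floor_le_iff)
  \<comment> \<open>Here \<nu> is at most 2 \<beta> - l - 1, and \<beta> < l + 1 makes this less
    than \<beta>.\<close>
  have nu_l: "nu_at r \<alpha> (l + 1) < ereal \<beta>" if "l + 1 \<le> r"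
    using gamma_le[OF that] \<beta>l unfolding nu_at_def by (cases "gamma_at r \<alpha> (l + 1)") auto
  let ?filled = "\<lambda>n X. \<forall>\<rho>. \<rho> \<subseteq> {0..n} \<longrightarrow> card \<rho> = Suc l \<longrightarrow> bd (frag_of \<rho>) \<in> boundary_span (sub_faces (Suc l) X)"
  \<comment> \<open>The absence of overlaps is required at \<open>k = l' + 1\<close>, the first
    degree with negative \<nu>, or the first beyond \<open>r\<close>; this yields a collapse into
    dimension \<open>l'\<close>.\<close>
  let ?sparse = "\<lambda>n::nat. \<lambda>X. overlaps (l' + 2) (l' + 1) X = {}"
  have filled: "aas ?H ?filled"
    by (rule aas_filled[where i = i and a = "real i + 1 - \<beta>" and b = \<beta>])
       (use alpha_nonneg i(1) \<alpha>i \<beta>l(1) in simp_all)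
  have "aas ?H (\<lambda>n X. overlaps (l' + 1 + 1) (l' + 1) X = {})"
    by (rule aas_no_overlaps[OF setting]) (use above_l' in simp_all)
  then have sparse: "aas ?H ?sparse" by simp
  have both: "aas ?H (\<lambda>n X. ?filled n X \<and> ?sparse n X)"
    using filled sparse by (rule aas_conj)
  have skeleton: "aas (upper_model r \<alpha>) (\<lambda>n Y.
      has_full_skeleton n (int l - 1) Y \<and> collapses_into_skeleton (int l') Y)"
    unfolding upper aas_map_pmf
  proof (rule aas_mono[OF both], rule eventually_mono[OF eventually_ge_at_top[of l]], intro ballI impI, elim conjE)
    fix n X assume n: "l \<le> n" and X: "X \<in> set_pmf (?H n)" and F: "?filled n X" and O: "?sparse n X"
    have "has_full_skeleton n (int l - 1) (generated_complex X)"
      by (rule full_skeleton_if_fill[OF set_random_hypergraphD(1,4)[OF X] n]) (use F in blast)+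
    moreover have "collapses_into_skeleton (int (l' + 1) - 1) (generated_complex X)"
      by (rule collapses_no_overlaps[OF set_random_hypergraphD(1,2,3)[OF X]]) (use O in simp_all)
    ultimately show "has_full_skeleton n (int l - 1) (generated_complex X) \<and>
        collapses_into_skeleton (int l') (generated_complex X)" by simp
  qed
  have homology: "aas (upper_model r \<alpha>) (\<lambda>n Y.
      (\<forall>k < int l. trivial_group (reduced_face_homology k Y)) \<and>
      (\<forall>k. l < k \<and> k \<le> l' \<longrightarrow> real (betti (int k) Y) \<le> \<omega> n * real n powr real_of_ereal (nu_at r \<alpha> k)) \<and>
      (\<forall>k > int l'. trivial_group (reduced_face_homology k Y)))"
    if \<omega>: "filterlim \<omega> at_top sequentially" for \<omega> :: "nat \<Rightarrow> real"
  proof -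
    let ?small = "\<lambda>k n X. real (betti (int k) (generated_complex X)) \<le> \<omega> n * real n powr real_of_ereal (nu_at r \<alpha> k)"
    have "aas ?H (\<lambda>n X. \<forall>k\<in>{l<..l'}. ?small k n X)"
    proof (rule aas_ball)
      fix k assume k: "k \<in> {l<..l'}"
      then obtain g where g: "gamma_at r \<alpha> k = ereal g" using gamma_real[of k] by auto
      have "nu_at r \<alpha> k = ereal (2 * g - real k)" using g by (simp add: nu_at_def)
      then show "aas ?H (?small k)"
        using aas_betti_le[OF setting _ _ g \<omega>] k l'S by simp
    qed simp
    with both have "aas ?H (\<lambda>n X. (?filled n X \<and> ?sparse n X) \<and> (\<forall>k\<in>{l<..l'}. ?small k n X))"
      by (rule aas_conj)
    then show ?thesis
      unfolding upper aas_map_pmf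
    proof (rule aas_mono, intro eventually_mono[OF eventually_ge_at_top[of l]] ballI impI, elim conjE)
      fix n X assume n: "l \<le> n" and X: "X \<in> set_pmf (?H n)" and F: "?filled n X" and O: "?sparse n X"
        and small: "\<forall>k\<in>{l<..l'}. ?small k n X"
      have low: "trivial_group (reduced_face_homology k (generated_complex X))" if "k < int l" for k
        by (rule trivial_homology_if_fill[OF set_random_hypergraphD(1,4)[OF X] n _ that]) (use F in blast)+
      have high: "trivial_group (reduced_face_homology k (generated_complex X))" if "int l' < k" for k
      proof -
        define k' where "k' = nat k"
        have k': "k = int k'" "l' < k'" using that by (simp_all add: k'_def)
        \<comment> \<open>Overlaps decrease in \<open>k\<close>, so one event serves all of the
          infinitely many degrees above \<open>l'\<close> at once.\<close>
        have "overlaps (k' + 1) k' X \<subseteq> overlaps (l' + 2) (l' + 1) X"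
          using k'(2) by (intro overlaps_mono) simp_all
        then have "overlaps (k' + 1) k' X = {}" using O by simp
        then show ?thesis
          unfolding k'(1) using k'(2) by (intro trivial_homology_no_overlaps[OF set_random_hypergraphD(1,2,3)[OF X]]) simp_all
      qed
      show "(\<forall>k < int l. trivial_group (reduced_face_homology k (generated_complex X))) \<and>
          (\<forall>k. l < k \<and> k \<le> l' \<longrightarrow> ?small k n X) \<and>
          (\<forall>k > int l'. trivial_group (reduced_face_homology k (generated_complex X)))"
        using low high small by simp
    qed
  qed
  show ?thesis
    using skeleton ll' l'_le floor_le nu_l nu_at_Suc_le homology aas_sim_betti[OF setting] by blast
qed

end
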